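(* Let $\delta>1/2$ and $H=H(\delta)$. Let $f_0$ be one-periodic with $f_0\in H^s_2$ for some $s>1/2$, and let $\Pi$ be a prior whose posterior $\Pi_n=\Pi(\cdot\mid\mathbb X^{(n)})$ is supported in the space $L^2([0,1))$ of one-periodic square-integrable functions, with posterior mean $\bar f_n\in L^2([0,1))$. Suppose that the weak Bernstein--von Mises phenomenon in $H$ holds at $f_0$, i.e. $\beta(\Pi_n\circ\tau_{\mathbb X^{(n)}}^{-1},\mathcal N)\to0$ in $P_{f_0}^n$-probability. Assume $$\|\bar f_n-\mathbb X^{(n)}\|_H=o_P(n^{-1/2}),$$ and that for some sequence $r_n=o(n^{-1/2})$, $$\|\bar f_n-f_0\|_2^2=O_P(r_n),\qquad \Pi_n(f:\|f-f_0\|_2^2>r_n)=o_P(1).$$ Let $0<\alpha<1$, let $\kappa:f\mapsto f\ast f$, let $R_n$ be such that $$\Pi_n\circ\kappa^{-1}\big(g:\|g-\bar f_n\ast\bar f_n\|_\infty\le R_n/\sqrt n\big)=1-\alpha,$$ and let $C_n=\{g:\|g-\bar f_n\ast\bar f_n\|_\infty\le R_n/\sqrt n\}$. Then, as $n\to\infty$, $$P_{f_0}^n(f_0\ast f_0\in C_n)\to1-\alpha\quad\text{and}\quad R_n=O_P(1).$$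
   Context: Convolution. $f\ast g(x)=\int_0^1 f(x-t)g(t)\,dt$ with subtraction modulo $1$ (convolution on the unit circle). $\kappa$ maps $L^2([0,1))$ (one-periodic functions) into the space $C([0,1))$ of continuous one-periodic functions with the uniform norm $\|\cdot\|_\infty$. Basis. $L^2=L^2([0,1])$, $\langle f,g\rangle=\int_0^1 f\bar g$. Fix an $S$-regular ($S\in\mathbb N$, $S>s$) orthonormal basis $\{\psi_{lk}: l\in\mathcal L,k\in\mathcal Z_l\}$ of $L^2$ ($\mathcal L,\mathcal Z_l\subset\mathbb Z$) with characteristic sequence $a_l$, meaning that every $\psi_{lk}$ is $S$-times differentiable with all derivatives in $L^2$ and either (a) $|\mathcal Z_l|=1$ and $a_l=\max(2,|l|)$, or (b) $\mathcal L\subset\mathbb N=\{1,2,\dots\}$ and $a_l=|\mathcal Z_l|=2^l$. For $0\le s<S$, $H^s_2=\{f\in L^2:\|f\|_{s,2}^2=\sum_l a_l^{2s}\sum_k|\langle\psi_{lk},f\rangle|^2<\infty\}$. It is assumed that the basis is such that $(\sum_{m\in\mathbb Z}|\hat f(m)|^2(1+|m|)^{2s})^{1/2}$, with $\hat f(m)$ the Fourier coefficients, is an equivalent norm on $H^s_2$. Space $H$. For $\delta>1/2$, $H(\delta)$ is the Hilbert space of linear forms $f$ on $\mathrm{span}\{\psi_{lk}\}$ (identified with their coefficients $\langle f,\psi_{lk}\rangle$) with $\|f\|_{H(\delta)}^2=\sum_{l}a_l^{-1}(\log a_l)^{-2\delta}\sum_{k}|\langle f,\psi_{lk}\rangle|^2<\infty$.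 It contains $L^2$. Standard white noise $\mathbb W$, with i.i.d. $N(0,1)$ coefficients in the basis, is a tight centered Gaussian Borel random variable in $H(\delta)$; its law is $\mathcal N$. Model. For $f\in L^2$, $P_f^n$ is the law of $\mathbb X^{(n)}=f+n^{-1/2}\mathbb W$ in $H(\delta)$. A prior $\Pi$ is a Borel probability measure on $L^2$; the posterior $\Pi_n=\Pi(\cdot\mid\mathbb X^{(n)})$ is the conditional law of $f$ given $\mathbb X^{(n)}$ when $f\sim\Pi$, $\mathbb X^{(n)}\mid f\sim P_f^n$ (Bayes' formula with likelihood $dP_f^n/dP_0^n=\exp(n\langle f,\mathbb X^{(n)}\rangle-\tfrac n2\|f\|_2^2)$), also viewed as a measure on $H(\delta)$; $\bar f_n=\int f\,d\Pi_n(f)$. The posterior is studied when $\mathbb X^{(n)}\sim P_{f_0}^n$; $o_P,O_P$ refer to $P_{f_0}^n$. Weak Bernstein--von Mises phenomenon. $\tau_z(f)=\sqrt n(f-z)$; $\beta$ is the bounded Lipschitz metric on Borel probability measures on $H$, $\beta(\mu,\nu)=\sup_u|\int u\,d(\mu-\nu)|$ over $u:H\to\mathbb R$ with $\sup|u|+\mathrm{Lip}(u)\le1$.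
   Formalization: The theorem additionally assumes that f_0 is not zero in L^2; at f_0 = 0 the coverage claim is false, since the first-order limit 2 f_0 * W degenerates and for Gaussian product priors the coverage tends to 1 rather than 1-α. *)

theory Defs
  imports "HOL-Probability.Probability"
begin

text \<open>One-periodic functions are identified with their restrictions to \<open>{0..<1}\<close>.  All functions are
  real-valued, so that i.i.d. real Gaussian coefficients and the real exponential likelihood of the
  white noise model make sense; then \<open>inner\<close> is $\int_0^1 f \bar g$.\<close>

abbreviation circle :: "real measure" where
  "circle \<equiv> restrict_space lborel {0..<1}"

definition square_integrable :: "(real \<Rightarrow> real) \<Rightarrow> bool" where
  "square_integrable f \<longleftrightarrow> f \<in> borel_measurable circle \<and> integrable circle (\<lambda>x. (f x)\<^sup>2)"

lemma prob_space_circle: "prob_space circle"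
proof
  show "emeasure circle (space circle) = 1"
    by (subst emeasure_restrict_space) (auto simp: space_restrict_space)
qed

lemma finite_measure_circle: "finite_measure circle"
  using prob_space_circle by (rule prob_space.finite_measure)

lemma sqint_prod:
  assumes "square_integrable f" "square_integrable g"
  shows "integrable circle (\<lambda>x. f x * g x)"
proof (rule Bochner_Integration.integrable_bound)
  show "integrable circle (\<lambda>x. (f x)\<^sup>2 + (g x)\<^sup>2)"
    using assms by (auto simp: square_integrable_def)
  show "(\<lambda>x. f x * g x) \<in> borel_measurable circle"
    using assms by (auto simp: square_integrable_def)
  have "\<bar>a * b\<bar> \<le> a\<^sup>2 + b\<^sup>2" for a b :: real
  proof -
    have "2 * (\<bar>a\<bar> * \<bar>b\<bar>) \<le> a\<^sup>2 + b\<^sup>2"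
      using sum_squares_bound[of "\<bar>a\<bar>" "\<bar>b\<bar>"] by (simp add: mult.assoc)
    then show ?thesis unfolding abs_mult
      using mult_nonneg_nonneg[of "\<bar>a\<bar>" "\<bar>b\<bar>"] by linarith
  qed
  then show "AE x in circle. norm (f x * g x) \<le> norm ((f x)\<^sup>2 + (g x)\<^sup>2)"
    by (auto simp: intro!: AE_I2)
qed

lemma sqint_add:
  assumes "square_integrable f" "square_integrable g"
  shows "square_integrable (\<lambda>x. f x + g x)"
proof -
  have "integrable circle (\<lambda>x. (f x)\<^sup>2 + (g x)\<^sup>2 + 2 * (f x * g x))"
    using assms sqint_prod[OF assms] by (auto simp: square_integrable_def)
  then show ?thesis
    using assms by (auto simp: square_integrable_def power2_sum mult.assoc)
qed

lemma sqint_scale: "square_integrable f \<Longrightarrow> square_integrable (\<lambda>x. c * f x)"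
  by (auto simp: square_integrable_def power_mult_distrib)

lemma sqint_zero: "square_integrable (\<lambda>x. 0)"
  by (auto simp: square_integrable_def)

lemma sqint_const: "square_integrable (\<lambda>x. c)"
  using finite_measure.integrable_const[OF finite_measure_circle, of "c\<^sup>2"]
  by (simp add: square_integrable_def)

lemma sqint_minus: "square_integrable f \<Longrightarrow> square_integrable (\<lambda>x. - f x)"
  by (auto simp: square_integrable_def)

lemma sqint_diff:
  "square_integrable f \<Longrightarrow> square_integrable g \<Longrightarrow> square_integrable (\<lambda>x. f x - g x)"
  using sqint_add[of f "\<lambda>x. - g x"] sqint_minus[of g] by simp

lemma sqint_integrable: "square_integrable f \<Longrightarrow> integrable circle f"
  using sqint_prod[of f "\<lambda>_. 1"] finite_measure.integrable_const[OF finite_measure_circle]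
  by (auto simp: square_integrable_def)

definition L2_eq :: "(real \<Rightarrow> real) \<Rightarrow> (real \<Rightarrow> real) \<Rightarrow> bool" where
  "L2_eq f g \<longleftrightarrow> square_integrable f \<and> square_integrable g \<and> (AE x in circle. f x = g x)"

quotient_type L2 = "real \<Rightarrow> real" / partial: L2_eq
proof (rule part_equivpI)
  show "\<exists>f. L2_eq f f"
    by (rule exI[of _ "\<lambda>_. 0"]) (simp add: L2_eq_def sqint_zero)
  show "symp L2_eq"
    by (auto simp: L2_eq_def symp_def elim: AE_mp)
  show "transp L2_eq"
    unfolding L2_eq_def transp_def by (auto elim!: AE_mp)
qed

instantiation L2 :: real_inner
begin

lift_definition zero_L2 :: L2 is "\<lambda>_. 0" by (simp add: L2_eq_def sqint_zero)
lift_definition plus_L2 :: "L2 \<Rightarrow> L2 \<Rightarrow> L2" is "\<lambda>f g x. f x + g x"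
  by (auto simp: L2_eq_def intro!: sqint_add elim!: AE_mp)
lift_definition minus_L2 :: "L2 \<Rightarrow> L2 \<Rightarrow> L2" is "\<lambda>f g x. f x - g x"
  by (auto simp: L2_eq_def intro!: sqint_diff elim!: AE_mp)
lift_definition uminus_L2 :: "L2 \<Rightarrow> L2" is "\<lambda>f x. - f x"
  by (auto simp: L2_eq_def intro!: sqint_minus elim!: AE_mp)
lift_definition scaleR_L2 :: "real \<Rightarrow> L2 \<Rightarrow> L2" is "\<lambda>c f x. c * f x"
  by (auto simp: L2_eq_def intro!: sqint_scale elim!: AE_mp)
lift_definition inner_L2 :: "L2 \<Rightarrow> L2 \<Rightarrow> real" is "\<lambda>f g. LINT x|circle. f x * g x"
  unfolding L2_eq_def
  by (intro integral_cong_AE) (auto simp: square_integrable_def elim!: AE_mp)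

definition norm_L2 :: "L2 \<Rightarrow> real" where "norm_L2 f = sqrt (inner f f)"
definition sgn_L2 :: "L2 \<Rightarrow> L2" where "sgn_L2 f = inverse (norm f) *\<^sub>R f"
definition dist_L2 :: "L2 \<Rightarrow> L2 \<Rightarrow> real" where "dist_L2 f g = norm (f - g)"
definition uniformity_L2 :: "(L2 \<times> L2) filter" where
  "uniformity_L2 = (INF e\<in>{0<..}. principal {(f, g). dist f g < e})"
definition open_L2 :: "L2 set \<Rightarrow> bool" where
  "open_L2 U \<longleftrightarrow> (\<forall>f\<in>U. eventually (\<lambda>(f', g). f' = f \<longrightarrow> g \<in> U) uniformity)"

instance
proof
  fix f g h :: L2 and c d :: real
  show "f + g + h = f + (g + h)"
    by transfer (auto simp: L2_eq_def add.assoc intro!: sqint_add)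
  show "f + g = g + f"
    by transfer (auto simp: L2_eq_def add.commute intro!: sqint_add)
  show "0 + f = f" by transfer (auto simp: L2_eq_def)
  show "- f + f = 0" by transfer (auto simp: L2_eq_def sqint_zero)
  show "f - g = f + - g" by transfer (auto simp: L2_eq_def intro!: sqint_diff)
  show "c *\<^sub>R (f + g) = c *\<^sub>R f + c *\<^sub>R g"
    by transfer (auto simp: L2_eq_def distrib_left intro!: sqint_scale sqint_add)
  show "(c + d) *\<^sub>R f = c *\<^sub>R f + d *\<^sub>R f"
    by transfer (auto simp: L2_eq_def distrib_right intro!: sqint_scale sqint_add)
  show "c *\<^sub>R d *\<^sub>R f = (c * d) *\<^sub>R f"
    by transfer (auto simp: L2_eq_def mult.assoc intro!: sqint_scale)
  show "1 *\<^sub>R f = f" by transfer (auto simp: L2_eq_def)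
  show "sgn f = inverse (norm f) *\<^sub>R f" by (rule sgn_L2_def)
  show "dist f g = norm (f - g)" by (rule dist_L2_def)
  show "uniformity = (INF e\<in>{0<..}. principal {(f :: L2, g). dist f g < e})"
    by (rule uniformity_L2_def)
  show "open U \<longleftrightarrow> (\<forall>f\<in>U. eventually (\<lambda>(f', g). f' = f \<longrightarrow> g \<in> U) uniformity)" for U :: "L2 set"
    by (rule open_L2_def)
  show "inner f g = inner g f" by transfer (simp add: mult.commute)
  show "inner (f + g) h = inner f h + inner g h"
    by transfer (simp add: L2_eq_def distrib_right sqint_prod)
  show "inner (c *\<^sub>R f) g = c * inner f g"
    by transfer (simp add: mult.assoc)
  show "0 \<le> inner f f" by transfer simp
  show "inner f f = 0 \<longleftrightarrow> f = 0"
  proof transfer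
    fix f assume "L2_eq f f"
    then have sq: "square_integrable f" by (simp add: L2_eq_def)
    then have "(LINT x|circle. f x * f x) = 0 \<longleftrightarrow> (AE x in circle. f x * f x = 0)"
      by (intro integral_nonneg_eq_0_iff_AE sqint_prod) auto
    with sq show "(LINT x|circle. f x * f x) = 0 \<longleftrightarrow> L2_eq f (\<lambda>_. 0)"
      by (simp add: L2_eq_def sqint_zero)
  qed
  show "norm f = sqrt (inner f f)" by (rule norm_L2_def)
qed

end

lemma sqint_rep: "square_integrable (rep_L2 f)"
  using Quotient3_rep_reflp[OF Quotient3_L2, of f] by (simp add: L2_eq_def)

lemma abs_rep_L2: "abs_L2 (rep_L2 f) = f"
  by (rule Quotient3_abs_rep[OF Quotient3_L2])

lemma norm_abs_L2: "square_integrable f \<Longrightarrow> (norm (abs_L2 f))\<^sup>2 = (LINT x|circle. (f x)\<^sup>2)"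
  unfolding power2_norm_eq_inner by (simp add: inner_L2.abs_eq L2_eq_def power2_eq_square)

lemma minus_abs_L2:
  "square_integrable f \<Longrightarrow> square_integrable g \<Longrightarrow> abs_L2 f - abs_L2 g = abs_L2 (\<lambda>x. f x - g x)"
  by (simp add: minus_L2.abs_eq L2_eq_def)

lemma dist_abs_L2:
  "square_integrable f \<Longrightarrow> square_integrable g \<Longrightarrow>
    (dist (abs_L2 f) (abs_L2 g))\<^sup>2 = (LINT x|circle. (f x - g x)\<^sup>2)"
  by (simp add: dist_norm minus_abs_L2 norm_abs_L2 sqint_diff)

lemma abs_L2_eqI:
  "square_integrable f \<Longrightarrow> square_integrable g \<Longrightarrow> AE x in circle. f x = g x \<Longrightarrow> abs_L2 f = abs_L2 g"
  by (rule Quotient3_rel_abs[OF Quotient3_L2]) (simp add: L2_eq_def)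

lemma sqint_bounded_by:
  assumes "square_integrable w" "f \<in> borel_measurable circle" "AE x in circle. \<bar>f x\<bar> \<le> \<bar>w x\<bar>"
  shows "square_integrable f"
  unfolding square_integrable_def
proof
  show "integrable circle (\<lambda>x. (f x)\<^sup>2)"
  proof (rule Bochner_Integration.integrable_bound)
    show "integrable circle (\<lambda>x. (w x)\<^sup>2)" using assms by (simp add: square_integrable_def)
    show "AE x in circle. norm ((f x)\<^sup>2) \<le> norm ((w x)\<^sup>2)"
      using assms(3) by eventually_elim (simp add: abs_le_square_iff)
  qed (use assms in auto)
qed (use assms in auto)

lemma L2_dominated_convergence:
  fixes g :: "nat \<Rightarrow> real \<Rightarrow> real"
  assumes w: "square_integrable w" and f: "square_integrable f"
    and g: "\<And>n. g n \<in> borel_measurable circle"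
    and bd: "\<And>n. AE x in circle. \<bar>g n x\<bar> \<le> \<bar>w x\<bar>"
    and lim: "AE x in circle. (\<lambda>n. g n x) \<longlonglongrightarrow> f x"
  shows "(\<lambda>n. abs_L2 (g n)) \<longlonglongrightarrow> abs_L2 f"
proof -
  have sg: "square_integrable (g n)" for n by (rule sqint_bounded_by[OF w g bd])
  have "(\<lambda>n. LINT x|circle. (g n x - f x)\<^sup>2) \<longlonglongrightarrow> (LINT x|circle. 0)"
  proof (rule integral_dominated_convergence[where w = "\<lambda>x. 2 * (w x)\<^sup>2 + 2 * (f x)\<^sup>2"])
    show "integrable circle (\<lambda>x. 2 * (w x)\<^sup>2 + 2 * (f x)\<^sup>2)"
      using w f by (auto simp: square_integrable_def)
    show "AE x in circle. (\<lambda>n. (g n x - f x)\<^sup>2) \<longlonglongrightarrow> 0"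
      using lim by eventually_elim (auto intro!: tendsto_eq_intros)
    fix n
    have "(a - b)\<^sup>2 \<le> 2 * c\<^sup>2 + 2 * b\<^sup>2" if "\<bar>a\<bar> \<le> \<bar>c\<bar>" for a b c :: real
    proof -
      have "a\<^sup>2 \<le> c\<^sup>2" using that by (simp add: abs_le_square_iff)
      moreover have "(a - b)\<^sup>2 + (a + b)\<^sup>2 = 2 * a\<^sup>2 + 2 * b\<^sup>2" by (simp add: power2_eq_square algebra_simps)
      moreover have "0 \<le> (a + b)\<^sup>2" by simp
      ultimately show ?thesis by linarith
    qed
    then show "AE x in circle. norm ((g n x - f x)\<^sup>2) \<le> 2 * (w x)\<^sup>2 + 2 * (f x)\<^sup>2"
      using bd[of n] by (auto elim!: AE_mp)
  qed (use g f in \<open>auto simp: square_integrable_def\<close>)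
  then have "(\<lambda>n. (dist (abs_L2 (g n)) (abs_L2 f))\<^sup>2) \<longlonglongrightarrow> 0"
    by (simp add: dist_abs_L2 sg f)
  from tendsto_real_sqrt[OF this] show ?thesis
    by (subst tendsto_dist_iff) simp
qed

lemma L1_le_L2:
  assumes "square_integrable f"
  shows "(LINT x|circle. \<bar>f x\<bar>) \<le> norm (abs_L2 f)"
proof -
  have sa: "square_integrable (\<lambda>x. \<bar>f x\<bar>)" and s1: "square_integrable (\<lambda>_. 1)"
    using assms finite_measure.integrable_const[OF finite_measure_circle, of 1]
    by (auto simp: square_integrable_def)
  have "inner (abs_L2 (\<lambda>x. \<bar>f x\<bar>)) (abs_L2 (\<lambda>_. 1)) \<le>
      norm (abs_L2 (\<lambda>x. \<bar>f x\<bar>)) * norm (abs_L2 (\<lambda>_. 1))"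
    using Cauchy_Schwarz_ineq2[of "abs_L2 (\<lambda>x. \<bar>f x\<bar>)" "abs_L2 (\<lambda>_. 1)"] by linarith
  moreover have "inner (abs_L2 (\<lambda>x. \<bar>f x\<bar>)) (abs_L2 (\<lambda>_. 1)) = (LINT x|circle. \<bar>f x\<bar>)"
    using sa s1 by (simp add: inner_L2.abs_eq L2_eq_def)
  moreover have "(norm (abs_L2 (\<lambda>_. 1)))\<^sup>2 = 1"
    using prob_space.prob_space[OF prob_space_circle] by (simp add: norm_abs_L2[OF s1])
  then have "norm (abs_L2 (\<lambda>_. 1)) = 1"
    by (simp add: power2_eq_1_iff) (smt (verit) norm_ge_zero)
  moreover have "(norm (abs_L2 (\<lambda>x. \<bar>f x\<bar>)))\<^sup>2 = (norm (abs_L2 f))\<^sup>2"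
    by (simp add: norm_abs_L2 sa assms)
  then have "norm (abs_L2 (\<lambda>x. \<bar>f x\<bar>)) = norm (abs_L2 f)" by simp
  ultimately show ?thesis by simp
qed

instance L2 :: complete_space
proof
  fix X :: "nat \<Rightarrow> L2" assume X: "Cauchy X"
  have "\<forall>k. \<exists>N. \<forall>m\<ge>N. \<forall>n\<ge>N. dist (X m) (X n) < (1/2)^k"
    using X unfolding Cauchy_def by (metis zero_less_divide_1_iff zero_less_numeral zero_less_power)
  then obtain N where N: "\<And>k m n. m \<ge> N k \<Longrightarrow> n \<ge> N k \<Longrightarrow> dist (X m) (X n) < (1/2)^k" by metis
  define r where "r k = (\<Sum>i\<le>k. N i) + k" for k
  have rs: "r (Suc k) > r k" for k by (simp add: r_def)
  have rN: "r k \<ge> N k" for k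
    using member_le_sum[of k "{..k}" N] by (simp add: r_def)
  define f where "f n = rep_L2 (X n)" for n
  have f: "square_integrable (f n)" "abs_L2 (f n) = X n" for n
    by (auto simp: f_def sqint_rep abs_rep_L2)
  have fm[measurable]: "f n \<in> borel_measurable circle" for n
    using f(1)[of n] by (simp add: square_integrable_def)
  define g where "g k x = f (r (Suc k)) x - f (r k) x" for k x
  have gm[measurable]: "g k \<in> borel_measurable circle" for k unfolding g_def by measurable
  have gs: "square_integrable (g k)" for k unfolding g_def by (intro sqint_diff f)
  have gbd: "(LINT x|circle. \<bar>g k x\<bar>) \<le> (1/2)^k" for k
  proof -
    have "(LINT x|circle. \<bar>g k x\<bar>) \<le> norm (X (r (Suc k)) - X (r k))"
      using L1_le_L2[OF gs[of k]] minus_abs_L2[OF f(1) f(1), of "r (Suc k)" "r k"]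
      by (simp add: f g_def[abs_def])
    also have "\<dots> = dist (X (r (Suc k))) (X (r k))" by (simp add: dist_norm)
    also have "\<dots> < (1/2)^k"
      by (rule N) (use rN[of k] rs[of k] in auto)
    finally show ?thesis by simp
  qed
  have "(\<integral>\<^sup>+x. (\<Sum>k. ennreal \<bar>g k x\<bar>) \<partial>circle) = (\<Sum>k. \<integral>\<^sup>+x. ennreal \<bar>g k x\<bar> \<partial>circle)"
    by (rule nn_integral_suminf) measurable
  also have "\<dots> = (\<Sum>k. ennreal (LINT x|circle. \<bar>g k x\<bar>))"
    using sqint_integrable[OF gs] by (simp add: nn_integral_eq_integral)
  also have "\<dots> \<le> (\<Sum>k. ennreal ((1/2)^k))"
    by (intro suminf_le) (auto intro: ennreal_leI gbd)
  also have "\<dots> < \<infinity>"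
    by (subst suminf_ennreal_eq[OF _ geometric_sums[of "1/2::real"]]) auto
  finally have "AE x in circle. (\<Sum>k. ennreal \<bar>g k x\<bar>) \<noteq> \<infinity>"
    by (intro nn_integral_PInf_AE) auto
  then have "AE x in circle. convergent (\<lambda>k. f (r k) x)"
  proof eventually_elim
    fix x assume "(\<Sum>k. ennreal \<bar>g k x\<bar>) \<noteq> \<infinity>"
    then have "summable (\<lambda>k. \<bar>g k x\<bar>)"
      by (intro summable_suminf_not_top) auto
    then have "summable (\<lambda>k. g k x)" by (rule summable_rabs_cancel)
    then have "convergent (\<lambda>n. \<Sum>k<n. g k x)" by (simp add: summable_iff_convergent)
    moreover have "(\<Sum>k<n. g k x) = f (r n) x - f (r 0) x" for n
      unfolding g_def by (rule sum_lessThan_telescope)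
    ultimately have "convergent (\<lambda>n. f (r n) x - f (r 0) x)" by simp
    then have "convergent (\<lambda>n. (f (r n) x - f (r 0) x) + f (r 0) x)"
      by (intro convergent_add convergent_const)
    then show "convergent (\<lambda>k. f (r k) x)" by simp
  qed
  define F where "F x = lim (\<lambda>k. f (r k) x)" for x
  have Fm[measurable]: "F \<in> borel_measurable circle" unfolding F_def by measurable
  have lim: "AE x in circle. (\<lambda>k. f (r k) x) \<longlonglongrightarrow> F x"
    using \<open>AE x in circle. convergent (\<lambda>k. f (r k) x)\<close>
    by eventually_elim (simp add: F_def convergent_LIMSEQ_iff)
  have key: "(\<integral>\<^sup>+x. ennreal ((f n x - F x)\<^sup>2) \<partial>circle) \<le> ennreal (((1/2)^k)\<^sup>2)" if n: "n \<ge> N k" for n k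
  proof -
    have "(\<integral>\<^sup>+x. ennreal ((f n x - F x)\<^sup>2) \<partial>circle) =
        (\<integral>\<^sup>+x. liminf (\<lambda>j. ennreal ((f n x - f (r j) x)\<^sup>2)) \<partial>circle)"
    proof (rule nn_integral_cong_AE)
      show "AE x in circle. ennreal ((f n x - F x)\<^sup>2) = liminf (\<lambda>j. ennreal ((f n x - f (r j) x)\<^sup>2))"
        using lim
      proof eventually_elim
        fix x assume "(\<lambda>k. f (r k) x) \<longlonglongrightarrow> F x"
        then have "(\<lambda>j. ennreal ((f n x - f (r j) x)\<^sup>2)) \<longlonglongrightarrow> ennreal ((f n x - F x)\<^sup>2)"
          by (intro tendsto_intros tendsto_ennrealI)
        then show "ennreal ((f n x - F x)\<^sup>2) = liminf (\<lambda>j. ennreal ((f n x - f (r j) x)\<^sup>2))"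
          using lim_imp_Liminf trivial_limit_sequentially by metis
      qed
    qed
    also have "\<dots> \<le> liminf (\<lambda>j. \<integral>\<^sup>+x. ennreal ((f n x - f (r j) x)\<^sup>2) \<partial>circle)"
      by (rule nn_integral_liminf) measurable
    also have "\<dots> \<le> ennreal (((1/2)^k)\<^sup>2)"
    proof (rule Liminf_le)
      show "\<forall>\<^sub>F j in sequentially. (\<integral>\<^sup>+x. ennreal ((f n x - f (r j) x)\<^sup>2) \<partial>circle) \<le> ennreal (((1/2)^k)\<^sup>2)"
        using eventually_ge_at_top[of k]
      proof eventually_elim
        fix j assume j: "k \<le> j"
        have "r k \<le> r j" using j rs by (simp add: lift_Suc_mono_le less_imp_le)
        then have "dist (X n) (X (r j)) < (1/2)^k"
          using n rN[of k] by (intro N) auto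
        then have "(dist (X n) (X (r j)))\<^sup>2 \<le> ((1/2)^k)\<^sup>2"
          by (intro power_mono) auto
        moreover have "(\<integral>\<^sup>+x. ennreal ((f n x - f (r j) x)\<^sup>2) \<partial>circle) = ennreal ((dist (X n) (X (r j)))\<^sup>2)"
          using dist_abs_L2[OF f(1) f(1), of n "r j"] sqint_diff[OF f(1) f(1), of n "r j"]
          by (subst nn_integral_eq_integral) (auto simp: f square_integrable_def)
        ultimately show "(\<integral>\<^sup>+x. ennreal ((f n x - f (r j) x)\<^sup>2) \<partial>circle) \<le> ennreal (((1/2)^k)\<^sup>2)"
          by (simp add: ennreal_leI)
      qed
    qed simp
    finally show ?thesis .
  qed
  have sd: "square_integrable (\<lambda>x. f n x - F x)" if "n \<ge> N k" for n k
    unfolding square_integrable_def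
    using key[OF that] by (auto intro!: integrableI_bounded simp: order_le_less_trans)
  have "square_integrable (\<lambda>x. f (N 0) x - (f (N 0) x - F x))"
    by (intro sqint_diff f sd[of 0]) simp
  then have FS: "square_integrable F" by simp
  have "X \<longlonglongrightarrow> abs_L2 F"
  proof (rule metric_LIMSEQ_I)
    fix e :: real assume "e > 0"
    then obtain k where k: "(1/2::real)^k < e"
      using real_arch_pow_inv[of e "1/2"] by auto
    have "dist (X n) (abs_L2 F) < e" if n: "n \<ge> N k" for n
    proof -
      have "ennreal ((dist (X n) (abs_L2 F))\<^sup>2) = (\<integral>\<^sup>+x. ennreal ((f n x - F x)\<^sup>2) \<partial>circle)"
        using dist_abs_L2[OF f(1) FS, of n] sd[OF n]
        by (subst nn_integral_eq_integral) (auto simp: f square_integrable_def)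
      also have "\<dots> \<le> ennreal (((1/2)^k)\<^sup>2)" by (rule key[OF n])
      finally have "(dist (X n) (abs_L2 F))\<^sup>2 \<le> ((1/2)^k)\<^sup>2" by simp
      then have "dist (X n) (abs_L2 F) \<le> (1/2)^k" by (rule power2_le_imp_le) simp
      with k show ?thesis by simp
    qed
    then show "\<exists>no. \<forall>n\<ge>no. dist (X n) (abs_L2 F) < e" by blast
  qed
  then show "convergent X" by (auto simp: convergent_def)
qed

instance L2 :: banach ..

definition L2_indicator :: "real set \<Rightarrow> L2" where
  "L2_indicator A = abs_L2 (indicator A)"

lemma sqint_indicator: "A \<in> sets borel \<Longrightarrow> square_integrable (indicator A)"
proof (rule sqint_bounded_by[of "\<lambda>_. 1"])
  show "square_integrable (\<lambda>_. 1)" by (rule sqint_const)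
  show "(indicator A :: real \<Rightarrow> real) \<in> borel_measurable circle" if "A \<in> sets borel"
    using that by (intro measurable_restrict_space1) simp
qed (auto intro!: AE_I2 simp: indicator_def)

lemma abs_L2_add:
  "square_integrable f \<Longrightarrow> square_integrable g \<Longrightarrow> abs_L2 (\<lambda>x. f x + g x) = abs_L2 f + abs_L2 g"
  by (simp add: plus_L2.abs_eq L2_eq_def)

lemma abs_L2_scale:
  "square_integrable f \<Longrightarrow> abs_L2 (\<lambda>x. c * f x) = c *\<^sub>R abs_L2 f"
  by (simp add: scaleR_L2.abs_eq L2_eq_def)

lemma abs_L2_sum:
  fixes f :: "'a \<Rightarrow> real \<Rightarrow> real"
  assumes "finite Y" "\<And>y. y \<in> Y \<Longrightarrow> square_integrable (f y)"
  shows "square_integrable (\<lambda>x. \<Sum>y\<in>Y. f y x)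
    \<and> abs_L2 (\<lambda>x. \<Sum>y\<in>Y. f y x) = (\<Sum>y\<in>Y. abs_L2 (f y))"
  using assms
proof (induction Y)
  case empty
  then show ?case by (simp add: sqint_zero zero_L2.abs_eq)
next
  case (insert y Y)
  then show ?case by (simp add: sqint_add abs_L2_add)
qed

instance L2 :: second_countable_topology
proof
  obtain B :: "real set set" where B: "countable B" "topological_basis B"
    using ex_countable_basis by blast
  define G where "G = (\<lambda>F. \<Inter>F) ` {F. finite F \<and> F \<subseteq> B}"
  have cG: "countable G"
    unfolding G_def using countable_Collect_finite_subset[OF B(1)] by auto
  have GI: "Int_stable G"
    unfolding Int_stable_def
  proof safe
    fix a b assume "a \<in> G" "b \<in> G"
    then obtain F F' where "finite F" "F \<subseteq> B" "a = \<Inter>F" "finite F'" "F' \<subseteq> B" "b = \<Inter>F'"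
      by (auto simp: G_def)
    then show "a \<inter> b \<in> G" unfolding G_def by (intro image_eqI[of _ _ "F \<union> F'"]) auto
  qed
  have Go: "open a" if "a \<in> G" for a
    using that topological_basis_open[OF B(2)] by (auto simp: G_def intro!: open_Inter)
  have BG: "B \<subseteq> G"
  proof
    fix b assume "b \<in> B"
    then show "b \<in> G" unfolding G_def by (intro image_eqI[of _ _ "{b}"]) auto
  qed
  have borelB: "sets borel = sigma_sets UNIV B"
    using arg_cong[OF borel_eq_countable_basis[OF B], of sets] sets_measure_of[of B UNIV] by auto
  have borelG: "sets borel = sigma_sets UNIV G"
  proof
    show "sets borel \<subseteq> sigma_sets UNIV G"
      unfolding borelB by (rule sigma_sets_mono') (rule BG)
    show "sigma_sets UNIV G \<subseteq> sets borel"
    proof -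
      have "G \<subseteq> sets borel" using Go by (auto intro: borel_open)
      then show ?thesis using sets.sigma_sets_subset[of G borel] by simp
    qed
  qed
  define lc where "lc l = sum_list (map (\<lambda>(q, A). real_of_rat q *\<^sub>R L2_indicator A) l)" for l
  define D where "D = lc ` lists (UNIV \<times> G)"
  have cD: "countable D" unfolding D_def using cG by (intro countable_image countable_lists) auto
  have D0: "0 \<in> D" unfolding D_def by (intro image_eqI[of _ _ "[]"]) (auto simp: lc_def)
  have Dadd: "x + y \<in> D" if xy: "x \<in> D" "y \<in> D" for x y
  proof -
    obtain l l' where "x = lc l" "y = lc l'" "l \<in> lists (UNIV \<times> G)" "l' \<in> lists (UNIV \<times> G)"
      using xy unfolding D_def by blast
    then show ?thesis unfolding D_def by (intro image_eqI[of _ _ "l @ l'"]) (auto simp: lc_def)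
  qed
  have Dscale: "real_of_rat q *\<^sub>R x \<in> D" if x: "x \<in> D" for x q
  proof -
    obtain l where l: "x = lc l" "l \<in> lists (UNIV \<times> G)" using x unfolding D_def by blast
    have "real_of_rat q *\<^sub>R lc l = lc (map (\<lambda>(p, A). (q * p, A)) l)"
      by (induction l) (auto simp: lc_def scaleR_add_right of_rat_mult)
    with l show ?thesis unfolding D_def
      by (intro image_eqI[of _ _ "map (\<lambda>(p, A). (q * p, A)) l"]) auto
  qed
  define V where "V = closure D"
  have V0: "0 \<in> V" using D0 closure_subset by (auto simp: V_def)
  have Vadd: "x + y \<in> V" if xy: "x \<in> V" "y \<in> V" for x y
  proof -
    obtain f where f: "\<forall>n. f n \<in> D" "f \<longlonglongrightarrow> x"
      using xy(1) unfolding V_def closure_sequential by blast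
    obtain g where g: "\<forall>n. g n \<in> D" "g \<longlonglongrightarrow> y"
      using xy(2) unfolding V_def closure_sequential by blast
    from f g have "(\<lambda>n. f n + g n) \<longlonglongrightarrow> x + y" "\<And>n. f n + g n \<in> D"
      by (auto intro: tendsto_add Dadd)
    then show ?thesis unfolding V_def closure_sequential by (intro exI[of _ "\<lambda>n. f n + g n"]) auto
  qed
  have Vscale: "c *\<^sub>R x \<in> V" if x: "x \<in> V" for x c
  proof -
    obtain f where f: "\<forall>n. f n \<in> D" "f \<longlonglongrightarrow> x"
      using x unfolding V_def closure_sequential by blast
    have "\<exists>q::rat. c < real_of_rat q \<and> real_of_rat q < c + 1 / real (Suc n)" for n
      using of_rat_dense[of c "c + 1 / real (Suc n)"] by simp
    then obtain q :: "nat \<Rightarrow> rat" where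
      q: "\<And>n. c < real_of_rat (q n) \<and> real_of_rat (q n) < c + 1 / real (Suc n)" by metis
    have "(\<lambda>n. real_of_rat (q n)) \<longlonglongrightarrow> c"
    proof (rule tendsto_sandwich[where f = "\<lambda>_. c" and h = "\<lambda>n. c + 1 / real (Suc n)"])
      show "(\<lambda>n. c + 1 / real (Suc n)) \<longlonglongrightarrow> c"
        using tendsto_add[OF tendsto_const LIMSEQ_inverse_real_of_nat, of c] by (simp add: inverse_eq_divide)
      show "\<forall>\<^sub>F n in sequentially. c \<le> real_of_rat (q n)"
        "\<forall>\<^sub>F n in sequentially. real_of_rat (q n) \<le> c + 1 / real (Suc n)"
        using q less_imp_le by (blast intro: always_eventually)+
    qed simp
    then have "(\<lambda>n. real_of_rat (q n) *\<^sub>R f n) \<longlonglongrightarrow> c *\<^sub>R x" using f by (intro tendsto_scaleR)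
    then show ?thesis unfolding V_def closure_sequential
      using f Dscale by (intro exI[of _ "\<lambda>n. real_of_rat (q n) *\<^sub>R f n"]) auto
  qed
  have Vlim: "x \<in> V" if "\<And>n::nat. f n \<in> V" "f \<longlonglongrightarrow> x" for f x
    using that closed_sequentially[of V f x] by (simp add: V_def)
  have Vsum: "(\<Sum>y\<in>Y. h y) \<in> V" if "\<And>y. y \<in> Y \<Longrightarrow> h y \<in> V" for Y and h :: "real \<Rightarrow> L2"
    using that by (induction Y rule: infinite_finite_induct) (auto intro: V0 Vadd)
  have Vsumn: "(\<Sum>y\<in>Y. h y) \<in> V" if "\<And>y. y \<in> Y \<Longrightarrow> h y \<in> V" for Y and h :: "nat \<Rightarrow> L2"
    using that by (induction Y rule: infinite_finite_induct) (auto intro: V0 Vadd)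
  have VG: "L2_indicator A \<in> V" if "A \<in> G" for A
  proof -
    have "L2_indicator A \<in> D"
      unfolding D_def using that by (intro image_eqI[of _ _ "[(1, A)]"]) (auto simp: lc_def)
    then show ?thesis using closure_subset by (auto simp: V_def)
  qed
  have UG: "UNIV \<in> G" unfolding G_def by (intro image_eqI[of _ _ "{}"]) auto
  have Vind: "L2_indicator A \<in> V" if "A \<in> sigma_sets UNIV G" for A
    using GI subset_UNIV[of G, folded Pow_UNIV] that
  proof (induction rule: sigma_sets_induct_disjoint)
    case (basic A)
    then show ?case by (rule VG)
  next
    case empty
    have "L2_indicator {} = 0" by (simp add: L2_indicator_def zero_L2.abs_eq indicator_def[abs_def])
    then show ?case using V0 by simp
  next
    case (compl A)
    then have A: "A \<in> sets borel" by (simp add: borelG)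
    have "L2_indicator (UNIV - A) = abs_L2 (\<lambda>x. indicator UNIV x - indicator A x)"
      unfolding L2_indicator_def by (rule arg_cong[of _ _ abs_L2]) (auto simp: indicator_def)
    also have "\<dots> = L2_indicator UNIV + (-1) *\<^sub>R L2_indicator A"
      using minus_abs_L2[OF sqint_indicator sqint_indicator, of UNIV A] A by (simp add: L2_indicator_def)
    finally show ?case using Vadd[OF VG[OF UG] Vscale[OF compl(2), of "-1"]] by simp
  next
    case (union A)
    have A: "A n \<in> sets borel" for n using union(2) borelG by auto
    have s: "(\<Sum>k<n. indicator (A k) x :: real) = indicator (\<Union>k<n. A k) x" for n x
      using union(1) by (subst indicator_UN_disjoint) (auto simp: disjoint_family_on_def)
    have "(\<lambda>n. abs_L2 (\<lambda>x. \<Sum>k<n. indicator (A k) x)) \<longlonglongrightarrow> L2_indicator (\<Union>k. A k)"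
      unfolding L2_indicator_def s
    proof (rule L2_dominated_convergence[where w = "indicator UNIV"])
      show "AE x in circle. (\<lambda>n. indicator (\<Union>k<n. A k) x :: real) \<longlonglongrightarrow> indicator (\<Union>k. A k) x"
        by (rule AE_I2, rule LIMSEQ_indicator_UN)
      show "(indicator (\<Union>k<n. A k) :: real \<Rightarrow> real) \<in> borel_measurable circle" for n
      proof -
        have "square_integrable (indicator (\<Union>k<n. A k))" using A by (intro sqint_indicator) auto
        then show ?thesis by (simp add: square_integrable_def)
      qed
    qed (use A in \<open>auto intro!: sqint_indicator sqint_const AE_I2 simp: indicator_def\<close>)
    moreover have "abs_L2 (\<lambda>x. \<Sum>k<n. indicator (A k) x) = (\<Sum>k<n. L2_indicator (A k))" for n
      using abs_L2_sum[of "{..<n}" "\<lambda>k. indicator (A k)"] sqint_indicator[OF A] by (simp add: L2_indicator_def)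
    ultimately have "(\<lambda>n. \<Sum>k<n. L2_indicator (A k)) \<longlonglongrightarrow> L2_indicator (\<Union>k. A k)" by simp
    then show ?case by (rule Vlim[rotated]) (intro Vsumn union)
  qed
  have VT: "f \<in> V" for f :: L2
  proof -
    define h where "h = rep_L2 f"
    have h: "square_integrable h" "abs_L2 h = f" by (auto simp: h_def sqint_rep abs_rep_L2)
    then have "h \<in> borel_measurable circle" by (simp add: square_integrable_def)
    from borel_measurable_implies_sequence_metric[OF this, of 0] obtain F where
      F: "\<And>i. simple_function circle (F i)"
        "\<And>x. x \<in> space circle \<Longrightarrow> (\<lambda>i. F i x) \<longlonglongrightarrow> h x"
        "\<And>i x. x \<in> space circle \<Longrightarrow> dist (F i x) 0 \<le> 2 * dist (h x) 0" by blast
    have "abs_L2 (F i) \<in> V" for i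
    proof -
      define Y where "Y = F i ` space circle"
      have Y: "finite Y" using F(1)[of i] by (simp add: Y_def simple_function_def)
      define A where "A y = F i -` {y} \<inter> space circle" for y
      have A: "A y \<in> sets borel" for y
      proof -
        have "A y \<in> sets circle"
          unfolding A_def using F(1)[of i] by (intro simple_functionD(2))
        then show ?thesis by (auto simp: sets_restrict_space)
      qed
      have sA: "square_integrable (\<lambda>x. y * indicator (A y) x)" for y
        by (intro sqint_scale sqint_indicator A)
      have eq: "(\<Sum>y\<in>Y. y * indicator (A y) x) = F i x" if "x \<in> space circle" for x
      proof -
        have "(\<Sum>y\<in>Y. y * indicator (A y) x) = (\<Sum>y\<in>Y. if F i x = y then y else 0)"
          using that by (intro sum.cong) (auto simp: A_def indicator_def)
        also have "\<dots> = F i x" using Y that by (simp add: Y_def)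
        finally show ?thesis .
      qed
      have "square_integrable (F i)"
        by (rule sqint_bounded_by[of "\<lambda>x. 2 * h x"])
          (use F h in \<open>auto intro!: sqint_scale AE_I2 borel_measurable_simple_function simp: abs_mult\<close>)
      then have "abs_L2 (F i) = abs_L2 (\<lambda>x. \<Sum>y\<in>Y. y * indicator (A y) x)"
        using abs_L2_sum[OF Y sA] eq by (intro abs_L2_eqI) (auto intro!: AE_I2)
      also have "\<dots> = (\<Sum>y\<in>Y. y *\<^sub>R L2_indicator (A y))"
        using abs_L2_sum[OF Y sA] abs_L2_scale[OF sqint_indicator[OF A]] by (simp add: L2_indicator_def)
      also have "\<dots> \<in> V"
        using A by (intro Vsum Vscale Vind) (simp add: borelG)
      finally show ?thesis .
    qed
    moreover have "(\<lambda>i. abs_L2 (F i)) \<longlonglongrightarrow> abs_L2 h"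
      by (rule L2_dominated_convergence[where w = "\<lambda>x. 2 * h x"])
        (use F h in \<open>auto intro!: sqint_scale AE_I2 borel_measurable_simple_function simp: abs_mult\<close>)
    ultimately show ?thesis using Vlim h by metis
  qed
  define C where "C = (\<lambda>(x, n). ball x (1 / real (Suc n))) ` (D \<times> UNIV)"
  have "topological_basis C"
  proof (rule topological_basisI)
    fix U :: "L2 set" and x assume U: "open U" "x \<in> U"
    then obtain e where e: "e > 0" "ball x e \<subseteq> U" using open_contains_ball by blast
    obtain n where n: "1 / real (Suc n) < e / 2"
      using nat_approx_posE[of "e / 2"] e by auto
    have "x \<in> closure D" using VT by (simp add: V_def)
    then obtain y where y: "y \<in> D" "dist y x < 1 / real (Suc n)"
      using closure_approachable[of x D] by (metis zero_less_divide_1_iff of_nat_0_less_iff zero_less_Suc)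
    have "ball y (1 / real (Suc n)) \<subseteq> ball x e"
    proof
      fix z assume "z \<in> ball y (1 / real (Suc n))"
      then have "dist x z < e"
        using dist_triangle[of x z y] y n by (simp add: dist_commute)
      then show "z \<in> ball x e" by simp
    qed
    with y e show "\<exists>B'\<in>C. x \<in> B' \<and> B' \<subseteq> U"
      by (intro bexI[of _ "ball y (1 / real (Suc n))"]) (auto simp: C_def)
  qed (auto simp: C_def)
  moreover have "countable C" unfolding C_def using cD by (intro countable_image countable_SIGMA) auto
  ultimately show "\<exists>B::L2 set set. countable B \<and> open = generate_topology B"
    using topological_basis_imp_subbasis by blast
qed

lift_definition fourier_coeff :: "L2 \<Rightarrow> int \<Rightarrow> complex" is
  "\<lambda>f m. LINT x|circle. complex_of_real (f x) * cis (- 2 * pi * real_of_int m * x)"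
proof (rule ext)
  fix f g m assume "L2_eq f g"
  then have f: "f \<in> borel_measurable circle" and g: "g \<in> borel_measurable circle"
    and fg: "AE x in circle. f x = g x"
    by (auto simp: L2_eq_def square_integrable_def)
  have c: "(\<lambda>x. cis (- 2 * pi * real_of_int m * x)) \<in> borel_measurable circle"
    by (intro measurable_restrict_space1) (auto intro!: borel_measurable_continuous_onI continuous_intros)
  from f g fg c show "(LINT x|circle. complex_of_real (f x) * cis (- 2 * pi * real_of_int m * x)) =
      (LINT x|circle. complex_of_real (g x) * cis (- 2 * pi * real_of_int m * x))"
    by (intro integral_cong_AE) (auto elim!: AE_mp)
qed

lemma AE_circle_iff: "(AE x in circle. P x) \<longleftrightarrow> (AE x in lborel. x \<in> {0..<1} \<longrightarrow> P x)"
  by (rule AE_restrict_space_iff) simp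

lemma measurable_circle_shift [measurable]:
  assumes f: "f \<in> borel_measurable circle"
  shows "(\<lambda>t. f (frac (x - t))) \<in> borel_measurable circle"
proof (rule measurable_compose[OF _ f])
  show "(\<lambda>t. frac (x - t)) \<in> measurable circle circle"
    unfolding frac_def
    by (rule measurable_restrict_space2, auto simp: space_restrict_space frac_lt_1 frac_def[symmetric])
      (auto simp: frac_def intro!: measurable_restrict_space1)
qed

lemma AE_circle_shift:
  assumes "AE y in circle. P y"
  shows "AE t in circle. P (frac (x - t))"
proof -
  from assms have "AE y in lborel. y \<in> {0..<1} \<longrightarrow> P y" by (simp add: AE_circle_iff)
  then obtain N where N: "N \<in> null_sets lborel" "{y. \<not> (y \<in> {0..<1} \<longrightarrow> P y)} \<subseteq> N"
    by (rule AE_E3) auto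
  have Nb: "N \<in> sets borel" using N(1) by (simp add: null_sets_def)
  have "AE t in lborel. x - real_of_int k + (-1) * t \<notin> N" for k :: int
    by (rule AE_borel_affine[of "-1" "\<lambda>y. y \<notin> N"]) (use Nb AE_not_in[OF N(1)] in auto)
  then have "AE t in lborel. \<forall>k::int. x - real_of_int k + (-1) * t \<notin> N"
    by (subst AE_all_countable) blast
  then have "AE t in lborel. t \<in> {0..<1} \<longrightarrow> P (frac (x - t))"
  proof eventually_elim
    fix t assume "\<forall>k::int. x - real_of_int k + (-1) * t \<notin> N"
    then have "x - real_of_int \<lfloor>x - t\<rfloor> + (-1) * t \<notin> N" by blast
    moreover have "x - real_of_int \<lfloor>x - t\<rfloor> + (-1) * t = frac (x - t)" by (simp add: frac_def)
    ultimately have "frac (x - t) \<notin> N" by simp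
    moreover have "frac (x - t) \<in> {0..<1}" using frac_lt_1 frac_ge_0 by auto
    ultimately show "t \<in> {0..<1} \<longrightarrow> P (frac (x - t))" using N(2) by blast
  qed
  then show ?thesis by (simp add: AE_circle_iff)
qed

text \<open>Subtraction modulo 1 is rendered by \<open>frac\<close>, so \<open>convol f g\<close> is a one-periodic function on
  the whole line, determined at every point by the classes \<open>f\<close> and \<open>g\<close>.\<close>

lift_definition convol :: "L2 \<Rightarrow> L2 \<Rightarrow> real \<Rightarrow> real" is
  "\<lambda>f g x. LINT t|circle. f (frac (x - t)) * g t"
proof (rule ext)
  fix f f' g g' :: "real \<Rightarrow> real" and x :: real
  assume "L2_eq f f'" "L2_eq g g'"
  then have [measurable]: "f \<in> borel_measurable circle" "f' \<in> borel_measurable circle"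
      "g \<in> borel_measurable circle" "g' \<in> borel_measurable circle"
    and ae: "AE x in circle. f x = f' x" "AE x in circle. g x = g' x"
    by (auto simp: L2_eq_def square_integrable_def)
  show "(LINT t|circle. f (frac (x - t)) * g t) = (LINT t|circle. f' (frac (x - t)) * g' t)"
  proof (rule integral_cong_AE)
    show "AE t in circle. f (frac (x - t)) * g t = f' (frac (x - t)) * g' t"
      using AE_circle_shift[OF ae(1), of x] ae(2) by eventually_elim simp
  qed measurable
qed

definition periodic_C :: "(real \<Rightarrow> real) set" where
  "periodic_C = {g. continuous_on UNIV g \<and> (\<forall>x. g (x + 1) = g x)}"

definition unif_norm :: "(real \<Rightarrow> real) \<Rightarrow> real" where
  "unif_norm g = (SUP x\<in>{0..<1}. \<bar>g x\<bar>)"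

record l2_basis =
  levels :: "int set"
  positions :: "int \<Rightarrow> int set"
  char_seq :: "int \<Rightarrow> real"
  elem :: "int \<Rightarrow> int \<Rightarrow> L2"

definition idx :: "l2_basis \<Rightarrow> (int \<times> int) set" where
  "idx B = (SIGMA l:levels B. positions B l)"

definition times_differentiable :: "nat \<Rightarrow> L2 \<Rightarrow> bool" where
  "times_differentiable S f \<longleftrightarrow> (\<exists>D :: nat \<Rightarrow> real \<Rightarrow> real.
     (\<forall>j\<le>S. square_integrable (D j)) \<and> f = abs_L2 (D 0) \<and>
     (\<forall>j<S. \<forall>x\<in>{0..1}. (D j has_real_derivative D (Suc j) x) (at x within {0..1})))"

definition regular_basis :: "nat \<Rightarrow> l2_basis \<Rightarrow> bool" where
  "regular_basis S B \<longleftrightarrow>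
     (\<forall>(l, k)\<in>idx B. \<forall>(l', k')\<in>idx B.
        inner (elem B l k) (elem B l' k') = (if (l, k) = (l', k') then 1 else 0)) \<and>
     closure (span ((\<lambda>(l, k). elem B l k) ` idx B)) = UNIV \<and>
     (\<forall>(l, k)\<in>idx B. times_differentiable S (elem B l k)) \<and>
     ((\<forall>l\<in>levels B. card (positions B l) = 1 \<and> char_seq B l = max 2 \<bar>real_of_int l\<bar>) \<or>
      (levels B \<subseteq> {1..} \<and>
       (\<forall>l\<in>levels B. card (positions B l) = 2 ^ nat l \<and> char_seq B l = 2 ^ nat l)))"

definition sobolev :: "l2_basis \<Rightarrow> real \<Rightarrow> L2 set" where
  "sobolev B s =
     {f. (\<lambda>(l, k). char_seq B l powr (2 * s) * (inner (elem B l k) f)\<^sup>2) summable_on idx B}"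

definition sobolev_norm :: "l2_basis \<Rightarrow> real \<Rightarrow> L2 \<Rightarrow> real" where
  "sobolev_norm B s f =
     sqrt (\<Sum>\<^sub>\<infinity>(l, k)\<in>idx B. char_seq B l powr (2 * s) * (inner (elem B l k) f)\<^sup>2)"

definition fourier_sobolev :: "real \<Rightarrow> L2 set" where
  "fourier_sobolev s =
     {f. (\<lambda>m. (cmod (fourier_coeff f m))\<^sup>2 * (1 + \<bar>real_of_int m\<bar>) powr (2 * s)) summable_on UNIV}"

definition fourier_sobolev_norm :: "real \<Rightarrow> L2 \<Rightarrow> real" where
  "fourier_sobolev_norm s f =
     sqrt (\<Sum>\<^sub>\<infinity>m\<in>UNIV. (cmod (fourier_coeff f m))\<^sup>2 * (1 + \<bar>real_of_int m\<bar>) powr (2 * s))"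

text \<open>The equality of the two spaces is part of the condition: comparability of the two norms on
  \<open>sobolev B s\<close> alone would also allow bases adapted to a boundary condition, such as
  \<open>sin (\<pi> l x)\<close>, whose Sobolev spaces are proper subspaces of the periodic ones.\<close>

definition fourier_equivalent :: "l2_basis \<Rightarrow> real \<Rightarrow> bool" where
  "fourier_equivalent B s \<longleftrightarrow> sobolev B s = fourier_sobolev s \<and>
     (\<exists>c>0. \<exists>C>0. \<forall>f\<in>sobolev B s.
        c * fourier_sobolev_norm s f \<le> sobolev_norm B s f \<and>
        sobolev_norm B s f \<le> C * fourier_sobolev_norm s f)"

text \<open>A linear form on the span of the basis is given by its coefficients. They are functions on all
  of \<open>int \<times> int\<close>, set to zero off the index set so that equality of forms is equality of functions.\<close>

type_synonym coeffs = "int \<times> int \<Rightarrow> real"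

definition basis_coeff :: "l2_basis \<Rightarrow> L2 \<Rightarrow> coeffs" where
  "basis_coeff B f = (\<lambda>(l, k). if (l, k) \<in> idx B then inner (elem B l k) f else 0)"

definition H_weight :: "l2_basis \<Rightarrow> real \<Rightarrow> int \<times> int \<Rightarrow> real" where
  "H_weight B \<delta> = (\<lambda>(l, k). inverse (char_seq B l) * (ln (char_seq B l)) powr (- 2 * \<delta>))"

definition H_space :: "l2_basis \<Rightarrow> real \<Rightarrow> coeffs set" where
  "H_space B \<delta> =
     {x. (\<forall>i. i \<notin> idx B \<longrightarrow> x i = 0) \<and> (\<lambda>i. H_weight B \<delta> i * (x i)\<^sup>2) summable_on idx B}"

definition H_norm :: "l2_basis \<Rightarrow> real \<Rightarrow> coeffs \<Rightarrow> real" where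
  "H_norm B \<delta> x = sqrt (\<Sum>\<^sub>\<infinity>i\<in>idx B. H_weight B \<delta> i * (x i)\<^sup>2)"

definition H_dist :: "l2_basis \<Rightarrow> real \<Rightarrow> coeffs \<Rightarrow> coeffs \<Rightarrow> real" where
  "H_dist B \<delta> x y = H_norm B \<delta> (\<lambda>i. x i - y i)"

lemma char_seq_ge_2:
  assumes "regular_basis S B" "l \<in> levels B"
  shows "char_seq B l \<ge> 2"
proof -
  have "(2::real) \<le> 2 ^ nat l" if "1 \<le> l"
    using that self_le_power[of "2::real" "nat l"] by auto
  then show ?thesis using assms by (force simp: regular_basis_def)
qed

lemma H_weight_pos:
  assumes "regular_basis S B" "i \<in> idx B"
  shows "H_weight B \<delta> i > 0"
proof -
  obtain l k where "i = (l, k)" "l \<in> levels B" using assms(2) by (auto simp: idx_def)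
  then show ?thesis using char_seq_ge_2[OF assms(1), of l] by (simp add: H_weight_def)
qed

lemma Metric_space_H:
  assumes B: "regular_basis S B"
  shows "Metric_space (H_space B \<delta>) (H_dist B \<delta>)"
proof
  let ?w = "H_weight B \<delta>" and ?I = "idx B"
  have w: "?w i > 0" if "i \<in> ?I" for i by (rule H_weight_pos[OF B that])
  have w0: "0 \<le> ?w i * c\<^sup>2" if "i \<in> ?I" for i and c :: real
    using w[OF that] by (intro mult_nonneg_nonneg) auto
  have sm: "(\<lambda>i. ?w i * (x i - y i)\<^sup>2) summable_on ?I" if "x \<in> H_space B \<delta>" "y \<in> H_space B \<delta>" for x y
  proof (rule summable_on_comparison_test)
    show "(\<lambda>i. 2 * (?w i * (x i)\<^sup>2) + 2 * (?w i * (y i)\<^sup>2)) summable_on ?I"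
      using that by (intro summable_on_add summable_on_cmult_right) (auto simp: H_space_def)
    fix i assume i: "i \<in> ?I"
    have "(x i - y i)\<^sup>2 + (x i + y i)\<^sup>2 = 2 * (x i)\<^sup>2 + 2 * (y i)\<^sup>2"
      by (simp add: power2_eq_square algebra_simps)
    then have "(x i - y i)\<^sup>2 \<le> 2 * (x i)\<^sup>2 + 2 * (y i)\<^sup>2"
      using zero_le_power2[of "x i + y i"] by linarith
    then have "?w i * (x i - y i)\<^sup>2 \<le> ?w i * (2 * (x i)\<^sup>2 + 2 * (y i)\<^sup>2)"
      using w[OF i] by (intro mult_left_mono) auto
    then show "?w i * (x i - y i)\<^sup>2 \<le> 2 * (?w i * (x i)\<^sup>2) + 2 * (?w i * (y i)\<^sup>2)"
      by (simp add: algebra_simps)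
    show "0 \<le> ?w i * (x i - y i)\<^sup>2" using w[OF i] by simp
  qed
  show "0 \<le> H_dist B \<delta> x y" for x y
    unfolding H_dist_def H_norm_def
    by (intro real_sqrt_ge_zero infsum_nonneg w0)
  show "H_dist B \<delta> x y = H_dist B \<delta> y x" for x y
    unfolding H_dist_def H_norm_def by (simp add: power2_commute)
  show "H_dist B \<delta> x y = 0 \<longleftrightarrow> x = y" if x: "x \<in> H_space B \<delta>" and y: "y \<in> H_space B \<delta>" for x y
  proof
    assume "H_dist B \<delta> x y = 0"
    then have 0: "(\<Sum>\<^sub>\<infinity>i\<in>?I. ?w i * (x i - y i)\<^sup>2) = 0" by (simp add: H_dist_def H_norm_def)
    show "x = y"
    proof (rule ext)
      fix i
      show "x i = y i"
      proof (cases "i \<in> ?I")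
        case True
        have "?w i * (x i - y i)\<^sup>2 = 0"
          by (rule nonneg_infsum_le_0D[OF _ sm[OF x y] w0 True]) (use 0 in auto)
        then show ?thesis using w[OF True] by simp
      next
        case False
        then show ?thesis using x y unfolding H_space_def mem_Collect_eq by metis
      qed
    qed
  next
    assume "x = y"
    then show "H_dist B \<delta> x y = 0" by (simp add: H_dist_def H_norm_def)
  qed
  show "H_dist B \<delta> x z \<le> H_dist B \<delta> x y + H_dist B \<delta> y z"
    if x: "x \<in> H_space B \<delta>" and y: "y \<in> H_space B \<delta>" and z: "z \<in> H_space B \<delta>" for x y z
  proof -
    have fin: "L2_set (\<lambda>i. sqrt (?w i) * (u i - v i)) F \<le> H_dist B \<delta> u v"
      if u: "u \<in> H_space B \<delta>" and v: "v \<in> H_space B \<delta>" and F: "finite F" "F \<subseteq> ?I" for u v F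
    proof -
      have "(\<Sum>i\<in>F. (sqrt (?w i) * (u i - v i))\<^sup>2) = (\<Sum>i\<in>F. ?w i * (u i - v i)\<^sup>2)"
      proof (intro sum.cong refl)
        fix i assume "i \<in> F"
        then have "0 \<le> ?w i" using F(2) w[of i] by (meson less_imp_le subsetD)
        then show "(sqrt (?w i) * (u i - v i))\<^sup>2 = ?w i * (u i - v i)\<^sup>2"
          by (simp add: power_mult_distrib)
      qed
      also have "\<dots> \<le> (\<Sum>\<^sub>\<infinity>i\<in>?I. ?w i * (u i - v i)\<^sup>2)"
        using F by (intro finite_sum_le_infsum sm u v w0) auto
      finally show ?thesis by (simp add: L2_set_def H_dist_def H_norm_def)
    qed
    let ?r = "H_dist B \<delta> x y + H_dist B \<delta> y z"
    have r0: "0 \<le> ?r"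
      using \<open>\<And>x y. 0 \<le> H_dist B \<delta> x y\<close> by simp
    have "(\<Sum>\<^sub>\<infinity>i\<in>?I. ?w i * (x i - z i)\<^sup>2) \<le> ?r\<^sup>2"
    proof (rule infsum_le_finite_sums[OF sm[OF x z]])
      fix F assume F: "finite F" "F \<subseteq> ?I"
      have "L2_set (\<lambda>i. sqrt (?w i) * (x i - z i)) F =
          L2_set (\<lambda>i. sqrt (?w i) * (x i - y i) + sqrt (?w i) * (y i - z i)) F"
        by (rule L2_set_cong) (auto simp: algebra_simps)
      also have "\<dots> \<le> L2_set (\<lambda>i. sqrt (?w i) * (x i - y i)) F + L2_set (\<lambda>i. sqrt (?w i) * (y i - z i)) F"
        by (rule L2_set_triangle_ineq)
      also have "\<dots> \<le> ?r" by (intro add_mono fin x y z F)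
      finally have "(L2_set (\<lambda>i. sqrt (?w i) * (x i - z i)) F)\<^sup>2 \<le> ?r\<^sup>2"
        by (intro power_mono) auto
      moreover have "(L2_set (\<lambda>i. sqrt (?w i) * (x i - z i)) F)\<^sup>2 = (\<Sum>i\<in>F. ?w i * (x i - z i)\<^sup>2)"
      proof -
        have "(sqrt (?w i) * (x i - z i))\<^sup>2 = ?w i * (x i - z i)\<^sup>2" if "i \<in> F" for i
        proof -
          have "0 \<le> ?w i" using F(2) w[of i] that by (meson less_imp_le subsetD)
          then show ?thesis by (simp add: power_mult_distrib)
        qed
        moreover have "0 \<le> (\<Sum>i\<in>F. ?w i * (x i - z i)\<^sup>2)"
          by (rule sum_nonneg) (rule w0, rule subsetD[OF F(2)])
        ultimately show ?thesis by (simp add: L2_set_def)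
      qed
      ultimately show "(\<Sum>i\<in>F. ?w i * (x i - z i)\<^sup>2) \<le> ?r\<^sup>2" by simp
    qed
    then have "H_dist B \<delta> x z \<le> sqrt (?r\<^sup>2)"
      unfolding H_dist_def[of B \<delta> x z] H_norm_def by (rule real_sqrt_le_mono)
    with r0 show ?thesis by simp
  qed
qed

definition H_borel :: "l2_basis \<Rightarrow> real \<Rightarrow> coeffs measure" where
  "H_borel B \<delta> =
     sigma (H_space B \<delta>) {U. openin (Metric_space.mtopology (H_space B \<delta>) (H_dist B \<delta>)) U}"

text \<open>The i.i.d. standard normal sequence lies in \<open>H_space B \<delta>\<close> only almost surely; it is replaced
  by zero on the exceptional null set.\<close>

definition white_noise :: "l2_basis \<Rightarrow> real \<Rightarrow> coeffs measure" where
  "white_noise B \<delta> =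
     distr (PiM (idx B) (\<lambda>_. std_normal_distribution)) (H_borel B \<delta>)
       (\<lambda>\<omega>. let w = (\<lambda>i. if i \<in> idx B then \<omega> i else 0) in if w \<in> H_space B \<delta> then w else (\<lambda>_. 0))"

definition data_law :: "l2_basis \<Rightarrow> real \<Rightarrow> nat \<Rightarrow> L2 \<Rightarrow> coeffs measure" where
  "data_law B \<delta> n f =
     distr (white_noise B \<delta>) (H_borel B \<delta>) (\<lambda>w i. basis_coeff B f i + w i / sqrt (real n))"

text \<open>A posterior is a regular conditional law: for \<open>f\<close> distributed as \<open>prior\<close> and data \<open>X\<close> with law
  \<open>data_law B \<delta> n f\<close> given \<open>f\<close>, the kernel satisfies
  $E[1_D(X)\, K(X)(A)] = P(f \in A, X \in D)$.\<close>

definition is_posterior ::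
    "l2_basis \<Rightarrow> real \<Rightarrow> nat \<Rightarrow> L2 measure \<Rightarrow> (coeffs \<Rightarrow> L2 measure) \<Rightarrow> bool" where
  "is_posterior B \<delta> n prior K \<longleftrightarrow>
     K \<in> measurable (H_borel B \<delta>) (prob_algebra borel) \<and>
     (\<forall>A\<in>sets borel. \<forall>D\<in>sets (H_borel B \<delta>).
        (\<integral>\<^sup>+f. (\<integral>\<^sup>+x. indicator D x * emeasure (K x) A \<partial>data_law B \<delta> n f) \<partial>prior) =
        (\<integral>\<^sup>+f. indicator A f * emeasure (data_law B \<delta> n f) D \<partial>prior))"

definition post_mean :: "(coeffs \<Rightarrow> L2 measure) \<Rightarrow> coeffs \<Rightarrow> L2" where
  "post_mean K x = (LINT f|K x. f)"

text \<open>Outer probabilities coincide with probabilities on events and make the symbols meaningful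
  without measurability of \<open>Z n\<close> (for example when \<open>Z n\<close> is an uncountable supremum).\<close>

definition little_oP :: "(nat \<Rightarrow> 'a measure) \<Rightarrow> (nat \<Rightarrow> 'a \<Rightarrow> real) \<Rightarrow> (nat \<Rightarrow> real) \<Rightarrow> bool" where
  "little_oP P Z r \<longleftrightarrow> (\<forall>\<epsilon>>0.
     (\<lambda>n. outer_measure_of (P n) {x \<in> space (P n). \<bar>Z n x\<bar> > \<epsilon> * \<bar>r n\<bar>}) \<longlonglongrightarrow> 0)"

definition big_OP :: "(nat \<Rightarrow> 'a measure) \<Rightarrow> (nat \<Rightarrow> 'a \<Rightarrow> real) \<Rightarrow> (nat \<Rightarrow> real) \<Rightarrow> bool" where
  "big_OP P Z r \<longleftrightarrow> (\<forall>\<epsilon>>0. \<exists>M. \<forall>\<^sub>F n in sequentially.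
     outer_measure_of (P n) {x \<in> space (P n). \<bar>Z n x\<bar> > M * \<bar>r n\<bar>} \<le> ennreal \<epsilon>)"

definition BL1 :: "'a set \<Rightarrow> ('a \<Rightarrow> 'a \<Rightarrow> real) \<Rightarrow> ('a \<Rightarrow> real) set" where
  "BL1 M d = {u. (SUP x\<in>M. ennreal \<bar>u x\<bar>) +
     (SUP (x, y)\<in>{(x, y). x \<in> M \<and> y \<in> M \<and> x \<noteq> y}. ennreal (\<bar>u x - u y\<bar> / d x y)) \<le> 1}"

definition BL_dist :: "'a set \<Rightarrow> ('a \<Rightarrow> 'a \<Rightarrow> real) \<Rightarrow> 'a measure \<Rightarrow> 'a measure \<Rightarrow> real" where
  "BL_dist M d \<mu> \<nu> = (SUP u\<in>BL1 M d. \<bar>(LINT x|\<mu>. u x) - (LINT x|\<nu>. u x)\<bar>)"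

definition rescaled_posterior ::
    "l2_basis \<Rightarrow> real \<Rightarrow> nat \<Rightarrow> (coeffs \<Rightarrow> L2 measure) \<Rightarrow> coeffs \<Rightarrow> coeffs measure" where
  "rescaled_posterior B \<delta> n K x =
     distr (K x) (H_borel B \<delta>) (\<lambda>f i. sqrt (real n) * (basis_coeff B f i - x i))"

definition weak_BvM :: "l2_basis \<Rightarrow> real \<Rightarrow> L2 \<Rightarrow> (nat \<Rightarrow> coeffs \<Rightarrow> L2 measure) \<Rightarrow> bool" where
  "weak_BvM B \<delta> f0 K \<longleftrightarrow> little_oP (\<lambda>n. data_law B \<delta> n f0)
     (\<lambda>n x. BL_dist (H_space B \<delta>) (H_dist B \<delta>) (rescaled_posterior B \<delta> n (K n) x) (white_noise B \<delta>))
     (\<lambda>_. 1)"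

definition self_convol :: "L2 \<Rightarrow> real \<Rightarrow> real" where
  "self_convol f = convol f f"

definition credible_band ::
    "nat \<Rightarrow> (coeffs \<Rightarrow> L2 measure) \<Rightarrow> (coeffs \<Rightarrow> real) \<Rightarrow> coeffs \<Rightarrow> (real \<Rightarrow> real) set" where
  "credible_band n K R x = {g \<in> periodic_C.
     unif_norm (\<lambda>t. g t - self_convol (post_mean K x) t) \<le> R x / sqrt (real n)}"

end

theory Submission
  imports Defs
begin

text \<open>Write $X$ for the data and $m$ for the posterior mean. The identity
  $f * f - m * m = 2 f_0 * (f - m) + 2 (m - f_0) * (f - m) + (f - m) * (f - m)$ and
  $\|g * h\|_\infty \le \|g\|_2 \|h\|_2$ show that, where the posterior concentrates,
  $\sqrt n \|f * f - m * m\|_\infty$ agrees up to $o(1)$ with $N(\sqrt n (f - X))$ for the seminorm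
  $N(w) = \|2 f_0 * w\|_\infty$. Since translations and reflections of $f_0$ have the same Fourier
  moduli as $f_0$, they are bounded in $H^s_2$ and hence in the dual of $H(\delta)$, so $N$ is
  Lipschitz on $H(\delta)$. Bounded Lipschitz convergence then compares the posterior law of
  $N(\sqrt n (f - X))$ with the law of $N(W)$, $W$ being white noise, and $\sqrt n (X - f_0)$ has exactly
  the law of $W$; this pins $R_n$ between nearby quantiles and gives the coverage, provided that $N(W)$
  has a continuous distribution function.

  For that continuity, fix $c > 0$ and scale finitely many coordinates of $W$ by $\rho > 0$, which
  preserves null sets. By convexity $N$ takes the value $c$ for at most one $\rho$ as soon as it is
  less than $c$ at $\rho = 0$, so by Fubini the event that $N(W) = c$ while the remaining coordinates
  have seminorm less than $c$ is null; and those remaining coordinates have small seminorm with high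
  probability. At $c = 0$ it suffices to vary one coordinate on which $N$ does not vanish.\<close>

text \<open>Two obstacles shape the proof. First, the quantities in the o_P and O_P hypotheses need
  not be measurable, the bounded Lipschitz distance being an uncountable supremum; each exceptional
  set is therefore enclosed in a measurable event of small probability, and off these events the
  comparison of posterior and limit is deterministic, made at one fixed data point. Second,
  translating along a coordinate cannot by itself exclude an atom at c > 0: a convex function may be
  constant on an interval, though only at its minimal value. Scaling towards a point where N is less
  than c makes c exceed that minimum, which is why coordinates are scaled and not translated. The
  condition \<open>f0 \<noteq> 0\<close> is what makes N nonzero; for f0 = 0 the limit law would be
  a point mass at 0. Since r_n bounds squared norms, the quadratic remainder, multiplied by sqrt n,
  is of order sqrt n r_n and vanishes.\<close>

section \<open>Convolution on the circle\<close>

text \<open>Its pattern \<open>f (frac (x - t))\<close> with a variable \<open>f\<close> applies to its own premise, so the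
  measurability prover loops on it.\<close>

declare measurable_circle_shift [measurable del]

lemma measurable_frac_reflect: "(\<lambda>t. frac (x - t)) \<in> measurable circle circle"
  unfolding frac_def
  by (rule measurable_restrict_space2, auto simp: space_restrict_space frac_lt_1 frac_def[symmetric])
    (auto simp: frac_def intro!: measurable_restrict_space1)

lemma emeasure_lborel_reflect:
  assumes "A \<in> sets borel"
  shows "emeasure lborel ((\<lambda>t. c - t) -` A) = emeasure lborel (A :: real set)"
proof -
  have "emeasure lborel A = (\<integral>\<^sup>+x. indicator A x \<partial>lborel)" using assms by simp
  also have "\<dots> = (\<integral>\<^sup>+x. indicator A (c + (-1) * x) \<partial>lborel)"
    using assms by (subst nn_integral_real_affine[where c = "-1" and t = c]) auto
  also have "\<dots> = (\<integral>\<^sup>+x. indicator ((\<lambda>t. c - t) -` A) x \<partial>lborel)"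
    by (intro nn_integral_cong) (auto simp: indicator_def)
  also have "\<dots> = emeasure lborel ((\<lambda>t. c - t) -` A)"
    using measurable_sets[of "\<lambda>t. c - t" borel borel A] assms by (intro nn_integral_indicator) simp
  finally show ?thesis by simp
qed

text \<open>Modulo 1 the map t to x - t is a Euclidean reflection on each of two arcs: with y = frac
  x, it maps [0, y] onto itself by y - t and (y, 1) onto itself by y - t + 1.\<close>

lemma distr_circle_reflect: "distr circle circle (\<lambda>t. frac (x - t)) = circle"
proof (rule measure_eqI)
  fix A assume "A \<in> sets (distr circle circle (\<lambda>t. frac (x - t)))"
  then have A: "A \<in> sets circle" by simp
  then have Ab: "A \<in> sets borel" and A01: "A \<subseteq> {0..<1}"
    by (auto simp: sets_restrict_space)
  define y where "y = frac x"
  have y: "0 \<le> y" "y < 1" by (auto simp: y_def frac_lt_1)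
  have fr: "frac (x - t) = (if t \<le> y then y - t else y - t + 1)" if t: "0 \<le> t" "t < 1" for t
  proof -
    have "frac (x - t) = frac (y - t)"
    proof -
      obtain k :: int where "x = y + of_int k" by (metis y_def frac_def diff_add_cancel)
      then have "x - t = (y - t) + of_int k" by simp
      then show ?thesis by (simp only: frac_def floor_add_int) simp
    qed
    moreover have "frac (y - t) = (if t \<le> y then y - t else y - t + 1)"
      using y t by (subst frac_unique_iff) auto
    ultimately show ?thesis by simp
  qed
  let ?P = "(\<lambda>t. y - t) -` (A \<inter> {0..y})" and ?Q = "(\<lambda>t. y + 1 - t) -` (A \<inter> {y<..<1})"
  have *: "(\<lambda>t. frac (x - t)) -` A \<inter> space circle = ?P \<union> ?Q"
  proof (intro set_eqI iffI)
    fix t assume "t \<in> (\<lambda>t. frac (x - t)) -` A \<inter> space circle"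
    then show "t \<in> ?P \<union> ?Q"
      using fr[of t] by (auto simp: space_restrict_space algebra_simps split: if_splits)
  next
    fix t assume t: "t \<in> ?P \<union> ?Q"
    then have "0 \<le> t" "t < 1" using A01 y by auto
    moreover from this have "frac (x - t) \<in> A"
      using t y by (subst fr) (auto simp: algebra_simps)
    ultimately show "t \<in> (\<lambda>t. frac (x - t)) -` A \<inter> space circle"
      by (simp add: space_restrict_space)
  qed
  have mP: "?P \<in> sets borel" "?Q \<in> sets borel"
    using Ab measurable_sets[of "\<lambda>t. y - t" borel borel "A \<inter> {0..y}"]
      measurable_sets[of "\<lambda>t. y + 1 - t" borel borel "A \<inter> {y<..<1}"] by simp_all
  have "emeasure (distr circle circle (\<lambda>t. frac (x - t))) A = emeasure circle (?P \<union> ?Q)"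
    using A by (simp only: emeasure_distr[OF measurable_frac_reflect] * sets_distr)
  also have "\<dots> = emeasure lborel (?P \<union> ?Q)"
    using y by (intro emeasure_restrict_space) auto
  also have "\<dots> = emeasure lborel ?P + emeasure lborel ?Q"
    using mP by (intro plus_emeasure[symmetric]) auto
  also have "\<dots> = emeasure lborel (A \<inter> {0..y}) + emeasure lborel (A \<inter> {y<..<1})"
    using Ab by (subst (1 2) emeasure_lborel_reflect) auto
  also have "\<dots> = emeasure lborel ((A \<inter> {0..y}) \<union> (A \<inter> {y<..<1}))"
    using Ab by (intro plus_emeasure) auto
  also have "(A \<inter> {0..y}) \<union> (A \<inter> {y<..<1}) = A" using A01 y by auto
  also have "emeasure lborel A = emeasure circle A"
    using A01 by (intro emeasure_restrict_space[symmetric]) auto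
  finally show "emeasure (distr circle circle (\<lambda>t. frac (x - t))) A = emeasure circle A" .
qed simp

lemma integral_circle_reflect:
  fixes f :: "real \<Rightarrow> 'a :: {banach, second_countable_topology}"
  assumes "f \<in> borel_measurable circle"
  shows "(LINT t|circle. f (frac (x - t))) = (LINT t|circle. f t)"
  using integral_distr[OF measurable_frac_reflect assms, of x] by (simp only: distr_circle_reflect)

lemma sqint_reflect:
  assumes "square_integrable f"
  shows "square_integrable (\<lambda>t. f (frac (x - t)))"
proof -
  have "integrable (distr circle circle (\<lambda>t. frac (x - t))) (\<lambda>t. (f t)\<^sup>2)"
    using assms by (simp add: distr_circle_reflect square_integrable_def)
  then have "integrable circle (\<lambda>t. (f (frac (x - t)))\<^sup>2)"
    by (rule integrable_distr[OF measurable_frac_reflect])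
  then show ?thesis
    using assms measurable_circle_shift[of f x] by (simp add: square_integrable_def)
qed

lemma sqint_rep_measurable: "rep_L2 f \<in> borel_measurable circle"
  using sqint_rep by (simp add: square_integrable_def)

lemma rep_abs_L2_AE: "square_integrable f \<Longrightarrow> AE x in circle. rep_L2 (abs_L2 f) x = f x"
  using Quotient3_rep_abs[OF Quotient3_L2, of f] by (auto simp: L2_eq_def)

lemma abs_L2_eq_iff:
  assumes "square_integrable f" "square_integrable g"
  shows "abs_L2 f = abs_L2 g \<longleftrightarrow> (AE x in circle. f x = g x)"
proof -
  have "L2_eq f g = (abs_L2 f = abs_L2 g)"
    using Quotient3_rel[OF Quotient3_L2, of f g] assms by (auto simp: L2_eq_def)
  then show ?thesis using assms by (auto simp: L2_eq_def)
qed

lemma inner_abs_L2: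
  "square_integrable f \<Longrightarrow> square_integrable g \<Longrightarrow> inner (abs_L2 f) (abs_L2 g) = (LINT x|circle. f x * g x)"
  by (simp add: inner_L2.abs_eq L2_eq_def)

lemma convol_abs_L2:
  "square_integrable f \<Longrightarrow> square_integrable g \<Longrightarrow>
    convol (abs_L2 f) (abs_L2 g) x = (LINT t|circle. f (frac (x - t)) * g t)"
  by (simp add: convol.abs_eq L2_eq_def)

text \<open>The Riesz representer of the functional that evaluates f * h at x as h varies, taken as
  a class in \<open>L2\<close>. It turns estimates for convolutions into statements about inner
  products.\<close>

definition reflect :: "L2 \<Rightarrow> real \<Rightarrow> L2" where
  "reflect f x = abs_L2 (\<lambda>t. rep_L2 f (frac (x - t)))"

lemma reflect_abs_L2:
  assumes "square_integrable f"
  shows "reflect (abs_L2 f) x = abs_L2 (\<lambda>t. f (frac (x - t)))"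
  unfolding reflect_def using assms AE_circle_shift[OF rep_abs_L2_AE[OF assms]]
  by (subst abs_L2_eq_iff) (auto intro!: sqint_reflect sqint_rep)

lemma convol_eq_inner: "convol f g x = inner (reflect f x) g"
proof -
  have "convol (abs_L2 (rep_L2 f)) (abs_L2 (rep_L2 g)) x =
      inner (reflect (abs_L2 (rep_L2 f)) x) (abs_L2 (rep_L2 g))"
    by (simp add: convol_abs_L2 reflect_abs_L2 inner_abs_L2 sqint_rep sqint_reflect)
  then show ?thesis by (simp add: abs_rep_L2)
qed

lemma reflect_add: "reflect (f + g) x = reflect f x + reflect g x"
proof -
  have "reflect (abs_L2 (rep_L2 f) + abs_L2 (rep_L2 g)) x =
      reflect (abs_L2 (rep_L2 f)) x + reflect (abs_L2 (rep_L2 g)) x"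
    by (simp add: reflect_abs_L2 abs_L2_add[symmetric] sqint_rep sqint_reflect sqint_add)
  then show ?thesis by (simp add: abs_rep_L2)
qed

lemma reflect_diff: "reflect (f - g) x = reflect f x - reflect g x"
  using reflect_add[of "f - g" g x] by simp

lemma norm_reflect: "norm (reflect f x) = norm f"
proof -
  have "(LINT t|circle. (rep_L2 f (frac (x - t)))\<^sup>2) = (LINT t|circle. (rep_L2 f t)\<^sup>2)"
    by (intro integral_circle_reflect borel_measurable_power sqint_rep_measurable)
  then have "(norm (reflect (abs_L2 (rep_L2 f)) x))\<^sup>2 = (norm (abs_L2 (rep_L2 f)))\<^sup>2"
    by (simp add: reflect_abs_L2 norm_abs_L2 sqint_reflect sqint_rep)
  then show ?thesis by (simp add: abs_rep_L2)
qed

text \<open>The substitution t to x - t modulo 1 preserves the measure and is an involution on [0,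
  1), so it interchanges the two factors. Scalar multiples of the first factor are later handled
  through this symmetry.\<close>

lemma convol_commute: "convol f g = convol g f"
proof
  fix x
  let ?f = "rep_L2 f" and ?g = "rep_L2 g"
  have ff: "frac (x - frac (x - t)) = t" if "t \<in> space circle" for t
  proof -
    have "x - frac (x - t) = t + of_int \<lfloor>x - t\<rfloor>" by (simp add: frac_def)
    then have "frac (x - frac (x - t)) = frac t" by (simp add: frac_def)
    also have "frac t = t" using that by (simp add: space_restrict_space frac_eq)
    finally show ?thesis .
  qed

  have "(LINT t|circle. ?f (frac (x - t)) * ?g t) =
      (LINT t|circle. ?f (frac (x - frac (x - t))) * ?g (frac (x - t)))"
    by (rule integral_circle_reflect[symmetric])
      (intro borel_measurable_times measurable_circle_shift sqint_rep_measurable)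
  also have "\<dots> = (LINT t|circle. ?g (frac (x - t)) * ?f t)"
    by (intro Bochner_Integration.integral_cong) (auto simp: ff mult.commute)
  finally have "convol (abs_L2 ?f) (abs_L2 ?g) x = convol (abs_L2 ?g) (abs_L2 ?f) x"
    by (simp only: convol_abs_L2[OF sqint_rep sqint_rep])
  then show "convol f g x = convol g f x" by (simp only: abs_rep_L2)
qed

lemma convol_diff_right: "convol f (g - h) x = convol f g x - convol f h x"
  by (simp add: convol_eq_inner inner_diff_right)

lemma convol_diff_left: "convol (f - g) h x = convol f h x - convol g h x"
  by (simp add: convol_eq_inner reflect_diff inner_diff_left)

lemma abs_convol_le: "\<bar>convol f g x\<bar> \<le> norm f * norm g"
  using Cauchy_Schwarz_ineq2[of "reflect f x" g] by (simp add: convol_eq_inner norm_reflect)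

lemma reflect_periodic: "reflect f (x + 1) = reflect f x"
proof -
  have "frac (x + 1 - t) = frac (x - t)" for t
  proof -
    have "x + 1 - t = (x - t) + 1" by simp
    then show ?thesis by (simp only: frac_1_eq)
  qed
  then show ?thesis by (simp add: reflect_def)
qed

lemma convol_periodic: "convol f g (x + 1) = convol f g x"
  by (simp add: convol_eq_inner reflect_periodic)

text \<open>The endpoint values \<open>D 0\<close> and \<open>D 1\<close> may differ, so the
  periodic extension of \<open>D\<close> can jump at integers. For fixed x only the countably many t
  with x - t an integer are affected, hence dominated convergence still applies.\<close>

lemma continuous_convol_continuous_rep:
  fixes D :: "real \<Rightarrow> real"
  assumes D: "continuous_on {0..1} D"
  shows "continuous_on UNIV (convol (abs_L2 D) h)"
proof -
  let ?h = "rep_L2 h"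
  have "bounded (D ` {0..1})"
    by (rule compact_imp_bounded[OF compact_continuous_image[OF D compact_Icc]])
  then obtain C where "\<forall>y\<in>D ` {0..1}. norm y \<le> C" unfolding bounded_iff by blast
  then have C: "\<bar>D x\<bar> \<le> C" if "x \<in> {0..1}" for x using that by simp
  have Dm: "D \<in> borel_measurable circle"
  proof -
    have "D \<in> borel_measurable (restrict_space borel {0..<1})"
      by (rule borel_measurable_continuous_on_restrict[OF continuous_on_subset[OF D]]) auto
    moreover have "sets (restrict_space borel {0..<1}) = sets circle" by (simp add: sets_restrict_space)
    ultimately show ?thesis using measurable_cong_sets by blast
  qed
  have sD: "square_integrable D"
    by (rule sqint_bounded_by[OF sqint_const[of C] Dm]) (use C in \<open>force intro: AE_I2 simp: space_restrict_space\<close>)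

  have eq: "convol (abs_L2 D) h x = (LINT t|circle. D (frac (x - t)) * ?h t)" for x
    using convol_abs_L2[OF sD sqint_rep, of h x] by (simp add: abs_rep_L2)
  have "(\<lambda>n. convol (abs_L2 D) h (u n)) \<longlonglongrightarrow> convol (abs_L2 D) h x" if u: "u \<longlonglongrightarrow> x" for u x
    unfolding eq
  proof (rule integral_dominated_convergence[where w = "\<lambda>t. C * \<bar>?h t\<bar>"])
    show "(\<lambda>t. D (frac (x - t)) * ?h t) \<in> borel_measurable circle"
      "\<And>n. (\<lambda>t. D (frac (u n - t)) * ?h t) \<in> borel_measurable circle"
      using Dm by (auto intro: measurable_circle_shift borel_measurable_times sqint_rep_measurable)
    show "integrable circle (\<lambda>t. C * \<bar>?h t\<bar>)"
      using sqint_integrable[OF sqint_rep[of h]] by auto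
    show "AE t in circle. norm (D (frac (u n - t)) * ?h t) \<le> C * \<bar>?h t\<bar>" for n
      using C[of "frac (u n - t)" for t] by (intro AE_I2)
        (auto simp: abs_mult intro!: mult_right_mono order_less_imp_le[OF frac_lt_1])
    have "AE t in lborel. t \<notin> (\<lambda>k. x - real_of_int k) ` UNIV"
      by (intro AE_not_in countable_imp_null_set_lborel) auto
    then have "AE t in circle. t \<notin> (\<lambda>k. x - real_of_int k) ` UNIV"
      unfolding AE_circle_iff by eventually_elim simp
    then show "AE t in circle. (\<lambda>n. D (frac (u n - t)) * ?h t) \<longlonglongrightarrow> D (frac (x - t)) * ?h t"
    proof eventually_elim
      fix t assume t: "t \<notin> (\<lambda>k. x - real_of_int k) ` UNIV"
      have "x - t \<notin> \<int>"
      proof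
        assume "x - t \<in> \<int>"
        then obtain k where "x - t = of_int k" by (auto elim: Ints_cases)
        then have "t = x - of_int k" by simp
        then show False using t by blast
      qed
      then have fr: "isCont frac (x - t)" by (rule continuous_frac)
      have f01: "0 < frac (x - t)" "frac (x - t) < 1"
        using \<open>x - t \<notin> \<int>\<close> frac_gt_0_iff frac_lt_1 by blast+
      have "isCont D (frac (x - t))"
        using D f01 by (metis continuous_on_interior interior_atLeastAtMost_real greaterThanLessThan_iff)
      then have "isCont (\<lambda>y. D (frac (y - t))) x"
        using fr by (intro isCont_o2[of x "\<lambda>y. y - t" "\<lambda>y. D (frac y)"] isCont_o2[of "x - t" frac D]) auto
      then have "(\<lambda>n. D (frac (u n - t))) \<longlonglongrightarrow> D (frac (x - t))"
        using u by (rule isCont_tendsto_compose)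
      then show "(\<lambda>n. D (frac (u n - t)) * ?h t) \<longlonglongrightarrow> D (frac (x - t)) * ?h t"
        by (intro tendsto_intros)
    qed
  qed
  then show ?thesis
    by (simp add: continuous_on_sequentially comp_def)
qed

text \<open>Needed because \<open>credible_band\<close> admits only members of
  \<open>periodic_C\<close>. Basis elements have continuous representatives, which is where S > 0
  enters, and by the sup norm bound the convolutions of approximating finite combinations converge
  uniformly.\<close>

lemma continuous_convol:
  assumes B: "regular_basis S B" and S: "S > 0"
  shows "continuous_on UNIV (convol f g)"
proof -
  let ?G = "{f. continuous_on UNIV (convol f g)}"
  have add: "f + f' \<in> ?G" if "f \<in> ?G" "f' \<in> ?G" for f f'
  proof -
    have "convol (f + f') g = (\<lambda>x. convol f g x + convol f' g x)"
      by (rule ext) (simp add: convol_eq_inner reflect_add inner_add_left)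
    then show ?thesis using that continuous_on_add[of UNIV "convol f g" "convol f' g"] by simp
  qed
  have scale: "c *\<^sub>R f \<in> ?G" if "f \<in> ?G" for f c
  proof -
    have "convol (c *\<^sub>R f) g = (\<lambda>x. c * convol f g x)"
      by (rule ext) (simp only: convol_commute[of _ g] convol_eq_inner inner_scaleR_right)
    then show ?thesis using that continuous_on_mult_left[of UNIV "convol f g" c] by simp
  qed
  have zero: "0 \<in> ?G"
  proof -
    have "convol 0 g = (\<lambda>x. 0)" by (rule ext) (simp only: convol_commute[of _ g] convol_eq_inner inner_zero_right)
    then show ?thesis by simp
  qed
  have el: "(\<lambda>(l, k). elem B l k) ` idx B \<subseteq> ?G"
  proof clarify
    fix l k assume "(l, k) \<in> idx B"
    then have "times_differentiable S (elem B l k)" using B by (auto simp: regular_basis_def)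
    then obtain D :: "nat \<Rightarrow> real \<Rightarrow> real" where D: "elem B l k = abs_L2 (D 0)"
      "\<forall>x\<in>{0..1}. (D 0 has_real_derivative D 1 x) (at x within {0..1})"
      using S unfolding times_differentiable_def by force
    have "continuous_on {0..1} (D 0)"
      by (rule DERIV_continuous_on) (use D in auto)
    then show "continuous_on UNIV (convol (elem B l k) g)"
      unfolding D by (rule continuous_convol_continuous_rep)
  qed
  have sp: "span ((\<lambda>(l, k). elem B l k) ` idx B) \<subseteq> ?G"
    by (rule span_minimal[OF el]) (use add scale zero in \<open>auto simp: subspace_def\<close>)
  have "f \<in> closure (span ((\<lambda>(l, k). elem B l k) ` idx B))"
    using B by (auto simp: regular_basis_def)
  then obtain p where p: "\<And>n. p n \<in> span ((\<lambda>(l, k). elem B l k) ` idx B)" "p \<longlonglongrightarrow> f"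
    unfolding closure_sequential by blast
  show ?thesis
  proof (rule uniform_limit_theorem)
    show "\<forall>\<^sub>F n in sequentially. continuous_on UNIV (convol (p n) g)"
      using p sp by (intro always_eventually) auto
    show "uniform_limit UNIV (\<lambda>n. convol (p n) g) (convol f g) sequentially"
    proof (rule uniform_limitI)
      fix e :: real assume e: "e > 0"
      have "(\<lambda>n. norm (p n - f) * norm g) \<longlonglongrightarrow> 0"
        by (rule tendsto_mult_left_zero) (use p(2) in \<open>simp add: LIM_zero tendsto_norm_zero\<close>)
      then have "\<forall>\<^sub>F n in sequentially. norm (p n - f) * norm g < e"
        using e by (rule order_tendstoD)
      then show "\<forall>\<^sub>F n in sequentially. \<forall>x\<in>UNIV. dist (convol (p n) g x) (convol f g x) < e"
      proof eventually_elim
        fix n assume "norm (p n - f) * norm g < e"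
        then show "\<forall>x\<in>UNIV. dist (convol (p n) g x) (convol f g x) < e"
          using abs_convol_le[of "p n - f" g] by (auto simp: dist_real_def convol_diff_left intro: order_le_less_trans)
      qed
    qed
  qed simp
qed

section \<open>Parseval identity and the dual of the coefficient space\<close>

abbreviation basis_elem :: "l2_basis \<Rightarrow> int \<times> int \<Rightarrow> L2" where
  "basis_elem B \<equiv> \<lambda>(l, k). elem B l k"

lemma basis_coeff_idx: "i \<in> idx B \<Longrightarrow> basis_coeff B f i = inner (basis_elem B i) f"
  by (cases i) (simp add: basis_coeff_def)

lemma basis_coeff_not_idx: "i \<notin> idx B \<Longrightarrow> basis_coeff B f i = 0"
  by (cases i) (simp add: basis_coeff_def)

lemma basis_coeff_add: "basis_coeff B (f + g) i = basis_coeff B f i + basis_coeff B g i"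
  by (cases i) (simp add: basis_coeff_def inner_add_right)

lemma basis_coeff_diff: "basis_coeff B (f - g) i = basis_coeff B f i - basis_coeff B g i"
  by (cases i) (simp add: basis_coeff_def inner_diff_right)

lemma basis_orthonormal:
  assumes "regular_basis S B" "i \<in> idx B" "j \<in> idx B"
  shows "inner (basis_elem B i) (basis_elem B j) = (if i = j then 1 else 0)"
  using assms by (cases i; cases j) (force simp: regular_basis_def)

text \<open>Completing the square: the excess over the squared distance to the span is the squared
  error of the coefficients. Taking \<open>c\<close> to be the basis coefficients yields Bessel's
  inequality, a general \<open>c\<close> the best approximation property.\<close>

lemma norm_diff_basis_sum:
  assumes B: "regular_basis S B" and F: "finite F" "F \<subseteq> idx B"
  shows "(norm (f - (\<Sum>i\<in>F. c i *\<^sub>R basis_elem B i)))\<^sup>2 =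
    (norm f)\<^sup>2 - (\<Sum>i\<in>F. (basis_coeff B f i)\<^sup>2) + (\<Sum>i\<in>F. (basis_coeff B f i - c i)\<^sup>2)"
proof -
  let ?p = "\<Sum>i\<in>F. c i *\<^sub>R basis_elem B i"
  have fp: "inner f ?p = (\<Sum>i\<in>F. c i * basis_coeff B f i)"
    unfolding inner_sum_right inner_scaleR_right
    by (intro sum.cong refl) (use F in \<open>auto simp: basis_coeff_idx inner_commute\<close>)
  have "inner (basis_elem B i) ?p = c i" if "i \<in> F" for i
  proof -
    have "inner (basis_elem B i) ?p = (\<Sum>j\<in>F. if i = j then c j else 0)"
      unfolding inner_sum_right inner_scaleR_right
    proof (intro sum.cong refl)
      fix j assume "j \<in> F"
      then show "c j * inner (basis_elem B i) (basis_elem B j) = (if i = j then c j else 0)"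
        using F that basis_orthonormal[OF B, of i j] by (simp add: subsetD)
    qed
    then show ?thesis using F that by simp
  qed
  then have pp: "inner ?p ?p = (\<Sum>i\<in>F. c i * c i)"
    unfolding inner_sum_left[of _ F ?p] inner_scaleR_left by (intro sum.cong refl) simp
  have "(norm (f - ?p))\<^sup>2 = (norm f)\<^sup>2 - 2 * inner f ?p + inner ?p ?p"
    unfolding power2_norm_eq_inner by (simp add: inner_diff_left inner_diff_right inner_commute)
  also have "\<dots> = (norm f)\<^sup>2 + (\<Sum>i\<in>F. c i * c i - 2 * (c i * basis_coeff B f i))"
    by (simp add: fp pp sum_subtractf sum_distrib_left)
  also have "(\<Sum>i\<in>F. c i * c i - 2 * (c i * basis_coeff B f i)) =
      (\<Sum>i\<in>F. (basis_coeff B f i - c i)\<^sup>2 - (basis_coeff B f i)\<^sup>2)"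
    by (intro sum.cong refl) (simp add: power2_eq_square algebra_simps)
  finally show ?thesis by (simp add: sum_subtractf)
qed

lemma bessel:
  assumes "regular_basis S B" "finite F" "F \<subseteq> idx B"
  shows "(\<Sum>i\<in>F. (basis_coeff B f i)\<^sup>2) \<le> (norm f)\<^sup>2"
  using norm_diff_basis_sum[OF assms, of f "basis_coeff B f"]
    zero_le_power2[of "norm (f - (\<Sum>i\<in>F. basis_coeff B f i *\<^sub>R basis_elem B i))"] by simp

text \<open>Bessel bounds the sum by the squared norm. Conversely, density provides a finite
  combination within e of f, and by best approximation the missing part of the squared norm is at
  most the square of e.\<close>

lemma parseval_norm:
  assumes B: "regular_basis S B"
  shows "((\<lambda>i. (basis_coeff B f i)\<^sup>2) has_sum (norm f)\<^sup>2) (idx B)"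
proof -
  have sm: "(\<lambda>i. (basis_coeff B f i)\<^sup>2) summable_on idx B"
    by (rule nonneg_bdd_above_summable_on)
      (use bessel[OF B, of _ f] in \<open>auto simp: bdd_above_def\<close>)
  \<comment> \<open>\<open>span_explicit\<close> yields a combination over vectors; injectivity lets
    it be read as one over indices.\<close>
  have inj: "inj_on (basis_elem B) (idx B)"
    using basis_orthonormal[OF B] by (intro inj_onI) (metis zero_neq_one)
  have "(norm f)\<^sup>2 \<le> (\<Sum>\<^sub>\<infinity>i\<in>idx B. (basis_coeff B f i)\<^sup>2) + e\<^sup>2" if e: "e > 0" for e
  proof -
    have "f \<in> closure (span (basis_elem B ` idx B))"
      using B by (auto simp: regular_basis_def)
    then obtain p where p: "p \<in> span (basis_elem B ` idx B)" "dist p f < e"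
      using e closure_approachable by blast
    obtain t r where t: "finite t" "t \<subseteq> basis_elem B ` idx B" "p = (\<Sum>v\<in>t. r v *\<^sub>R v)"
      using p(1) unfolding span_explicit by blast
    obtain F where F: "F \<subseteq> idx B" "t = basis_elem B ` F" using t(2) by (meson subset_image_iff)
    have injF: "inj_on (basis_elem B) F" by (rule inj_on_subset[OF inj F(1)])
    have fF: "finite F" using t(1) F(2) injF finite_image_iff by blast
    have "p = (\<Sum>i\<in>F. r (basis_elem B i) *\<^sub>R basis_elem B i)"
      unfolding t(3) F(2) by (rule sum.reindex_cong[OF injF refl]) simp
    then have "(norm f)\<^sup>2 - (\<Sum>i\<in>F. (basis_coeff B f i)\<^sup>2) \<le> (norm (f - p))\<^sup>2"
      using norm_diff_basis_sum[OF B fF F(1), of f "\<lambda>i. r (basis_elem B i)"]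
        sum_nonneg[of F "\<lambda>i. (basis_coeff B f i - r (basis_elem B i))\<^sup>2"] by simp
    also have "(norm (f - p))\<^sup>2 \<le> e\<^sup>2"
      using p(2) by (intro power_mono) (auto simp: dist_norm norm_minus_commute)
    finally show ?thesis
      using finite_sum_le_infsum[OF sm fF F(1)] by simp
  qed
  then have "(norm f)\<^sup>2 \<le> (\<Sum>\<^sub>\<infinity>i\<in>idx B. (basis_coeff B f i)\<^sup>2) + e" if "e > 0" for e
    using that by (metis real_sqrt_gt_zero real_sqrt_pow2 less_imp_le)
  then have "(norm f)\<^sup>2 \<le> (\<Sum>\<^sub>\<infinity>i\<in>idx B. (basis_coeff B f i)\<^sup>2)"
    by (rule field_le_epsilon)
  moreover have "(\<Sum>\<^sub>\<infinity>i\<in>idx B. (basis_coeff B f i)\<^sup>2) \<le> (norm f)\<^sup>2"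
    by (rule infsum_le_finite_sums[OF sm]) (rule bessel[OF B])
  ultimately show ?thesis using has_sum_infsum[OF sm] by simp
qed

text \<open>Polarization of the norm identity; the summands polarize in the same way.\<close>

lemma parseval_inner:
  assumes B: "regular_basis S B"
  shows "((\<lambda>i. basis_coeff B f i * basis_coeff B g i) has_sum inner f g) (idx B)"
proof -
  have "((\<lambda>i. 1/4 * ((basis_coeff B (f + g) i)\<^sup>2 + (-1) * (basis_coeff B (f - g) i)\<^sup>2)) has_sum
      1/4 * ((norm (f + g))\<^sup>2 + (-1) * (norm (f - g))\<^sup>2)) (idx B)"
    by (intro has_sum_cmult_right has_sum_add parseval_norm[OF B])
  moreover have "1/4 * ((norm (f + g))\<^sup>2 + (-1) * (norm (f - g))\<^sup>2) = inner f g"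
    unfolding power2_norm_eq_inner by (simp add: inner_simps inner_commute)
  moreover have "1/4 * ((basis_coeff B (f + g) i)\<^sup>2 + (-1) * (basis_coeff B (f - g) i)\<^sup>2) =
      basis_coeff B f i * basis_coeff B g i" for i
    by (simp add: basis_coeff_add basis_coeff_diff power2_eq_square algebra_simps)
  ultimately show ?thesis by simp
qed

section \<open>Fourier coefficients of reflections and the dual of the coefficient space\<close>

lemma fourier_coeff_abs_L2:
  "square_integrable f \<Longrightarrow>
    fourier_coeff (abs_L2 f) m = (LINT x|circle. complex_of_real (f x) * cis (- 2 * pi * real_of_int m * x))"
  by (simp add: fourier_coeff.abs_eq L2_eq_def)

lemma cis_int_shift: "cis (- 2 * pi * real_of_int m * (t + real_of_int k)) = cis (- 2 * pi * real_of_int m * t)"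
proof -
  have "- 2 * pi * real_of_int m * (t + real_of_int k) =
      - 2 * pi * real_of_int m * t + 2 * pi * real_of_int (- m * k)"
    by (simp add: algebra_simps)
  moreover have "cis (2 * pi * real_of_int (- m * k)) = 1"
    by (rule cis_multiple_2pi) auto
  ultimately show ?thesis by (simp only: cis_mult[symmetric]) simp
qed

text \<open>Since f is real, reflection conjugates its Fourier coefficients, and translation by x
  contributes a unimodular factor. The modulus therefore does not depend on x.\<close>

lemma fourier_coeff_reflect:
  "fourier_coeff (reflect f x) m = cis (- 2 * pi * real_of_int m * x) * cnj (fourier_coeff f m)"
proof -
  let ?f = "rep_L2 f"
  \<comment> \<open>Written so that evaluation at frac (x - t) returns the original integrand: x -
    frac (x - t) differs from t by an integer, which the character does not see.\<close>
  define h where "h u = complex_of_real (?f u) * cis (- 2 * pi * real_of_int m * (x - u))" for u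
  have cm: "(\<lambda>u. cis (- 2 * pi * real_of_int m * (x - u))) \<in> borel_measurable circle"
    by (intro measurable_restrict_space1) (auto intro!: borel_measurable_continuous_onI continuous_intros)
  have hm: "h \<in> borel_measurable circle"
  proof -
    note [measurable] = sqint_rep_measurable[of f] cm
    show ?thesis unfolding h_def[abs_def] by measurable
  qed
  have "fourier_coeff (reflect (abs_L2 ?f) x) m =
      (LINT t|circle. complex_of_real (?f (frac (x - t))) * cis (- 2 * pi * real_of_int m * t))"
    by (simp add: reflect_abs_L2 sqint_rep fourier_coeff_abs_L2 sqint_reflect)
  also have "\<dots> = (LINT t|circle. h (frac (x - t)))"
  proof (intro Bochner_Integration.integral_cong refl)
    fix t
    have "x - frac (x - t) = t + real_of_int \<lfloor>x - t\<rfloor>" by (simp add: frac_def)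
    then show "complex_of_real (?f (frac (x - t))) * cis (- 2 * pi * real_of_int m * t) = h (frac (x - t))"
      by (simp only: h_def cis_int_shift)
  qed
  also have "\<dots> = (LINT t|circle. h t)" by (rule integral_circle_reflect[OF hm])
  also have "\<dots> = (LINT t|circle. cis (- 2 * pi * real_of_int m * x) *
      cnj (complex_of_real (?f t) * cis (- 2 * pi * real_of_int m * t)))"
    by (intro Bochner_Integration.integral_cong refl)
      (simp add: h_def cis_cnj cis_mult right_diff_distrib mult.left_commute)
  also have "\<dots> = cis (- 2 * pi * real_of_int m * x) * cnj (fourier_coeff (abs_L2 ?f) m)"
    by (simp only: integral_mult_right_zero Bochner_Integration.integral_cnj fourier_coeff_abs_L2[OF sqint_rep])
  finally show ?thesis by (simp only: abs_rep_L2)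
qed

lemma norm_fourier_coeff_reflect: "cmod (fourier_coeff (reflect f x) m) = cmod (fourier_coeff f m)"
  by (simp add: fourier_coeff_reflect norm_mult)

text \<open>Fourier moduli decide membership only in \<open>fourier_sobolev\<close>; the equality of
  the two spaces in \<open>fourier_equivalent\<close> carries it back to \<open>sobolev B s\<close>,
  and the norm comparison makes the bound uniform in x.\<close>

lemma sobolev_reflect:
  assumes "fourier_equivalent B s" "f \<in> sobolev B s"
  obtains C where "\<And>x. reflect f x \<in> sobolev B s" "\<And>x. sobolev_norm B s (reflect f x) \<le> C"
proof -
  obtain C where cC: "\<And>f. f \<in> sobolev B s \<Longrightarrow> sobolev_norm B s f \<le> C * fourier_sobolev_norm s f"
    and eq: "sobolev B s = fourier_sobolev s"
    using assms(1) unfolding fourier_equivalent_def by blast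
  have 1: "reflect f x \<in> sobolev B s" for x
    using assms(2) unfolding eq by (simp add: fourier_sobolev_def norm_fourier_coeff_reflect)
  moreover have "sobolev_norm B s (reflect f x) \<le> C * fourier_sobolev_norm s f" for x
    using cC[OF 1[of x]] by (simp add: fourier_sobolev_norm_def norm_fourier_coeff_reflect)
  ultimately show ?thesis using that by blast
qed

text \<open>With a the characteristic value, the inverse weight is a times a power of log a; the
  surplus power a^(2 s - 1), whose exponent is positive since s > 1/2, absorbs the
  logarithm.\<close>

lemma inverse_H_weight_le:
  assumes B: "regular_basis S B" and s: "s > 1/2" and d: "\<delta> > 0"
  obtains C where "C > 0" "\<And>l k. (l, k) \<in> idx B \<Longrightarrow> 1 / H_weight B \<delta> (l, k) \<le> C * char_seq B l powr (2 * s)"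
proof
  \<comment> \<open>Chosen so that raising ln a \<le> a^\<epsilon> / \<epsilon> to the power 2
    \<delta> produces exactly a^(2 s - 1).\<close>
  define \<epsilon> where "\<epsilon> = (2 * s - 1) / (2 * \<delta>)"
  have e: "\<epsilon> > 0" using s d by (simp add: \<epsilon>_def)
  show "(1 / \<epsilon>) powr (2 * \<delta>) > 0" using e by simp
  fix l k assume "(l, k) \<in> idx B"
  then have a: "char_seq B l \<ge> 2" using char_seq_ge_2[OF B] by (auto simp: idx_def)
  define a where "a = char_seq B l"
  have a2: "a \<ge> 2" "ln a > 0" using a by (auto simp: a_def)
  have "ln a \<le> a powr \<epsilon> / \<epsilon>" using ln_powr_bound[of a \<epsilon>] a2 e by simp
  then have "(ln a) powr (2 * \<delta>) \<le> (1 / \<epsilon> * a powr \<epsilon>) powr (2 * \<delta>)"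
    using a2 d by (intro powr_mono2) auto
  also have "\<dots> = (1 / \<epsilon>) powr (2 * \<delta>) * a powr (2 * s - 1)"
  proof -
    have "\<epsilon> * (2 * \<delta>) = 2 * s - 1" using d by (simp add: \<epsilon>_def)
    then show ?thesis
      using powr_mult[of "1 / \<epsilon>" "a powr \<epsilon>" "2 * \<delta>"] e by (simp only: powr_powr)
  qed
  finally have "a * (ln a) powr (2 * \<delta>) \<le> a * ((1 / \<epsilon>) powr (2 * \<delta>) * a powr (2 * s - 1))"
    using a2 by (intro mult_left_mono) auto
  also have "\<dots> = (1 / \<epsilon>) powr (2 * \<delta>) * a powr (2 * s)"
    using a2 by (simp add: powr_diff)
  finally show "1 / H_weight B \<delta> (l, k) \<le> (1 / \<epsilon>) powr (2 * \<delta>) * char_seq B l powr (2 * s)"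
    using a2 by (simp add: H_weight_def a_def powr_minus field_simps)
qed

text \<open>The dual norm of a weighted sequence space carries the inverse weights. Uniformity in x
  is what makes the supremum over x of the convolution finite and Lipschitz on
  \<open>H_space\<close>.\<close>

lemma H_dual_bound_reflect:
  assumes B: "regular_basis S B" "fourier_equivalent B s" and s: "s > 1/2" and d: "\<delta> > 0"
    and f: "f \<in> sobolev B s"
  obtains D where "D > 0"
    "\<And>x. (\<lambda>i. (basis_coeff B (reflect f x) i)\<^sup>2 / H_weight B \<delta> i) summable_on idx B"
    "\<And>x. sqrt (\<Sum>\<^sub>\<infinity>i\<in>idx B. (basis_coeff B (reflect f x) i)\<^sup>2 / H_weight B \<delta> i) \<le> D"
proof -
  obtain C where C: "C > 0"
    "\<And>l k. (l, k) \<in> idx B \<Longrightarrow> 1 / H_weight B \<delta> (l, k) \<le> C * char_seq B l powr (2 * s)"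
    using inverse_H_weight_le[OF B(1) s d] by blast
  obtain D where D: "\<And>x. reflect f x \<in> sobolev B s" "\<And>x. sobolev_norm B s (reflect f x) \<le> D"
    using sobolev_reflect[OF B(2) f] by blast
  let ?g = "\<lambda>x. \<lambda>(l, k). char_seq B l powr (2 * s) * (inner (elem B l k) (reflect f x))\<^sup>2"
  let ?h = "\<lambda>x i. (basis_coeff B (reflect f x) i)\<^sup>2 / H_weight B \<delta> i"
  have g: "?g x summable_on idx B" for x using D(1)[of x] by (simp add: sobolev_def)
  have hg: "?h x i \<le> C * ?g x i" "0 \<le> ?h x i" if i: "i \<in> idx B" for x i
  proof -
    obtain l k where lk: "i = (l, k)" by (cases i)
    have "?h x i = 1 / H_weight B \<delta> i * (inner (elem B l k) (reflect f x))\<^sup>2"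
      using i by (simp add: basis_coeff_def lk)
    also have "\<dots> \<le> (C * char_seq B l powr (2 * s)) * (inner (elem B l k) (reflect f x))\<^sup>2"
      using C(2)[of l k] i by (intro mult_right_mono) (auto simp: lk)
    finally show "?h x i \<le> C * ?g x i" by (simp add: lk mult.assoc)
    show "0 \<le> ?h x i" using H_weight_pos[OF B(1) i, of \<delta>] by simp
  qed
  have hs: "?h x summable_on idx B" for x
    by (rule summable_on_comparison_test[OF summable_on_cmult_right[OF g, of C x]]) (use hg in auto)
  have "sqrt (\<Sum>\<^sub>\<infinity>i\<in>idx B. ?h x i) \<le> sqrt C * (\<bar>D\<bar> + 1)" for x
  proof -
    have "(\<Sum>\<^sub>\<infinity>i\<in>idx B. ?h x i) \<le> (\<Sum>\<^sub>\<infinity>i\<in>idx B. C * ?g x i)"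
      by (rule infsum_mono[OF hs summable_on_cmult_right[OF g]]) (use hg in auto)
    also have "\<dots> = C * (\<Sum>\<^sub>\<infinity>i\<in>idx B. ?g x i)" by (rule infsum_cmult_right) (rule g)
    finally have "sqrt (\<Sum>\<^sub>\<infinity>i\<in>idx B. ?h x i) \<le> sqrt (C * (\<Sum>\<^sub>\<infinity>i\<in>idx B. ?g x i))"
      by (rule real_sqrt_le_mono)
    also have "\<dots> = sqrt C * sobolev_norm B s (reflect f x)"
      by (simp only: real_sqrt_mult sobolev_norm_def)
    also have "\<dots> \<le> sqrt C * (\<bar>D\<bar> + 1)"
      using D(2)[of x] C(1) by (intro mult_left_mono) auto
    finally show ?thesis .
  qed
  moreover have "sqrt C * (\<bar>D\<bar> + 1) > 0" using C(1) by auto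
  ultimately show ?thesis using that[of "sqrt C * (\<bar>D\<bar> + 1)"] hs by blast
qed

lemma H_norm_nonneg:
  assumes "regular_basis S B" shows "0 \<le> H_norm B \<delta> x"
  unfolding H_norm_def
  by (intro real_sqrt_ge_zero infsum_nonneg mult_nonneg_nonneg) (auto intro: less_imp_le H_weight_pos[OF assms])

text \<open>Weighted Cauchy-Schwarz, splitting each product into sqrt w times x and y over sqrt w.
  Finite sums of absolute values come first, since their bound also yields summability.\<close>

lemma H_cauchy_schwarz:
  assumes B: "regular_basis S B" and x: "x \<in> H_space B \<delta>"
    and y: "(\<lambda>i. (y i)\<^sup>2 / H_weight B \<delta> i) summable_on idx B"
  shows "(\<lambda>i. x i * y i) summable_on idx B"
    and "\<bar>\<Sum>\<^sub>\<infinity>i\<in>idx B. x i * y i\<bar> \<le> H_norm B \<delta> x * sqrt (\<Sum>\<^sub>\<infinity>i\<in>idx B. (y i)\<^sup>2 / H_weight B \<delta> i)"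
proof -
  let ?w = "H_weight B \<delta>" and ?I = "idx B"
  let ?M = "H_norm B \<delta> x * sqrt (\<Sum>\<^sub>\<infinity>i\<in>?I. (y i)\<^sup>2 / ?w i)"
  have w: "?w i > 0" if "i \<in> ?I" for i by (rule H_weight_pos[OF B that])
  have xs: "(\<lambda>i. ?w i * (x i)\<^sup>2) summable_on ?I" using x by (simp add: H_space_def)
  have fin: "(\<Sum>i\<in>F. \<bar>x i * y i\<bar>) \<le> ?M" if F: "finite F" "F \<subseteq> ?I" for F
  proof -
    have wF: "?w i > 0" if "i \<in> F" for i using w F that by blast
    have "(\<Sum>i\<in>F. \<bar>x i * y i\<bar>) = (\<Sum>i\<in>F. \<bar>sqrt (?w i) * x i\<bar> * \<bar>y i / sqrt (?w i)\<bar>)"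
    proof (intro sum.cong refl)
      fix i assume "i \<in> F"
      then show "\<bar>x i * y i\<bar> = \<bar>sqrt (?w i) * x i\<bar> * \<bar>y i / sqrt (?w i)\<bar>"
        using wF[of i] by (simp add: abs_mult)
    qed
    also have "\<dots> \<le> L2_set (\<lambda>i. sqrt (?w i) * x i) F * L2_set (\<lambda>i. y i / sqrt (?w i)) F"
      by (rule L2_set_mult_ineq)
    also have "L2_set (\<lambda>i. sqrt (?w i) * x i) F = sqrt (\<Sum>i\<in>F. ?w i * (x i)\<^sup>2)"
      unfolding L2_set_def using wF
      by (intro arg_cong[of _ _ sqrt] sum.cong refl) (simp add: power_mult_distrib less_imp_le)
    also have "L2_set (\<lambda>i. y i / sqrt (?w i)) F = sqrt (\<Sum>i\<in>F. (y i)\<^sup>2 / ?w i)"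
      unfolding L2_set_def using wF
      by (intro arg_cong[of _ _ sqrt] sum.cong refl) (simp add: power_divide less_imp_le)
    also have "sqrt (\<Sum>i\<in>F. ?w i * (x i)\<^sup>2) * sqrt (\<Sum>i\<in>F. (y i)\<^sup>2 / ?w i) \<le> ?M"
      unfolding H_norm_def using w F wF
      by (intro mult_mono real_sqrt_le_mono finite_sum_le_infsum xs y real_sqrt_ge_zero sum_nonneg infsum_nonneg)
        (simp_all add: less_imp_le)
    finally show ?thesis .
  qed
  have as: "(\<lambda>i. \<bar>x i * y i\<bar>) summable_on ?I"
    by (rule nonneg_bdd_above_summable_on) (use fin in \<open>auto simp: bdd_above_def\<close>)
  then show s: "(\<lambda>i. x i * y i) summable_on ?I"
    using abs_summable_summable[of "\<lambda>i. x i * y i" ?I] by simp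
  have "\<bar>\<Sum>\<^sub>\<infinity>i\<in>?I. x i * y i\<bar> \<le> (\<Sum>\<^sub>\<infinity>i\<in>?I. \<bar>x i * y i\<bar>)"
    using norm_infsum_bound[of "\<lambda>i. x i * y i" ?I] as by simp
  also have "\<dots> \<le> ?M" by (rule infsum_le_finite_sums[OF as fin])
  finally show "\<bar>\<Sum>\<^sub>\<infinity>i\<in>?I. x i * y i\<bar> \<le> ?M" .
qed

section \<open>The sup norm of a convolution as a seminorm on the coefficient space\<close>

lemma H_weight_nonneg: "regular_basis S B \<Longrightarrow> i \<in> idx B \<Longrightarrow> 0 \<le> H_weight B \<delta> i"
  using H_weight_pos less_imp_le by blast

lemma H_space_zero: "(\<lambda>_. 0) \<in> H_space B \<delta>"
  by (simp add: H_space_def)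

lemma H_space_scale: "x \<in> H_space B \<delta> \<Longrightarrow> (\<lambda>i. c * x i) \<in> H_space B \<delta>"
  using summable_on_cmult_right[of "\<lambda>i. H_weight B \<delta> i * (x i)\<^sup>2" "idx B" "c\<^sup>2"]
  by (auto simp: H_space_def power_mult_distrib mult.left_commute)

lemma H_space_add:
  assumes B: "regular_basis S B" and x: "x \<in> H_space B \<delta>" and y: "y \<in> H_space B \<delta>"
  shows "(\<lambda>i. x i + y i) \<in> H_space B \<delta>"
proof -
  have "(\<lambda>i. H_weight B \<delta> i * (x i + y i)\<^sup>2) summable_on idx B"
  proof (rule summable_on_comparison_test)
    show "(\<lambda>i. 2 * (H_weight B \<delta> i * (x i)\<^sup>2) + 2 * (H_weight B \<delta> i * (y i)\<^sup>2)) summable_on idx B"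
      using x y by (intro summable_on_add summable_on_cmult_right) (auto simp: H_space_def)
    fix i assume i: "i \<in> idx B"
    have "(x i - y i)\<^sup>2 + (x i + y i)\<^sup>2 = 2 * (x i)\<^sup>2 + 2 * (y i)\<^sup>2"
      by (simp add: power2_eq_square algebra_simps)
    then have "(x i + y i)\<^sup>2 \<le> 2 * (x i)\<^sup>2 + 2 * (y i)\<^sup>2"
      using zero_le_power2[of "x i - y i"] by linarith
    then have "H_weight B \<delta> i * (x i + y i)\<^sup>2 \<le> H_weight B \<delta> i * (2 * (x i)\<^sup>2 + 2 * (y i)\<^sup>2)"
      using H_weight_nonneg[OF B i] by (intro mult_left_mono) auto
    then show "H_weight B \<delta> i * (x i + y i)\<^sup>2 \<le>
        2 * (H_weight B \<delta> i * (x i)\<^sup>2) + 2 * (H_weight B \<delta> i * (y i)\<^sup>2)"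
      by (simp add: algebra_simps)
    show "0 \<le> H_weight B \<delta> i * (x i + y i)\<^sup>2" using H_weight_nonneg[OF B i] by simp
  qed
  then show ?thesis using x y by (simp add: H_space_def)
qed

lemma H_space_diff:
  assumes "regular_basis S B" "x \<in> H_space B \<delta>" "y \<in> H_space B \<delta>"
  shows "(\<lambda>i. x i - y i) \<in> H_space B \<delta>"
  using H_space_add[OF assms(1,2) H_space_scale[OF assms(3), of "-1"]] by simp

lemma H_space_finite_support:
  assumes "finite F" "F \<subseteq> idx B" "\<And>i. i \<notin> F \<Longrightarrow> x i = 0"
  shows "x \<in> H_space B \<delta>"
proof -
  have "(\<lambda>i. H_weight B \<delta> i * (x i)\<^sup>2) summable_on F" using assms(1) by (rule summable_on_finite)
  then have "(\<lambda>i. H_weight B \<delta> i * (x i)\<^sup>2) summable_on idx B"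
    using assms by (elim summable_on_cong_neutral[THEN iffD1, rotated -1]) auto
  then show ?thesis using assms by (auto simp: H_space_def)
qed

lemma H_norm_scale: "H_norm B \<delta> (\<lambda>i. c * x i) = \<bar>c\<bar> * H_norm B \<delta> x"
proof -
  have "(\<Sum>\<^sub>\<infinity>i\<in>idx B. H_weight B \<delta> i * (c * x i)\<^sup>2) = c\<^sup>2 * (\<Sum>\<^sub>\<infinity>i\<in>idx B. H_weight B \<delta> i * (x i)\<^sup>2)"
    by (simp only: infsum_cmult_right'[symmetric] power_mult_distrib mult.left_commute)
  then show ?thesis by (simp add: H_norm_def real_sqrt_mult)
qed

text \<open>Characteristic values are at least 2, so every weight is at most
  \<open>ln 2 powr (- 2 * \<delta>)\<close>, and Parseval gives a continuous embedding of
  \<open>L2\<close>.\<close>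

lemma basis_coeff_in_H:
  assumes B: "regular_basis S B" and d: "\<delta> > 0"
  shows "basis_coeff B f \<in> H_space B \<delta>"
    and "H_norm B \<delta> (basis_coeff B f) \<le> sqrt (ln 2 powr (- 2 * \<delta>)) * norm f"
proof -
  let ?c = "ln 2 powr (- 2 * \<delta>)"
  have w: "H_weight B \<delta> i \<le> ?c" if i: "i \<in> idx B" for i
  proof -
    obtain l k where lk: "i = (l, k)" by (cases i)
    have a: "char_seq B l \<ge> 2" using char_seq_ge_2[OF B] i by (auto simp: idx_def lk)
    have "(ln (char_seq B l)) powr (- 2 * \<delta>) \<le> ?c" using a d by (intro powr_mono2') auto
    moreover have "inverse (char_seq B l) \<le> 1" using a by (simp add: inverse_le_1_iff)
    ultimately have "inverse (char_seq B l) * (ln (char_seq B l)) powr (- 2 * \<delta>) \<le> 1 * ?c"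
      using a by (intro mult_mono) auto
    then show ?thesis by (simp add: H_weight_def lk)
  qed
  have le: "H_weight B \<delta> i * (basis_coeff B f i)\<^sup>2 \<le> ?c * (basis_coeff B f i)\<^sup>2"
      "0 \<le> H_weight B \<delta> i * (basis_coeff B f i)\<^sup>2" if "i \<in> idx B" for i
    using w[OF that] H_weight_nonneg[OF B that, of \<delta>] by (auto intro: mult_right_mono)
  have hs: "((\<lambda>i. ?c * (basis_coeff B f i)\<^sup>2) has_sum (?c * (norm f)\<^sup>2)) (idx B)"
    by (intro has_sum_cmult_right parseval_norm[OF B])
  have sm: "(\<lambda>i. H_weight B \<delta> i * (basis_coeff B f i)\<^sup>2) summable_on idx B"
    by (rule summable_on_comparison_test[OF has_sum_imp_summable[OF hs]]) (use le in auto)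
  then show "basis_coeff B f \<in> H_space B \<delta>"
    unfolding H_space_def using basis_coeff_not_idx by blast
  have "(\<Sum>\<^sub>\<infinity>i\<in>idx B. H_weight B \<delta> i * (basis_coeff B f i)\<^sup>2) \<le> ?c * (norm f)\<^sup>2"
    using infsum_mono[OF sm has_sum_imp_summable[OF hs] le(1)] infsumI[OF hs] by simp
  then have "H_norm B \<delta> (basis_coeff B f) \<le> sqrt (?c * (norm f)\<^sup>2)"
    unfolding H_norm_def by (rule real_sqrt_le_mono)
  then show "H_norm B \<delta> (basis_coeff B f) \<le> sqrt ?c * norm f"
    by (simp add: real_sqrt_mult)
qed

text \<open>A supremum of reals is meaningful only for bounded functions, which is why the lemmas on
  \<open>unif_norm\<close> carry boundedness hypotheses.\<close>

lemma unif_norm_nonneg: "0 \<le> unif_norm g" if "bdd_above ((\<lambda>x. \<bar>g x\<bar>) ` {0..<1})"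
proof -
  have "\<bar>g 0\<bar> \<le> unif_norm g" unfolding unif_norm_def by (rule cSUP_upper[OF _ that]) simp
  then show ?thesis by simp
qed

lemma unif_norm_le: "(\<And>x. \<bar>g x\<bar> \<le> C) \<Longrightarrow> unif_norm g \<le> C"
  unfolding unif_norm_def by (rule cSUP_least) auto

lemma unif_norm_upper:
  "(\<And>x. \<bar>g x\<bar> \<le> C) \<Longrightarrow> x \<in> {0..<1} \<Longrightarrow> \<bar>g x\<bar> \<le> unif_norm g"
  unfolding unif_norm_def by (rule cSUP_upper) (auto simp: bdd_above_def)

lemma unif_norm_scale: "unif_norm (\<lambda>x. c * g x) = \<bar>c\<bar> * unif_norm g" if "\<And>x. \<bar>g x\<bar> \<le> C"
proof (cases "c = 0")
  case False
  have le: "unif_norm (\<lambda>x. c * g x) \<le> \<bar>c\<bar> * unif_norm g" if "\<And>x. \<bar>g x\<bar> \<le> C" for c C and g :: "real \<Rightarrow> real"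
    unfolding unif_norm_def[of "\<lambda>x. c * g x"]
    by (rule cSUP_least) (use unif_norm_upper[of g C] that in \<open>auto simp: abs_mult intro!: mult_left_mono\<close>)
  have "\<bar>c * g x\<bar> \<le> \<bar>c\<bar> * C" for x using that[of x] by (simp add: abs_mult mult_left_mono)
  then have "unif_norm (\<lambda>x. inverse c * (c * g x)) \<le> \<bar>inverse c\<bar> * unif_norm (\<lambda>x. c * g x)" by (rule le)
  moreover have "(\<lambda>x. inverse c * (c * g x)) = g" using False by (auto simp: field_simps)
  ultimately have "\<bar>c\<bar> * unif_norm g \<le> unif_norm (\<lambda>x. c * g x)"
    using False by (simp add: field_simps)
  moreover have "unif_norm (\<lambda>x. c * g x) \<le> \<bar>c\<bar> * unif_norm g" using that by (rule le)
  ultimately show ?thesis by simp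
qed (simp add: unif_norm_def)

lemma unif_norm_triangle:
  assumes "\<And>x. \<bar>g x\<bar> \<le> C" "\<And>x. \<bar>h x\<bar> \<le> D"
  shows "unif_norm (\<lambda>x. g x + h x) \<le> unif_norm g + unif_norm h"
  unfolding unif_norm_def[of "\<lambda>x. g x + h x"]
proof (rule cSUP_least)
  fix x :: real assume "x \<in> {0..<1}"
  then have "\<bar>g x\<bar> \<le> unif_norm g" "\<bar>h x\<bar> \<le> unif_norm h"
    using unif_norm_upper[of g C] unif_norm_upper[of h D] assms by auto
  then show "\<bar>g x + h x\<bar> \<le> unif_norm g + unif_norm h" by linarith
qed simp

text \<open>Extends $h \mapsto f * h$ from $L^2$ to $H(\delta)$, by Parseval.\<close>

definition conv_form :: "l2_basis \<Rightarrow> L2 \<Rightarrow> coeffs \<Rightarrow> real \<Rightarrow> real" where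
  "conv_form B f w x = (\<Sum>\<^sub>\<infinity>i\<in>idx B. w i * basis_coeff B (reflect f x) i)"

lemma conv_form_basis_coeff:
  assumes "regular_basis S B"
  shows "conv_form B f (basis_coeff B h) x = convol f h x"
  using infsumI[OF parseval_inner[OF assms, of h "reflect f x"]]
  by (simp add: conv_form_def convol_eq_inner inner_commute)

text \<open>The probabilistic part uses the convolution only through these properties. They are
  required on \<open>H_space\<close> alone, as the series behind \<open>conv_form\<close> need not
  converge elsewhere.\<close>

locale H_seminorm =
  fixes B :: l2_basis and S :: nat and \<delta> :: real and N :: "coeffs \<Rightarrow> real" and C :: real
  assumes B: "regular_basis S B"
    and C: "C > 0"
    and triangle: "\<And>x y. x \<in> H_space B \<delta> \<Longrightarrow> y \<in> H_space B \<delta> \<Longrightarrow> N (\<lambda>i. x i + y i) \<le> N x + N y"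
    and scale: "\<And>c x. x \<in> H_space B \<delta> \<Longrightarrow> N (\<lambda>i. c * x i) = \<bar>c\<bar> * N x"
    and bound: "\<And>x. x \<in> H_space B \<delta> \<Longrightarrow> N x \<le> C * H_norm B \<delta> x"
begin

lemma nonneg: "x \<in> H_space B \<delta> \<Longrightarrow> 0 \<le> N x"
  using triangle[of x "\<lambda>i. -1 * x i"] scale[of x "-1"] scale[of x 0] H_space_scale[of x B \<delta> "-1"] by simp

lemma diff_le:
  assumes "x \<in> H_space B \<delta>" "y \<in> H_space B \<delta>"
  shows "\<bar>N x - N y\<bar> \<le> N (\<lambda>i. x i - y i)"
proof -
  have "N x \<le> N (\<lambda>i. x i - y i) + N y"
    using triangle[OF H_space_diff[OF B assms] assms(2)] by simp
  moreover have "N y \<le> N (\<lambda>i. y i - x i) + N x"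
    using triangle[OF H_space_diff[OF B assms(2,1)] assms(1)] by simp
  moreover have "N (\<lambda>i. y i - x i) = N (\<lambda>i. x i - y i)"
    using scale[OF H_space_diff[OF B assms], of "-1"] by simp
  ultimately show ?thesis by linarith
qed

lemma lipschitz:
  assumes "x \<in> H_space B \<delta>" "y \<in> H_space B \<delta>"
  shows "\<bar>N x - N y\<bar> \<le> C * H_dist B \<delta> x y"
  using diff_le[OF assms] bound[OF H_space_diff[OF B assms]] by (simp add: H_dist_def)

end

text \<open>The dual bound, uniform in the evaluation point, bounds the form pointwise; the supremum
  is therefore finite, which the seminorm laws need, and the same bound is the constant
  \<open>C\<close>.\<close>

lemma H_seminorm_conv_form:
  assumes B: "regular_basis S B" "fourier_equivalent B s" and s: "s > 1/2" and d: "\<delta> > 0"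
    and f: "f \<in> sobolev B s"
  obtains C where "H_seminorm B S \<delta> (\<lambda>w. unif_norm (conv_form B f w)) C"
proof -
  obtain D where D: "D > 0"
    "\<And>x. (\<lambda>i. (basis_coeff B (reflect f x) i)\<^sup>2 / H_weight B \<delta> i) summable_on idx B"
    "\<And>x. sqrt (\<Sum>\<^sub>\<infinity>i\<in>idx B. (basis_coeff B (reflect f x) i)\<^sup>2 / H_weight B \<delta> i) \<le> D"
    using H_dual_bound_reflect[OF B s d f] by metis
  have sm: "(\<lambda>i. w i * basis_coeff B (reflect f x) i) summable_on idx B" if "w \<in> H_space B \<delta>" for w x
    by (rule H_cauchy_schwarz(1)[OF B(1) that D(2)])
  have bd: "\<bar>conv_form B f w x\<bar> \<le> D * H_norm B \<delta> w" if w: "w \<in> H_space B \<delta>" for w x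
  proof -
    have "\<bar>conv_form B f w x\<bar> \<le> H_norm B \<delta> w *
        sqrt (\<Sum>\<^sub>\<infinity>i\<in>idx B. (basis_coeff B (reflect f x) i)\<^sup>2 / H_weight B \<delta> i)"
      unfolding conv_form_def by (rule H_cauchy_schwarz(2)[OF B(1) w D(2)])
    also have "\<dots> \<le> H_norm B \<delta> w * D"
      by (intro mult_left_mono D(3) H_norm_nonneg[OF B(1)])
    finally show ?thesis by (simp add: mult.commute)
  qed
  have "H_seminorm B S \<delta> (\<lambda>w. unif_norm (conv_form B f w)) D"
  proof
    show "regular_basis S B" "D > 0" by fact+
    show "unif_norm (conv_form B f (\<lambda>i. x i + y i)) \<le> unif_norm (conv_form B f x) + unif_norm (conv_form B f y)"
      if "x \<in> H_space B \<delta>" "y \<in> H_space B \<delta>" for x y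
    proof -
      have "conv_form B f (\<lambda>i. x i + y i) = (\<lambda>t. conv_form B f x t + conv_form B f y t)"
        unfolding conv_form_def distrib_right using that by (intro ext infsum_add sm)
      then show ?thesis using unif_norm_triangle[OF bd[OF that(1)] bd[OF that(2)]] by simp
    qed
    show "unif_norm (conv_form B f (\<lambda>i. c * x i)) = \<bar>c\<bar> * unif_norm (conv_form B f x)"
      if "x \<in> H_space B \<delta>" for c x
    proof -
      have "conv_form B f (\<lambda>i. c * x i) = (\<lambda>t. c * conv_form B f x t)"
        unfolding conv_form_def mult.assoc by (intro ext infsum_cmult_right')
      then show ?thesis using unif_norm_scale[OF bd[OF that]] by simp
    qed
    show "unif_norm (conv_form B f x) \<le> D * H_norm B \<delta> x" if "x \<in> H_space B \<delta>" for x
      by (rule unif_norm_le[OF bd[OF that]])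
  qed
  then show ?thesis by (rule that)
qed

lemma basis_elem_coeff:
  assumes B: "regular_basis S B" and i: "i \<in> idx B"
  shows "basis_coeff B (basis_elem B i) = (\<lambda>j. if j = i then 1 else 0)"
proof
  fix j show "basis_coeff B (basis_elem B i) j = (if j = i then 1 else 0)"
    using basis_orthonormal[OF B _ i, of j] i
    by (cases "j \<in> idx B") (auto simp: basis_coeff_idx basis_coeff_not_idx)
qed

text \<open>The norm of \<open>reflect f 0\<close> equals that of f, so by Parseval it has a nonzero
  basis coefficient, and this coefficient is the value at 0 of the convolution of f with that basis
  element. The direction found here serves to exclude an atom at 0.\<close>

lemma conv_form_nontrivial:
  assumes B: "regular_basis S B" and f: "f \<noteq> 0"
  obtains i where "i \<in> idx B" "unif_norm (conv_form B f (\<lambda>j. if j = i then 1 else 0)) > 0"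
proof -
  have "\<exists>i\<in>idx B. basis_coeff B (reflect f 0) i \<noteq> 0"
  proof (rule ccontr)
    assume "\<not> ?thesis"
    then have "((\<lambda>i. (basis_coeff B (reflect f 0) i)\<^sup>2) has_sum 0) (idx B)"
      by (intro has_sum_0) auto
    then have "(norm (reflect f 0))\<^sup>2 = 0"
      using parseval_norm[OF B, of "reflect f 0"] has_sum_unique by blast
    then show False using f by (simp add: norm_reflect)
  qed
  then obtain i where i: "i \<in> idx B" "basis_coeff B (reflect f 0) i \<noteq> 0" by blast
  have cf: "conv_form B f (\<lambda>j. if j = i then 1 else 0) x = convol f (basis_elem B i) x" for x
    using conv_form_basis_coeff[OF B, of f "basis_elem B i" x] basis_elem_coeff[OF B i(1)] by simp
  have "convol f (basis_elem B i) 0 \<noteq> 0"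
    using i by (simp add: convol_eq_inner basis_coeff_idx inner_commute)
  moreover have "\<bar>convol f (basis_elem B i) 0\<bar> \<le> unif_norm (convol f (basis_elem B i))"
    by (rule unif_norm_upper[OF abs_convol_le]) simp
  ultimately have "unif_norm (conv_form B f (\<lambda>j. if j = i then 1 else 0)) > 0"
    unfolding cf by simp
  with i(1) show ?thesis by (rule that)
qed

section \<open>Borel sets of the coefficient space\<close>

text \<open>\<open>infsum\<close> is 0 for a family that is not summable, whereas the integral over
  counting measure is then infinite. The passage makes summability a measurable condition and gives
  access to Tonelli.\<close>

lemma nn_integral_count_space_eq_infsum:
  fixes f :: "'a \<Rightarrow> real"
  assumes nn: "\<And>i. i \<in> A \<Longrightarrow> 0 \<le> f i"
  shows "(\<integral>\<^sup>+i. ennreal (f i) \<partial>count_space A) = (if f summable_on A then ennreal (infsum f A) else \<infinity>)"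
proof -
  have eq: "(\<lambda>i. norm (f i)) summable_on A \<longleftrightarrow> f summable_on A"
    by (rule summable_on_cong) (simp add: nn)
  have eqn: "(\<integral>\<^sup>+i. ennreal (norm (f i)) \<partial>count_space A) = (\<integral>\<^sup>+i. ennreal (f i) \<partial>count_space A)"
    by (rule nn_integral_cong) (simp add: nn)
  show ?thesis
  proof (cases "f summable_on A")
    case True
    then have "Infinite_Set_Sum.abs_summable_on f A"
      using eq abs_summable_equivalent by blast
    with True nn show ?thesis
      by (simp add: nn_integral_conv_infsetsum infsetsum_infsum)
  next
    case False
    then have "\<not> integrable (count_space A) f"
      using eq abs_summable_equivalent[of f A] by (simp add: Infinite_Set_Sum.abs_summable_on_def)
    then have "\<not> (\<integral>\<^sup>+i. ennreal (norm (f i)) \<partial>count_space A) < \<infinity>"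
      by (simp add: integrable_iff_bounded)
    then have "(\<integral>\<^sup>+i. ennreal (f i) \<partial>count_space A) = \<infinity>"
      unfolding eqn by (metis less_top infinity_ennreal_def)
    with False show ?thesis by simp
  qed
qed

lemma summable_on_iff_nn_integral_count_space:
  fixes f :: "'a \<Rightarrow> real"
  assumes "\<And>i. i \<in> A \<Longrightarrow> 0 \<le> f i"
  shows "f summable_on A \<longleftrightarrow> (\<integral>\<^sup>+i. ennreal (f i) \<partial>count_space A) < \<infinity>"
  using nn_integral_count_space_eq_infsum[of A f] assms by simp

lemma borel_measurable_nn_integral_count_space:
  assumes A: "countable A" and f: "\<And>i. i \<in> A \<Longrightarrow> f i \<in> borel_measurable M"
  shows "(\<lambda>\<omega>. \<integral>\<^sup>+i. f i \<omega> \<partial>count_space A) \<in> borel_measurable M"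
proof -
  interpret sigma_finite_measure "count_space A"
    using A by (rule sigma_finite_measure_count_space_countable)
  have "(\<lambda>(i, \<omega>). f i \<omega>) \<in> borel_measurable (count_space A \<Otimes>\<^sub>M M)"
    by (rule measurable_pair_measure_countable1) (use A f in auto)
  then have "(\<lambda>(\<omega>, i). f i \<omega>) \<in> borel_measurable (M \<Otimes>\<^sub>M count_space A)"
    by (subst measurable_pair_swap_iff) (simp add: split_beta)
  then show ?thesis by (rule borel_measurable_nn_integral)
qed

lemma space_H_borel: "regular_basis S B \<Longrightarrow> space (H_borel B \<delta>) = H_space B \<delta>"
  and sets_H_borel: "regular_basis S B \<Longrightarrow> sets (H_borel B \<delta>) =
    sigma_sets (H_space B \<delta>) {U. openin (Metric_space.mtopology (H_space B \<delta>) (H_dist B \<delta>)) U}"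
proof -
  assume "regular_basis S B"
  then interpret Metric_space "H_space B \<delta>" "H_dist B \<delta>" by (rule Metric_space_H)
  have "{U. openin mtopology U} \<subseteq> Pow (H_space B \<delta>)"
    using openin_subset by fastforce
  then show "space (H_borel B \<delta>) = H_space B \<delta>"
    "sets (H_borel B \<delta>) = sigma_sets (H_space B \<delta>) {U. openin mtopology U}"
    by (simp_all add: H_borel_def space_measure_of sets_measure_of)
qed

lemma H_space_tail:
  assumes B: "regular_basis S B" and x: "x \<in> H_space B \<delta>" and e: "e > 0"
  obtains F where "finite F" "F \<subseteq> idx B"
    "(\<Sum>\<^sub>\<infinity>i\<in>idx B - F. H_weight B \<delta> i * (x i)\<^sup>2) < e"
proof -
  let ?f = "\<lambda>i. H_weight B \<delta> i * (x i)\<^sup>2"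
  have sm: "?f summable_on idx B" using x by (simp add: H_space_def)
  have "(sum ?f \<longlongrightarrow> infsum ?f (idx B)) (finite_subsets_at_top (idx B))"
    using has_sum_infsum[OF sm] by (simp add: has_sum_def)
  then have "\<forall>\<^sub>F F in finite_subsets_at_top (idx B). sum ?f F > infsum ?f (idx B) - e"
    using e by (intro order_tendstoD) auto
  then obtain F where F: "finite F" "F \<subseteq> idx B" "sum ?f F > infsum ?f (idx B) - e"
    unfolding eventually_finite_subsets_at_top by blast
  have "infsum ?f (idx B - F) = infsum ?f (idx B) - infsum ?f F"
    using F by (intro infsum_Diff sm) auto
  with F show ?thesis by (intro that[of F]) auto
qed

text \<open>Finitely supported rational sequences are dense. They are coded by association lists, so
  that countability is immediate.\<close>

lemma H_space_separable:
  assumes B: "regular_basis S B"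
  obtains Q where "countable Q" "Q \<subseteq> H_space B \<delta>"
    "\<And>x e. x \<in> H_space B \<delta> \<Longrightarrow> e > 0 \<Longrightarrow> \<exists>q\<in>Q. H_dist B \<delta> x q < e"
proof
  define g :: "((int \<times> int) \<times> rat) list \<Rightarrow> coeffs" where
    "g l i = (if i \<in> idx B then (case map_of l i of None \<Rightarrow> 0 | Some q \<Rightarrow> of_rat q) else 0)" for l i
  show "countable (range g)" by simp
  show "range g \<subseteq> H_space B \<delta>"
  proof clarify
    fix l
    have "i \<in> idx B \<inter> fst ` set l" if "g l i \<noteq> 0" for i
      using that by (auto simp: g_def map_of_eq_None_iff split: if_splits option.splits)
        (metis map_of_SomeD image_eqI fst_conv)
    then show "g l \<in> H_space B \<delta>"
      by (intro H_space_finite_support[of "idx B \<inter> fst ` set l"]) auto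
  qed
  fix x and e :: real assume x: "x \<in> H_space B \<delta>" and e: "e > 0"
  let ?w = "H_weight B \<delta>"
  obtain F where F: "finite F" "F \<subseteq> idx B"
    "(\<Sum>\<^sub>\<infinity>i\<in>idx B - F. ?w i * (x i)\<^sup>2) < e\<^sup>2 / 2"
    using H_space_tail[OF B x, of "e\<^sup>2 / 2"] e by auto
  define W where "W = (\<Sum>i\<in>F. ?w i)"
  have W: "W \<ge> 0" unfolding W_def using F H_weight_nonneg[OF B] by (intro sum_nonneg) blast
  \<comment> \<open>A coordinatewise error that costs at most half of the squared e over
    \<open>F\<close>, the other half being left to the tail; W + 1 guards against W = 0.\<close>
  define \<eta> where "\<eta> = sqrt (e\<^sup>2 / (2 * (W + 1)))"
  have \<eta>: "\<eta> > 0" "\<eta>\<^sup>2 * W \<le> e\<^sup>2 / 2"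
    using W e by (auto simp: \<eta>_def field_simps)
  have "\<exists>q. \<bar>x i - of_rat q\<bar> \<le> \<eta>" for i
  proof -
    obtain q where "x i < of_rat q" "of_rat q < x i + \<eta>"
      using of_rat_dense[of "x i" "x i + \<eta>"] \<eta>(1) by auto
    then show ?thesis by (intro exI[of _ q]) linarith
  qed
  then obtain q where q: "\<And>i. \<bar>x i - of_rat (q i)\<bar> \<le> \<eta>" by metis
  obtain fs where fs: "set fs = F" using finite_list[OF F(1)] by blast
  define l where "l = map (\<lambda>i. (i, q i)) fs"
  have gl: "g l i = (if i \<in> F then of_rat (q i) else 0)" for i
    using F(2) fs by (auto simp: g_def l_def map_of_map_restrict restrict_map_def)
  let ?h = "\<lambda>i. ?w i * (x i - g l i)\<^sup>2"
  have "g l \<in> H_space B \<delta>"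
    using F gl by (intro H_space_finite_support[of F]) auto
  then have sm: "?h summable_on idx B"
    using H_space_diff[OF B x] by (simp add: H_space_def)
  have "infsum ?h (idx B) = infsum ?h (idx B - F) + sum ?h F"
    using F by (simp add: infsum_Diff[OF sm])
  also have "infsum ?h (idx B - F) = (\<Sum>\<^sub>\<infinity>i\<in>idx B - F. ?w i * (x i)\<^sup>2)"
    by (rule infsum_cong) (simp add: gl)
  also have "sum ?h F \<le> (\<Sum>i\<in>F. ?w i * \<eta>\<^sup>2)"
  proof (rule sum_mono)
    fix i assume i: "i \<in> F"
    have "(x i - g l i)\<^sup>2 \<le> \<eta>\<^sup>2"
      using q[of i] i \<eta>(1) by (intro power2_le_iff_abs_le[THEN iffD2]) (auto simp: gl)
    then show "?h i \<le> ?w i * \<eta>\<^sup>2"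
      using H_weight_nonneg[OF B, of i] i F by (intro mult_left_mono) auto
  qed
  also have "(\<Sum>i\<in>F. ?w i * \<eta>\<^sup>2) = \<eta>\<^sup>2 * W" by (simp add: W_def sum_distrib_right mult.commute)
  also have "(\<Sum>\<^sub>\<infinity>i\<in>idx B - F. ?w i * (x i)\<^sup>2) + \<eta>\<^sup>2 * W < e\<^sup>2" using F(3) \<eta>(2) by simp
  finally have "infsum ?h (idx B) < e\<^sup>2" by simp
  then have "sqrt (infsum ?h (idx B)) < sqrt (e\<^sup>2)" by (rule real_sqrt_less_mono)
  then have "H_dist B \<delta> x (g l) < e" using e by (simp add: H_dist_def H_norm_def)
  then show "\<exists>q\<in>range g. H_dist B \<delta> x q < e" by blast
qed

text \<open>By separability an open set is a countable union of balls with radii 1 / (n + 1) around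
  points of a countable dense set, so it suffices that distances to points are measurable. Those are
  explicit sums for white noise.\<close>

lemma measurable_H_borelI:
  assumes B: "regular_basis S B" and f: "f \<in> space M \<rightarrow> H_space B \<delta>"
    and d: "\<And>y. y \<in> H_space B \<delta> \<Longrightarrow> (\<lambda>\<omega>. H_dist B \<delta> (f \<omega>) y) \<in> borel_measurable M"
  shows "f \<in> measurable M (H_borel B \<delta>)"
proof (rule measurable_sigma_sets[OF sets_H_borel[OF B]])
  interpret Metric_space "H_space B \<delta>" "H_dist B \<delta>" by (rule Metric_space_H[OF B])
  show "{U. openin mtopology U} \<subseteq> Pow (H_space B \<delta>)"
    using openin_subset by fastforce
  obtain Q where Q: "countable Q" "Q \<subseteq> H_space B \<delta>"
    "\<And>x e. x \<in> H_space B \<delta> \<Longrightarrow> e > 0 \<Longrightarrow> \<exists>q\<in>Q. H_dist B \<delta> x q < e"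
    using H_space_separable[OF B] by metis
  fix U assume "U \<in> {U. openin mtopology U}"
  then have U: "openin mtopology U" by simp
  define J where "J = {(q, n::nat). q \<in> Q \<and> mball q (1 / real (Suc n)) \<subseteq> U}"
  have "J \<subseteq> Q \<times> UNIV" by (auto simp: J_def)
  then have cJ: "countable J" by (rule countable_subset) (intro countable_SIGMA Q(1) countableI_type)
  have "f -` U \<inter> space M = (\<Union>(q, n)\<in>J. {\<omega> \<in> space M. H_dist B \<delta> (f \<omega>) q < 1 / real (Suc n)})"
  proof (intro set_eqI iffI)
    fix \<omega> assume w: "\<omega> \<in> f -` U \<inter> space M"
    then have fH: "f \<omega> \<in> H_space B \<delta>" using f by auto
    obtain r where r: "r > 0" "mball (f \<omega>) r \<subseteq> U"
      using U w unfolding openin_mtopology by blast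
    obtain n where n: "1 / real (Suc n) < r / 2" using nat_approx_posE[of "r / 2"] r by auto
    obtain q where q: "q \<in> Q" "H_dist B \<delta> (f \<omega>) q < 1 / real (Suc n)"
      using Q(3)[OF fH, of "1 / real (Suc n)"] by auto
    have "mball q (1 / real (Suc n)) \<subseteq> mball (f \<omega>) r"
    proof
      fix y assume y: "y \<in> mball q (1 / real (Suc n))"
      then have "H_dist B \<delta> (f \<omega>) y \<le> H_dist B \<delta> (f \<omega>) q + H_dist B \<delta> q y"
        using triangle[of "f \<omega>" q y] fH q Q(2) by auto
      also have "\<dots> < r" using y q(2) n by auto
      finally show "y \<in> mball (f \<omega>) r" using y fH by auto
    qed
    with r(2) q have "(q, n) \<in> J" by (auto simp: J_def)
    then show "\<omega> \<in> (\<Union>(q, n)\<in>J. {\<omega> \<in> space M. H_dist B \<delta> (f \<omega>) q < 1 / real (Suc n)})"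
      using q(2) w by blast
  next
    fix \<omega> assume "\<omega> \<in> (\<Union>(q, n)\<in>J. {\<omega> \<in> space M. H_dist B \<delta> (f \<omega>) q < 1 / real (Suc n)})"
    then obtain q n where q: "(q, n) \<in> J" "\<omega> \<in> space M" "H_dist B \<delta> (f \<omega>) q < 1 / real (Suc n)" by blast
    then have "f \<omega> \<in> mball q (1 / real (Suc n))"
      using f Q(2) by (auto simp: J_def commute)
    then show "\<omega> \<in> f -` U \<inter> space M" using q by (auto simp: J_def)
  qed
  also have "\<dots> \<in> sets M"
  proof (rule sets.countable_UN''[OF cJ])
    show "(case i of (q, n) \<Rightarrow> {\<omega> \<in> space M. H_dist B \<delta> (f \<omega>) q < 1 / real (Suc n)}) \<in> sets M"
      if "i \<in> J" for i
      using that d Q(2) by (auto simp: J_def)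
  qed
  finally show "f -` U \<inter> space M \<in> sets M" .
qed (use f in auto)

lemma H_lipschitz_measurable:
  fixes u :: "coeffs \<Rightarrow> real"
  assumes B: "regular_basis S B"
    and L: "\<And>x y. x \<in> H_space B \<delta> \<Longrightarrow> y \<in> H_space B \<delta> \<Longrightarrow> \<bar>u x - u y\<bar> \<le> L * H_dist B \<delta> x y"
  shows "u \<in> borel_measurable (H_borel B \<delta>)"
proof (rule borel_measurableI)
  interpret Metric_space "H_space B \<delta>" "H_dist B \<delta>" by (rule Metric_space_H[OF B])
  fix V :: "real set" assume V: "open V"
  have "openin mtopology (u -` V \<inter> H_space B \<delta>)"
    unfolding openin_mtopology
  proof (intro conjI allI impI)
    fix x assume x: "x \<in> u -` V \<inter> H_space B \<delta>"
    then obtain e where e: "e > 0" "ball (u x) e \<subseteq> V" using V open_contains_ball by blast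
    \<comment> \<open>\<open>L\<close> is not assumed positive, so |L| + 1 serves as the Lipschitz
      constant.\<close>
    have "mball x (e / (\<bar>L\<bar> + 1)) \<subseteq> u -` V \<inter> H_space B \<delta>"
    proof
      fix y assume y: "y \<in> mball x (e / (\<bar>L\<bar> + 1))"
      have "\<bar>u x - u y\<bar> \<le> L * H_dist B \<delta> x y" using x y by (intro L) auto
      also have "\<dots> \<le> (\<bar>L\<bar> + 1) * H_dist B \<delta> x y" by (intro mult_right_mono) auto
      also have "\<dots> < e" using y by (simp add: field_simps)
      finally show "y \<in> u -` V \<inter> H_space B \<delta>" using e y by (auto simp: dist_real_def)
    qed
    then show "\<exists>r>0. mball x r \<subseteq> u -` V \<inter> H_space B \<delta>" using e by (intro exI[of _ "e / (\<bar>L\<bar> + 1)"]) auto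
  qed auto
  then show "u -` V \<inter> space (H_borel B \<delta>) \<in> sets (H_borel B \<delta>)"
    by (auto simp: space_H_borel[OF B] sets_H_borel[OF B])
qed

lemma H_dist_lipschitz:
  assumes B: "regular_basis S B" and "x \<in> H_space B \<delta>" "y \<in> H_space B \<delta>" "z \<in> H_space B \<delta>"
  shows "\<bar>H_dist B \<delta> x z - H_dist B \<delta> y z\<bar> \<le> H_dist B \<delta> x y"
proof -
  interpret Metric_space "H_space B \<delta>" "H_dist B \<delta>" by (rule Metric_space_H[OF B])
  show ?thesis using triangle[of x y z] triangle[of y x z] assms commute[of x y] by linarith
qed

lemma H_affine_measurable:
  assumes B: "regular_basis S B" and a: "a \<in> H_space B \<delta>"
  shows "(\<lambda>x i. a i + c * x i) \<in> measurable (H_borel B \<delta>) (H_borel B \<delta>)"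
proof (rule measurable_H_borelI[OF B])
  show "(\<lambda>x i. a i + c * x i) \<in> space (H_borel B \<delta>) \<rightarrow> H_space B \<delta>"
    by (auto simp: space_H_borel[OF B] intro!: H_space_add[OF B a] H_space_scale)
  fix y assume y: "y \<in> H_space B \<delta>"
  show "(\<lambda>x. H_dist B \<delta> (\<lambda>i. a i + c * x i) y) \<in> borel_measurable (H_borel B \<delta>)"
  proof (rule H_lipschitz_measurable[OF B])
    fix x x' assume x: "x \<in> H_space B \<delta>" "x' \<in> H_space B \<delta>"
    have "\<bar>H_dist B \<delta> (\<lambda>i. a i + c * x i) y - H_dist B \<delta> (\<lambda>i. a i + c * x' i) y\<bar> \<le>
        H_dist B \<delta> (\<lambda>i. a i + c * x i) (\<lambda>i. a i + c * x' i)"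
      using x y by (intro H_dist_lipschitz[OF B] H_space_add[OF B a] H_space_scale)
    also have "\<dots> = \<bar>c\<bar> * H_dist B \<delta> x x'"
      using H_norm_scale[of B \<delta> c "\<lambda>i. x i - x' i"] by (simp add: H_dist_def right_diff_distrib)
    finally show "\<bar>H_dist B \<delta> (\<lambda>i. a i + c * x i) y - H_dist B \<delta> (\<lambda>i. a i + c * x' i) y\<bar> \<le>
        \<bar>c\<bar> * H_dist B \<delta> x x'" .
  qed
qed

lemma basis_coeff_measurable:
  assumes B: "regular_basis S B" and d: "\<delta> > 0"
  shows "basis_coeff B \<in> measurable borel (H_borel B \<delta>)"
proof (rule measurable_H_borelI[OF B])
  show "basis_coeff B \<in> space borel \<rightarrow> H_space B \<delta>" using basis_coeff_in_H[OF B d] by auto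
  fix y assume y: "y \<in> H_space B \<delta>"
  let ?c = "sqrt (ln 2 powr (- 2 * \<delta>))"
  have "?c-lipschitz_on UNIV (\<lambda>f. H_dist B \<delta> (basis_coeff B f) y)"
  proof (rule lipschitz_onI)
    fix f g :: L2
    have "\<bar>H_dist B \<delta> (basis_coeff B f) y - H_dist B \<delta> (basis_coeff B g) y\<bar> \<le>
        H_dist B \<delta> (basis_coeff B f) (basis_coeff B g)"
      using basis_coeff_in_H[OF B d] y by (intro H_dist_lipschitz[OF B]) auto
    also have "\<dots> = H_norm B \<delta> (basis_coeff B (f - g))"
      by (simp add: H_dist_def basis_coeff_diff[abs_def])
    also have "\<dots> \<le> ?c * norm (f - g)" by (rule basis_coeff_in_H[OF B d])
    finally show "dist (H_dist B \<delta> (basis_coeff B f) y) (H_dist B \<delta> (basis_coeff B g) y) \<le> ?c * dist f g"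
      by (simp add: dist_real_def dist_norm)
  qed simp
  then show "(\<lambda>f. H_dist B \<delta> (basis_coeff B f) y) \<in> borel_measurable borel"
    by (intro borel_measurable_continuous_onI lipschitz_on_continuous_on)
qed

section \<open>Null sets of the iid normal law under coordinate scalings\<close>

abbreviation iid_normal :: "'i set \<Rightarrow> ('i \<Rightarrow> real) measure" where
  "iid_normal I \<equiv> PiM I (\<lambda>_. std_normal_distribution)"

lemma prob_space_std_normal: "prob_space std_normal_distribution"
  using prob_space_normal_density by auto

lemma prob_space_iid_normal: "prob_space (iid_normal I)"
  by (rule prob_space_PiM) (rule prob_space_std_normal)

lemma measurable_iid_normal_component: "i \<in> I \<Longrightarrow> (\<lambda>\<omega>. \<omega> i) \<in> borel_measurable (iid_normal I)"
  using measurable_component_singleton[of i I "\<lambda>_. std_normal_distribution"]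
  by (simp cong: measurable_cong_sets)

lemma measurable_iid_normalI:
  assumes "\<And>i. i \<in> I \<Longrightarrow> (\<lambda>x. f x i) \<in> borel_measurable M"
    and "\<And>x i. x \<in> space M \<Longrightarrow> i \<notin> I \<Longrightarrow> f x i = undefined"
  shows "f \<in> measurable M (iid_normal I)"
proof -
  have "(\<lambda>x i. f x i) \<in> measurable M (iid_normal I)"
  proof (rule measurable_PiM_single')
    show "(\<lambda>x. f x i) \<in> measurable M std_normal_distribution" if "i \<in> I" for i
      using assms(1)[OF that] by (simp cong: measurable_cong_sets)
    show "(\<lambda>x i. f x i) \<in> space M \<rightarrow> (\<Pi>\<^sub>E i\<in>I. space std_normal_distribution)"
      using assms(2) by (auto simp: PiE_def extensional_def)
  qed
  then show ?thesis by simp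
qed

lemma AE_std_normal_iff: "(AE x in std_normal_distribution. P x) \<longleftrightarrow> (AE x in lborel. P x)"
  by (subst AE_density) (simp_all add: normal_density_pos)

text \<open>Fubini in one coordinate. The normal density is positive, so null sets in that
  coordinate are the Lebesgue null sets, which are stable under invertible affine maps and include
  all countable sets.\<close>

lemma AE_iid_normal_iff:
  assumes i: "i \<in> I" and Q: "{\<omega> \<in> space (iid_normal I). Q \<omega>} \<in> sets (iid_normal I)"
  shows "(AE \<omega> in iid_normal I. Q \<omega>) \<longleftrightarrow>
    (AE X in iid_normal (I - {i}). AE z in lborel. Q (X(i := z)))"
proof -
  let ?M = "std_normal_distribution" and ?P = "iid_normal (I - {i})"
  let ?f = "\<lambda>(z, X). X(i := z)"
  interpret M: prob_space ?M by (rule prob_space_std_normal)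
  interpret P: prob_space ?P by (rule prob_space_iid_normal)
  interpret pair_sigma_finite ?M ?P ..
  have I: "insert i (I - {i}) = I" using i by auto
  have d: "distr (?M \<Otimes>\<^sub>M ?P) (iid_normal I) ?f = iid_normal I"
    using distr_pair_PiM_eq_PiM[of "I - {i}" "\<lambda>_. ?M" i] prob_space_std_normal unfolding I by blast
  have fm: "?f \<in> measurable (?M \<Otimes>\<^sub>M ?P) (iid_normal I)"
  proof -
    have "(\<lambda>x. (snd x)(i := fst x)) \<in> measurable (?M \<Otimes>\<^sub>M ?P) (iid_normal I)"
      by (rule measurable_fun_upd[of I "I - {i}" i]) (use i in auto)
    then show ?thesis by (simp add: split_beta')
  qed
  have S: "{x \<in> space (?M \<Otimes>\<^sub>M ?P). Q (?f x)} \<in> sets (?M \<Otimes>\<^sub>M ?P)"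
  proof -
    have "{x \<in> space (?M \<Otimes>\<^sub>M ?P). Q (?f x)} = ?f -` {\<omega> \<in> space (iid_normal I). Q \<omega>} \<inter> space (?M \<Otimes>\<^sub>M ?P)"
      using measurable_space[OF fm] by auto
    then show ?thesis using measurable_sets[OF fm Q] by simp
  qed
  have "(AE \<omega> in iid_normal I. Q \<omega>) \<longleftrightarrow> (AE x in ?M \<Otimes>\<^sub>M ?P. Q (?f x))"
    using AE_distr_iff[OF fm Q] unfolding d .
  also have "\<dots> \<longleftrightarrow> (AE z in ?M. AE X in ?P. Q (?f (z, X)))"
    using AE_pair_measure[OF S] AE_pair[of "\<lambda>x. Q (?f x)"] by blast
  also have "\<dots> \<longleftrightarrow> (AE X in ?P. AE z in ?M. Q (?f (z, X)))"
    by (rule AE_commute) (use S in \<open>simp add: split_beta'\<close>)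
  finally show ?thesis by (simp only: AE_std_normal_iff split_conv)
qed

lemma AE_lborel_at_most_one:
  assumes "\<And>x y :: real. P x \<Longrightarrow> P y \<Longrightarrow> x = y"
  shows "AE x in lborel. \<not> P x"
proof -
  have "\<exists>a. {x. P x} \<subseteq> {a}" using assms by blast
  then have "countable {x. P x}" using countable_subset by blast
  then have "AE x in lborel. x \<notin> {x. P x}" by (intro AE_not_in countable_imp_null_set_lborel)
  then show ?thesis by simp
qed

lemma measurable_Collect_compose:
  assumes "{y \<in> space N. Q y} \<in> sets N" "f \<in> measurable M N"
  shows "{x \<in> space M. Q (f x)} \<in> sets M"
proof -
  have "{x \<in> space M. Q (f x)} = f -` {y \<in> space N. Q y} \<inter> space M"
    using measurable_space[OF assms(2)] by auto
  then show ?thesis using measurable_sets[OF assms(2,1)] by simp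
qed

text \<open>Scaling a coordinate changes the normal law but not its null sets, because a nonzero
  factor preserves Lebesgue null sets. Hence only almost sure statements are transferred.\<close>

lemma AE_iid_normal_scale_coordinate:
  assumes i: "i \<in> I" and Q: "{\<omega> \<in> space (iid_normal I). Q \<omega>} \<in> sets (iid_normal I)" and c: "c \<noteq> 0"
    and ae: "AE \<omega> in iid_normal I. Q \<omega>"
  shows "AE X in iid_normal I. Q (X(i := c * X i))"
proof -
  have fm: "(\<lambda>X. X(i := c * X i)) \<in> measurable (iid_normal I) (iid_normal I)"
  proof (rule measurable_iid_normalI)
    show "(\<lambda>X. (X(i := c * X i)) j) \<in> borel_measurable (iid_normal I)" if "j \<in> I" for j
      using measurable_iid_normal_component[OF that] by (cases "j = i") auto
  qed (use i in \<open>auto simp: space_PiM PiE_def extensional_def\<close>)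
  have "AE X in iid_normal (I - {i}). AE z in lborel. Q (X(i := z))"
    using ae AE_iid_normal_iff[OF i Q] by simp
  moreover have "AE X in iid_normal (I - {i}). {z. Q (X(i := z))} \<in> sets borel"
  proof (rule AE_I2)
    fix X assume X: "X \<in> space (iid_normal (I - {i}))"
    have "(\<lambda>z. X(i := z)) \<in> measurable borel (iid_normal I)"
    proof (rule measurable_iid_normalI)
      show "(\<lambda>z. (X(i := z)) j) \<in> borel_measurable borel" for j by (cases "j = i") auto
    qed (use i X in \<open>auto simp: space_PiM PiE_def extensional_def\<close>)
    from measurable_Collect_compose[OF Q this] show "{z. Q (X(i := z))} \<in> sets borel" by simp
  qed
  ultimately have "AE X in iid_normal (I - {i}). AE z in lborel. Q (X(i := c * z))"
  proof eventually_elim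
    case (elim X)
    have "AE z in lborel. Q (X(i := 0 + c * z))"
      by (rule AE_borel_affine[OF c, of "\<lambda>z. Q (X(i := z))"]) (use elim in \<open>auto simp: pred_def\<close>)
    then show ?case by simp
  qed
  then show ?thesis
    using AE_iid_normal_iff[OF i measurable_Collect_compose[OF Q fm]] by simp
qed

text \<open>For c = 0 the coordinates in \<open>F\<close> are deleted and only the tail remains; as
  c varies, the points run along a line through that tail.\<close>

definition scale_coords :: "'i set \<Rightarrow> real \<Rightarrow> ('i \<Rightarrow> real) \<Rightarrow> 'i \<Rightarrow> real" where
  "scale_coords F c \<omega> i = (if i \<in> F then c * \<omega> i else \<omega> i)"

lemma measurable_scale_coords:
  assumes "F \<subseteq> I" "g \<in> borel_measurable M" "h \<in> measurable M (iid_normal I)"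
  shows "(\<lambda>x. scale_coords F (g x) (h x)) \<in> measurable M (iid_normal I)"
proof (rule measurable_iid_normalI)
  show "(\<lambda>x. scale_coords F (g x) (h x) i) \<in> borel_measurable M" if i: "i \<in> I" for i
    using measurable_compose[OF assms(3) measurable_iid_normal_component[OF i]] assms(2)
    by (cases "i \<in> F") (auto simp: scale_coords_def)
  show "scale_coords F (g x) (h x) i = undefined" if "x \<in> space M" "i \<notin> I" for x i
    using measurable_space[OF assms(3) that(1)] that(2) assms(1)
    by (auto simp: scale_coords_def space_PiM PiE_def extensional_def)
qed

lemma AE_iid_normal_scale_coords:
  assumes F: "finite F" "F \<subseteq> I" and Q: "{\<omega> \<in> space (iid_normal I). Q \<omega>} \<in> sets (iid_normal I)"
    and c: "c \<noteq> 0" and ae: "AE \<omega> in iid_normal I. Q \<omega>"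
  shows "AE \<omega> in iid_normal I. Q (scale_coords F c \<omega>)"
  using F
proof (induction F rule: finite_induct)
  case empty
  have "scale_coords {} c \<omega> = \<omega>" for \<omega> :: "'a \<Rightarrow> real" by (rule ext) (simp add: scale_coords_def)
  then show ?case using ae by simp
next
  case (insert i F)
  have F: "F \<subseteq> I" and i: "i \<in> I" using insert by auto
  have m: "(\<lambda>\<omega>. scale_coords F c \<omega>) \<in> measurable (iid_normal I) (iid_normal I)"
    using measurable_scale_coords[OF F, of "\<lambda>_. c" "iid_normal I" "\<lambda>\<omega>. \<omega>"] by simp
  have "scale_coords F c (X(i := c * X i)) = scale_coords (insert i F) c X" for X
    using insert(2) by (auto simp: scale_coords_def)
  then show ?case
    using AE_iid_normal_scale_coordinate[OF i measurable_Collect_compose[OF Q m] c insert(3)[OF F]]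
    by (simp only:)
qed

lemma nn_integral_std_normal_square: "(\<integral>\<^sup>+x. ennreal (x\<^sup>2) \<partial>std_normal_distribution) = 1"
proof -
  have "(\<integral>\<^sup>+x. ennreal (x\<^sup>2) \<partial>std_normal_distribution) = ennreal (LINT x|std_normal_distribution. x\<^sup>2)"
    by (rule nn_integral_eq_integral) (use std_normal_distribution_even_moments(2)[of 1] in auto)
  also have "(LINT x|std_normal_distribution. x\<^sup>2) = 1"
    using std_normal_distribution_even_moments(1)[of 1] by (simp add: numeral_2_eq_2)
  finally show ?thesis by simp
qed

lemma nn_integral_iid_normal_weighted_square:
  fixes w :: "'i \<Rightarrow> real"
  assumes J: "countable J" "J \<subseteq> I" and w: "\<And>i. i \<in> J \<Longrightarrow> 0 \<le> w i"
  shows "(\<integral>\<^sup>+\<omega>. (\<integral>\<^sup>+i. ennreal (w i * (\<omega> i)\<^sup>2) \<partial>count_space J) \<partial>iid_normal I) =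
    (\<integral>\<^sup>+i. ennreal (w i) \<partial>count_space J)"
proof -
  have m: "(\<lambda>\<omega>. \<omega> i) \<in> borel_measurable (iid_normal I)" if "i \<in> J" for i
    using that J by (intro measurable_iid_normal_component) auto
  have "(\<integral>\<^sup>+\<omega>. (\<integral>\<^sup>+i. ennreal (w i * (\<omega> i)\<^sup>2) \<partial>count_space J) \<partial>iid_normal I) =
    (\<integral>\<^sup>+i. (\<integral>\<^sup>+\<omega>. ennreal (w i * (\<omega> i)\<^sup>2) \<partial>iid_normal I) \<partial>count_space J)"
    by (rule nn_integral_count_space_nn_integral[OF J(1)]) (use m in auto)
  also have "\<dots> = (\<integral>\<^sup>+i. ennreal (w i) \<partial>count_space J)"
  proof (rule nn_integral_cong)
    fix i assume "i \<in> space (count_space J)"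
    then have i: "i \<in> J" by simp
    have "(\<integral>\<^sup>+\<omega>. ennreal (w i * (\<omega> i)\<^sup>2) \<partial>iid_normal I) =
        (\<integral>\<^sup>+x. ennreal (w i * x\<^sup>2) \<partial>distr (iid_normal I) std_normal_distribution (\<lambda>\<omega>. \<omega> i))"
      using i J(2) by (subst nn_integral_distr) (auto intro: measurable_component_singleton)
    also have "distr (iid_normal I) std_normal_distribution (\<lambda>\<omega>. \<omega> i) = std_normal_distribution"
      using distr_PiM_component[of I "\<lambda>_. std_normal_distribution" i] i J(2) prob_space_std_normal by auto
    also have "(\<integral>\<^sup>+x. ennreal (w i * x\<^sup>2) \<partial>std_normal_distribution) =
        (\<integral>\<^sup>+x. ennreal (w i) * ennreal (x\<^sup>2) \<partial>std_normal_distribution)"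
      by (intro nn_integral_cong) (simp add: ennreal_mult w[OF i])
    also have "\<dots> = ennreal (w i) * (\<integral>\<^sup>+x. ennreal (x\<^sup>2) \<partial>std_normal_distribution)"
      by (rule nn_integral_cmult) auto
    finally show "(\<integral>\<^sup>+\<omega>. ennreal (w i * (\<omega> i)\<^sup>2) \<partial>iid_normal I) = ennreal (w i)"
      by (simp add: nn_integral_std_normal_square)
  qed
  finally show ?thesis .
qed

section \<open>White noise\<close>

text \<open>Cauchy condensation turns the series into that of \<open>real n powr (- p)\<close>. The
  truncation at 2 matches \<open>char_seq\<close> for one-element levels and keeps the logarithm
  positive and the terms nonincreasing from the start.\<close>

lemma summable_inverse_ln_powr:
  assumes p: "p > 1"
  shows "summable (\<lambda>n. inverse (max 2 (real n)) * ln (max 2 (real n)) powr (- p))"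
proof -
  let ?u = "\<lambda>n::nat. inverse (max 2 (real n)) * ln (max 2 (real n)) powr (- p)"
  have "summable ?u \<longleftrightarrow> summable (\<lambda>n. 2 ^ n * ?u (2 ^ n))"
  proof (rule condensation_test)
    fix m :: nat
    have "max 2 (real m) \<le> max 2 (real (Suc m))" by auto
    then show "?u (Suc m) \<le> ?u m"
      using p by (intro mult_mono powr_mono2' le_imp_inverse_le) auto
  qed auto
  also have "\<dots> \<longleftrightarrow> summable (\<lambda>n. ln 2 powr (- p) * real n powr (- p))"
  proof (rule summable_cong)
    show "\<forall>\<^sub>F n in sequentially. 2 ^ n * ?u (2 ^ n) = ln 2 powr (- p) * real n powr (- p)"
      using eventually_ge_at_top[of 1]
    proof eventually_elim
      fix n :: nat assume n: "1 \<le> n"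
      have "(2::real) \<le> 2 ^ n" using n self_le_power[of "2::real" n] by simp
      then have "max 2 (real (2 ^ n)) = 2 ^ n" by simp
      then show "2 ^ n * ?u (2 ^ n) = ln 2 powr (- p) * real n powr (- p)"
        by (simp add: ln_realpow powr_mult mult.commute)
    qed
  qed
  also have "\<dots>"
    using p by (intro summable_mult) (simp add: summable_real_powr_iff)
  finally show ?thesis .
qed

text \<open>The sum is the expected squared norm of white noise, and it converges because 2 \<delta>
  > 1. For dyadic levels the 2^l positions cancel the factor 2^(-l) and leave a multiple of l^(-2
  \<delta>); for one-element levels the preceding series dominates.\<close>

lemma H_weight_summable:
  assumes B: "regular_basis S B" and d: "\<delta> > 1/2"
  shows "H_weight B \<delta> summable_on idx B"
proof -
  define v where "v l = real (card (positions B l)) * (inverse (char_seq B l) * ln (char_seq B l) powr (- 2 * \<delta>))" for l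
  have "\<exists>u :: nat \<Rightarrow> real. summable u \<and> (\<forall>n. 0 \<le> u n) \<and> (\<forall>l\<in>levels B. card (positions B l) > 0 \<and> v l \<le> u (nat \<bar>l\<bar>))"
  proof -
    from B consider "\<forall>l\<in>levels B. card (positions B l) = 1 \<and> char_seq B l = max 2 \<bar>real_of_int l\<bar>"
      | "levels B \<subseteq> {1..}" "\<forall>l\<in>levels B. card (positions B l) = 2 ^ nat l \<and> char_seq B l = 2 ^ nat l"
      unfolding regular_basis_def by blast
    then show ?thesis
    proof cases
      case 1
      then show ?thesis
        using summable_inverse_ln_powr[of "2 * \<delta>"] d
        by (intro exI[of _ "\<lambda>n. inverse (max 2 (real n)) * ln (max 2 (real n)) powr (- (2 * \<delta>))"])
          (auto simp: v_def)
    next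
      case 2
      have "summable (\<lambda>n. ln 2 powr (- 2 * \<delta>) * real n powr (- 2 * \<delta>))"
        using d by (intro summable_mult) (simp add: summable_real_powr_iff)
      moreover have "v l \<le> ln 2 powr (- 2 * \<delta>) * real (nat \<bar>l\<bar>) powr (- 2 * \<delta>)" if "l \<in> levels B" for l
      proof -
        have "l \<ge> 1" using 2(1) that by auto
        moreover have "v l = ln (2 ^ nat l) powr (- 2 * \<delta>)" using 2(2) that by (simp add: v_def)
        ultimately show ?thesis by (simp add: ln_realpow powr_mult mult.commute)
      qed
      ultimately show ?thesis using 2(2)
        by (intro exI[of _ "\<lambda>n. ln 2 powr (- 2 * \<delta>) * real n powr (- 2 * \<delta>)"]) auto
    qed
  qed
  then obtain u :: "nat \<Rightarrow> real" where u: "summable u" "\<And>n. 0 \<le> u n"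
    and v: "\<And>l. l \<in> levels B \<Longrightarrow> card (positions B l) > 0" "\<And>l. l \<in> levels B \<Longrightarrow> v l \<le> u (nat \<bar>l\<bar>)"
    by blast
  \<comment> \<open>Every value of |l| is attained by at most two levels, whence the factor
    2.\<close>
  have L: "(\<Sum>l\<in>L. u (nat \<bar>l\<bar>)) \<le> 2 * suminf u" if L: "finite L" for L :: "int set"
  proof -
    define m where "m = (\<Sum>l\<in>L. nat \<bar>l\<bar>)"
    have "L \<subseteq> int ` {..m} \<union> (\<lambda>n. - int n) ` {..m}"
    proof
      fix l assume "l \<in> L"
      then have "nat \<bar>l\<bar> \<le> m" unfolding m_def using L by (intro member_le_sum) auto
      moreover have "l = int (nat \<bar>l\<bar>) \<or> l = - int (nat \<bar>l\<bar>)" by auto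
      ultimately show "l \<in> int ` {..m} \<union> (\<lambda>n. - int n) ` {..m}" by blast
    qed
    then have "(\<Sum>l\<in>L. u (nat \<bar>l\<bar>)) \<le> (\<Sum>l\<in>int ` {..m} \<union> (\<lambda>n. - int n) ` {..m}. u (nat \<bar>l\<bar>))"
      using u(2) by (intro sum_mono2) auto
    also have "\<dots> \<le> (\<Sum>l\<in>int ` {..m}. u (nat \<bar>l\<bar>)) + (\<Sum>l\<in>(\<lambda>n. - int n) ` {..m}. u (nat \<bar>l\<bar>))"
      using u(2) by (subst sum.union_inter[symmetric]) (auto intro!: sum_nonneg)
    also have "\<dots> = (\<Sum>n\<le>m. u n) + (\<Sum>n\<le>m. u n)"
      by (subst (1 2) sum.reindex) (auto simp: inj_on_def)
    also have "\<dots> \<le> suminf u + suminf u"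
      using u by (intro add_mono sum_le_suminf) auto
    finally show ?thesis by simp
  qed
  show ?thesis
  proof (rule nonneg_bdd_above_summable_on)
    show "0 \<le> H_weight B \<delta> i" if "i \<in> idx B" for i by (rule H_weight_nonneg[OF B that])
    have "(\<Sum>i\<in>F. H_weight B \<delta> i) \<le> 2 * suminf u" if F: "finite F" "F \<subseteq> idx B" for F
    proof -
      let ?L = "fst ` F"
      have FL: "F \<subseteq> (SIGMA l:?L. positions B l)" using F(2) by (force simp: idx_def)
      have Ll: "?L \<subseteq> levels B" using F(2) by (auto simp: idx_def)
      have fp: "finite (positions B l)" if "l \<in> ?L" for l using v(1) Ll that card_gt_0_iff by blast
      have "(\<Sum>i\<in>F. H_weight B \<delta> i) \<le> (\<Sum>i\<in>(SIGMA l:?L. positions B l). H_weight B \<delta> i)"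
        using F FL fp Ll H_weight_nonneg[OF B] by (intro sum_mono2 finite_SigmaI) (auto simp: idx_def)
      also have "\<dots> = (\<Sum>l\<in>?L. \<Sum>k\<in>positions B l. H_weight B \<delta> (l, k))"
        using F fp by (subst sum.Sigma) auto
      also have "\<dots> = (\<Sum>l\<in>?L. v l)" by (simp add: H_weight_def v_def)
      also have "\<dots> \<le> (\<Sum>l\<in>?L. u (nat \<bar>l\<bar>))" using v(2) Ll by (intro sum_mono) auto
      also have "\<dots> \<le> 2 * suminf u" using F(1) by (intro L) auto
      finally show ?thesis .
    qed
    then show "bdd_above (sum (H_weight B \<delta>) ` {F. F \<subseteq> idx B \<and> finite F})"
      by (auto simp: bdd_above_def)
  qed
qed

text \<open>Points of the product space are \<open>undefined\<close> off the index set, whereas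
  coefficient families vanish there.\<close>

definition zero_extend :: "l2_basis \<Rightarrow> (int \<times> int \<Rightarrow> real) \<Rightarrow> coeffs" where
  "zero_extend B \<omega> = (\<lambda>i. if i \<in> idx B then \<omega> i else 0)"

definition white_map :: "l2_basis \<Rightarrow> real \<Rightarrow> (int \<times> int \<Rightarrow> real) \<Rightarrow> coeffs" where
  "white_map B \<delta> \<omega> = (if zero_extend B \<omega> \<in> H_space B \<delta> then zero_extend B \<omega> else (\<lambda>_. 0))"

lemma white_noise_eq_distr: "white_noise B \<delta> = distr (iid_normal (idx B)) (H_borel B \<delta>) (white_map B \<delta>)"
  by (simp only: white_noise_def white_map_def[abs_def] zero_extend_def Let_def)

lemma white_map_in_H: "white_map B \<delta> \<omega> \<in> H_space B \<delta>"
  by (simp add: white_map_def H_space_zero)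

lemma zero_extend_in_H_iff:
  assumes B: "regular_basis S B"
  shows "zero_extend B \<omega> \<in> H_space B \<delta> \<longleftrightarrow>
    (\<integral>\<^sup>+i. ennreal (H_weight B \<delta> i * (\<omega> i)\<^sup>2) \<partial>count_space (idx B)) < \<infinity>"
proof -
  have "zero_extend B \<omega> \<in> H_space B \<delta> \<longleftrightarrow> (\<lambda>i. H_weight B \<delta> i * (\<omega> i)\<^sup>2) summable_on idx B"
    by (simp add: H_space_def zero_extend_def cong: summable_on_cong)
  also have "\<dots> \<longleftrightarrow> (\<integral>\<^sup>+i. ennreal (H_weight B \<delta> i * (\<omega> i)\<^sup>2) \<partial>count_space (idx B)) < \<infinity>"
    using H_weight_nonneg[OF B] by (intro summable_on_iff_nn_integral_count_space) auto
  finally show ?thesis .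
qed

lemma borel_measurable_weighted_square:
  "(\<lambda>\<omega>. \<integral>\<^sup>+i. ennreal (w i * (\<omega> i - y i)\<^sup>2) \<partial>count_space (idx B)) \<in> borel_measurable (iid_normal (idx B))"
  using measurable_iid_normal_component[of _ "idx B"]
  by (intro borel_measurable_nn_integral_count_space) auto

lemma sets_zero_extend_in_H:
  assumes B: "regular_basis S B"
  shows "{\<omega> \<in> space (iid_normal (idx B)). zero_extend B \<omega> \<in> H_space B \<delta>} \<in> sets (iid_normal (idx B))"
  unfolding zero_extend_in_H_iff[OF B]
  using borel_measurable_weighted_square[where w = "H_weight B \<delta>" and y = "\<lambda>_. 0" and B = B] by simp

text \<open>On the event of finite norm the distance to a point is the square root of an integral
  over counting measure; off this event it is constant.\<close>

lemma white_map_measurable: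
  assumes B: "regular_basis S B"
  shows "white_map B \<delta> \<in> measurable (iid_normal (idx B)) (H_borel B \<delta>)"
proof (rule measurable_H_borelI[OF B])
  show "white_map B \<delta> \<in> space (iid_normal (idx B)) \<rightarrow> H_space B \<delta>" by (simp add: white_map_in_H)
  fix y assume y: "y \<in> H_space B \<delta>"
  let ?S = "\<lambda>\<omega>. \<integral>\<^sup>+i. ennreal (H_weight B \<delta> i * (\<omega> i - y i)\<^sup>2) \<partial>count_space (idx B)"
  have "H_dist B \<delta> (white_map B \<delta> \<omega>) y =
      (if zero_extend B \<omega> \<in> H_space B \<delta> then sqrt (enn2real (?S \<omega>)) else H_dist B \<delta> (\<lambda>_. 0) y)" for \<omega>
  proof (cases "zero_extend B \<omega> \<in> H_space B \<delta>")
    case True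
    let ?h = "\<lambda>i. H_weight B \<delta> i * (\<omega> i - y i)\<^sup>2"
    have "(\<lambda>i. H_weight B \<delta> i * (zero_extend B \<omega> i - y i)\<^sup>2) summable_on idx B"
      using H_space_diff[OF B True y] by (simp add: H_space_def)
    then have sm: "?h summable_on idx B" by (simp add: zero_extend_def cong: summable_on_cong)
    have nn: "0 \<le> ?h i" if "i \<in> idx B" for i using H_weight_nonneg[OF B that] by simp
    have "?S \<omega> = ennreal (infsum ?h (idx B))"
      using sm nn_integral_count_space_eq_infsum[of "idx B" ?h] nn by simp
    then have "enn2real (?S \<omega>) = infsum ?h (idx B)"
      by (simp add: infsum_nonneg nn)
    then show ?thesis
      using True by (simp add: white_map_def H_dist_def H_norm_def zero_extend_def cong: infsum_cong)
  qed (simp add: white_map_def)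
  then show "(\<lambda>\<omega>. H_dist B \<delta> (white_map B \<delta> \<omega>) y) \<in> borel_measurable (iid_normal (idx B))"
    using borel_measurable_weighted_square[where w = "H_weight B \<delta>" and y = y and B = B] sets_zero_extend_in_H[OF B]
    by (simp only:) (intro measurable_If borel_measurable_sqrt borel_measurable_enn2real; simp)
qed

lemma prob_space_white_noise: "regular_basis S B \<Longrightarrow> prob_space (white_noise B \<delta>)"
  unfolding white_noise_eq_distr
  by (rule prob_space.prob_space_distr[OF prob_space_iid_normal white_map_measurable])

lemma space_white_noise: "regular_basis S B \<Longrightarrow> space (white_noise B \<delta>) = H_space B \<delta>"
  and sets_white_noise: "sets (white_noise B \<delta>) = sets (H_borel B \<delta>)"
  by (simp_all add: white_noise_eq_distr space_H_borel)

text \<open>The coordinates have second moment 1, so the expected squared norm is the finite sum of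
  the weights. Hence the default branch of \<open>white_map\<close> is taken with probability
  zero.\<close>

lemma AE_zero_extend_in_H:
  assumes B: "regular_basis S B" and d: "\<delta> > 1/2"
  shows "AE \<omega> in iid_normal (idx B). zero_extend B \<omega> \<in> H_space B \<delta>"
proof -
  have "(\<integral>\<^sup>+\<omega>. (\<integral>\<^sup>+i. ennreal (H_weight B \<delta> i * (\<omega> i)\<^sup>2) \<partial>count_space (idx B)) \<partial>iid_normal (idx B)) =
      (\<integral>\<^sup>+i. ennreal (H_weight B \<delta> i) \<partial>count_space (idx B))"
    using H_weight_nonneg[OF B] by (intro nn_integral_iid_normal_weighted_square) auto
  also have "\<dots> < \<infinity>"
    using summable_on_iff_nn_integral_count_space[of "idx B" "H_weight B \<delta>"] H_weight_nonneg[OF B]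
      H_weight_summable[OF B d] by simp
  finally have "AE \<omega> in iid_normal (idx B).
      (\<integral>\<^sup>+i. ennreal (H_weight B \<delta> i * (\<omega> i)\<^sup>2) \<partial>count_space (idx B)) \<noteq> \<infinity>"
    using borel_measurable_weighted_square[where w = "H_weight B \<delta>" and y = "\<lambda>_. 0" and B = B]
    by (intro nn_integral_PInf_AE) auto
  then show ?thesis unfolding zero_extend_in_H_iff[OF B] by eventually_elim (simp add: less_top)
qed

text \<open>Membership in \<open>H_space\<close> is a tail property, so it survives any scaling of
  finitely many coordinates.\<close>

lemma zero_extend_finite_change:
  assumes B: "regular_basis S B" and F: "finite F" and eq: "\<And>i. i \<notin> F \<Longrightarrow> \<omega> i = \<omega>' i"
    and H: "zero_extend B \<omega> \<in> H_space B \<delta>"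
  shows "zero_extend B \<omega>' \<in> H_space B \<delta>"
proof -
  have "(\<lambda>i. zero_extend B \<omega>' i - zero_extend B \<omega> i) \<in> H_space B \<delta>"
    by (rule H_space_finite_support[of "F \<inter> idx B"]) (use F eq in \<open>auto simp: zero_extend_def\<close>)
  from H_space_add[OF B this H] show ?thesis by simp
qed

section \<open>Continuity of the distribution function of the seminorm of white noise\<close>

context H_seminorm
begin

lemma measurable: "N \<in> borel_measurable (H_borel B \<delta>)"
  using lipschitz by (rule H_lipschitz_measurable[OF B])

text \<open>Two zeros of N on a line in direction i would make N vanish at a nonzero multiple of the
  i-th unit vector. So each such line carries at most one zero, and Fubini applies.\<close>

lemma AE_norm_neq_0:
  assumes d: "\<delta> > 1/2" and i: "i \<in> idx B" and Ni: "N (\<lambda>j. if j = i then 1 else 0) > 0"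
  shows "AE \<omega> in iid_normal (idx B). N (white_map B \<delta> \<omega>) \<noteq> 0"
proof -
  let ?I = "iid_normal (idx B)"
  let ?e = "\<lambda>j. if j = i then 1 else 0 :: real"
  \<comment> \<open>Without the membership clause, the default value 0 of \<open>white_map\<close>
    would count as a zero of N along whole lines outside \<open>H_space\<close>.\<close>
  define Q where "Q \<omega> \<longleftrightarrow> \<not> (zero_extend B \<omega> \<in> H_space B \<delta> \<and> N (white_map B \<delta> \<omega>) = 0)" for \<omega>
  note [measurable] = measurable_compose[OF white_map_measurable[OF B] measurable]
  have "{\<omega> \<in> space ?I. Q \<omega>} = space ?I - ({\<omega> \<in> space ?I. zero_extend B \<omega> \<in> H_space B \<delta>} \<inter>
      {\<omega> \<in> space ?I. N (white_map B \<delta> \<omega>) = 0})" by (auto simp: Q_def)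
  also have "\<dots> \<in> sets ?I" using sets_zero_extend_in_H[OF B] by (intro sets.Diff sets.Int) auto
  finally have Qm: "{\<omega> \<in> space ?I. Q \<omega>} \<in> sets ?I" .
  have "z = z'" if z: "\<not> Q (X(i := z))" and z': "\<not> Q (X(i := z'))" for X z z'
  proof -
    let ?x = "zero_extend B (X(i := z))" and ?x' = "zero_extend B (X(i := z'))"
    have x: "?x \<in> H_space B \<delta>" "?x' \<in> H_space B \<delta>" "N ?x = 0" "N ?x' = 0"
      using z z' by (auto simp: Q_def white_map_def)
    have e: "?e \<in> H_space B \<delta>" by (rule H_space_finite_support[of "{i}"]) (use i in auto)
    have "(\<lambda>j. ?x j - ?x' j) = (\<lambda>j. (z - z') * ?e j)"
      using i by (auto simp: zero_extend_def)
    then have "N (\<lambda>j. ?x j - ?x' j) = \<bar>z - z'\<bar> * N ?e" by (simp only: scale[OF e])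
    moreover have "N (\<lambda>j. ?x j - ?x' j) \<le> N ?x + N (\<lambda>j. -1 * ?x' j)"
      using triangle[OF x(1) H_space_scale[OF x(2), of "-1"]] by simp
    moreover have "N (\<lambda>j. -1 * ?x' j) = 0" using scale[OF x(2), of "-1"] x(4) by simp
    ultimately have "\<bar>z - z'\<bar> * N ?e \<le> 0" using x(3) by simp
    then show ?thesis using Ni by (simp add: mult_le_0_iff)
  qed
  then have "AE z in lborel. Q (X(i := z))" for X
    using AE_lborel_at_most_one[of "\<lambda>z. \<not> Q (X(i := z))"] by simp
  then have "AE \<omega> in ?I. Q \<omega>" unfolding AE_iid_normal_iff[OF i Qm] by simp
  with AE_zero_extend_in_H[OF B d] show ?thesis
    by eventually_elim (simp add: Q_def)
qed

lemma AE_norm_neq_if_tail_less: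
  assumes F: "finite F" "F \<subseteq> idx B" and c: "c > 0"
  shows "AE \<omega> in iid_normal (idx B).
    \<not> (N (white_map B \<delta> \<omega>) = c \<and> N (white_map B \<delta> (scale_coords F 0 \<omega>)) < c)"
proof -
  let ?I = "iid_normal (idx B)"
  let ?V = "\<lambda>\<omega>. N (white_map B \<delta> \<omega>)"
  define A where "A \<omega> \<longleftrightarrow> ?V \<omega> = c \<and> ?V (scale_coords F 0 \<omega>) < c" for \<omega>
  have V: "?V \<in> borel_measurable ?I" by (rule measurable_compose[OF white_map_measurable[OF B] measurable])
  have V0: "(\<lambda>\<omega>. ?V (scale_coords F 0 \<omega>)) \<in> borel_measurable ?I"
    using measurable_scale_coords[OF F(2), of "\<lambda>_. 0" ?I "\<lambda>\<omega>. \<omega>"] by (intro measurable_compose[OF _ V]) simp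
  have "{\<omega> \<in> space ?I. A \<omega>} \<in> sets ?I" unfolding A_def using V V0 by measurable
  then have Am: "{\<omega> \<in> space ?I. \<not> A \<omega>} \<in> sets ?I" by (rule sets.sets_Collect_neg)
  \<comment> \<open>If \<rho> < \<rho>', the point at scale \<rho> is a proper convex combination of
    the point at \<rho>', where N is c, and the point at 0, where N is less than c; then N is less
    than c at \<rho> as well.\<close>
  have uniq: "\<rho> = \<rho>'" if lt: "\<rho> \<le> \<rho>'" and r: "\<rho> > 0" and A: "A (scale_coords F \<rho> \<omega>)" "A (scale_coords F \<rho>' \<omega>)" for \<rho> \<rho>' \<omega>
  proof (rule ccontr)
    assume "\<rho> \<noteq> \<rho>'"
    with lt r have r': "0 < \<rho>'" "\<rho> / \<rho>' < 1" "0 < \<rho> / \<rho>'" by auto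
    let ?t = "\<rho> / \<rho>'"
    let ?x = "\<lambda>s. zero_extend B (scale_coords F s \<omega>)"
    \<comment> \<open>N vanishes at the default value of \<open>white_map\<close>, so N = c > 0
      forces membership in \<open>H_space\<close>, which then holds at every scale.\<close>
    have "white_map B \<delta> (scale_coords F \<rho> \<omega>) \<noteq> (\<lambda>_. 0)"
      using A(1) c scale[OF H_space_zero, of 0] by (auto simp: A_def)
    then have "?x \<rho> \<in> H_space B \<delta>" by (auto simp: white_map_def split: if_splits)
    then have x: "?x s \<in> H_space B \<delta>" for s
      by (rule zero_extend_finite_change[OF B F(1), rotated]) (simp add: scale_coords_def)
    have ss: "scale_coords F 0 (scale_coords F s \<omega>) = scale_coords F 0 \<omega>" for s
      by (auto simp: scale_coords_def)
    have N: "N (?x \<rho>) = c" "N (?x \<rho>') = c" "N (?x 0) < c"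
      using A x by (auto simp: A_def white_map_def ss)
    have "?x \<rho> = (\<lambda>i. ?t * ?x \<rho>' i + (1 - ?t) * ?x 0 i)"
      using r' by (auto simp: zero_extend_def scale_coords_def field_simps)
    then have "N (?x \<rho>) \<le> N (\<lambda>i. ?t * ?x \<rho>' i) + N (\<lambda>i. (1 - ?t) * ?x 0 i)"
      using triangle[OF H_space_scale[OF x] H_space_scale[OF x], of ?t \<rho>' "1 - ?t" 0] by simp
    also have "\<dots> = \<bar>?t\<bar> * c + \<bar>1 - ?t\<bar> * N (?x 0)"
      by (simp only: scale[OF x] N)
    also have "\<dots> = ?t * c + (1 - ?t) * N (?x 0)"
      using r' by (simp only: abs_of_pos diff_gt_0_iff_gt)
    also have "\<dots> < ?t * c + (1 - ?t) * c"
      using N(3) r' by (intro add_strict_left_mono mult_strict_left_mono) auto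
    finally show False using N(1) by (simp add: algebra_simps)
  qed
  interpret P: prob_space ?I by (rule prob_space_iid_normal)
  interpret pair_sigma_finite lborel ?I ..
  let ?Q = "\<lambda>\<rho> \<omega>. \<rho> \<in> {0<..} \<longrightarrow> \<not> A (scale_coords F \<rho> \<omega>)"
  have "{x \<in> space (lborel \<Otimes>\<^sub>M ?I). \<not> A (scale_coords F (fst x) (snd x))} \<in> sets (lborel \<Otimes>\<^sub>M ?I)"
    by (rule measurable_Collect_compose[OF Am measurable_scale_coords[OF F(2)]]) auto
  moreover have "{x \<in> space (lborel \<Otimes>\<^sub>M ?I). \<not> fst x \<in> {0::real<..}} \<in> sets (lborel \<Otimes>\<^sub>M ?I)"
    by measurable
  ultimately have Qm: "{x \<in> space (lborel \<Otimes>\<^sub>M ?I). ?Q (fst x) (snd x)} \<in> sets (lborel \<Otimes>\<^sub>M ?I)"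
    unfolding imp_conv_disj by (intro sets.sets_Collect_disj)
  have "AE \<rho> in lborel. ?Q \<rho> \<omega>" for \<omega>
    using AE_lborel_at_most_one[of "\<lambda>\<rho>. \<rho> > 0 \<and> A (scale_coords F \<rho> \<omega>)"] uniq
    by (smt (verit) AE_cong greaterThan_iff)
  then have "AE \<omega> in ?I. AE \<rho> in lborel. ?Q \<rho> \<omega>" by simp
  then have "AE \<rho> in lborel. AE \<omega> in ?I. ?Q \<rho> \<omega>" using AE_commute[OF Qm] by simp
  \<comment> \<open>Fubini gives the claim for almost every positive scale, and an interval is not
    null, so some \<rho> > 0 works for almost every point. Scaling by 1 / \<rho>, which preserves
    null sets, then returns to the original coordinates.\<close>
  moreover have "\<not> (AE \<rho> in lborel. \<rho> \<notin> {0<..<1::real})"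
    by (subst AE_iff_null_sets[symmetric]) (auto simp: null_sets_def)
  ultimately obtain \<rho> where \<rho>: "\<rho> > 0" "AE \<omega> in ?I. ?Q \<rho> \<omega>"
    by (metis (mono_tags, lifting) AE_mp AE_I2 greaterThanLessThan_iff)
  then have "AE \<omega> in ?I. \<not> A (scale_coords F \<rho> \<omega>)" by auto
  then have "AE \<omega> in ?I. \<not> A (scale_coords F \<rho> (scale_coords F (1 / \<rho>) \<omega>))"
    using \<rho>(1) measurable_scale_coords[OF F(2), of "\<lambda>_. \<rho>" ?I "\<lambda>\<omega>. \<omega>"]
    by (intro AE_iid_normal_scale_coords[OF F, of "\<lambda>\<omega>. \<not> A (scale_coords F \<rho> \<omega>)"]
        measurable_Collect_compose[OF Am]) auto
  moreover have "scale_coords F \<rho> (scale_coords F (1 / \<rho>) \<omega>) = \<omega>" for \<omega>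
    using \<rho>(1) by (auto simp: scale_coords_def)
  ultimately show ?thesis by (simp add: A_def)
qed

end

context H_seminorm
begin

text \<open>Off a null set, N = c forces the tail to have seminorm at least c, hence squared norm at
  least (c / C)^2. Markov's inequality then involves only the weights outside
  \<open>F\<close>.\<close>

lemma emeasure_norm_eq_le_tail:
  assumes F: "finite F" "F \<subseteq> idx B" and c: "c > 0"
  shows "emeasure (iid_normal (idx B)) {\<omega> \<in> space (iid_normal (idx B)). N (white_map B \<delta> \<omega>) = c} \<le>
    ennreal ((C / c)\<^sup>2) * (\<integral>\<^sup>+i. ennreal (H_weight B \<delta> i) \<partial>count_space (idx B - F))"
proof -
  let ?I = "iid_normal (idx B)" and ?J = "idx B - F"
  let ?V = "\<lambda>\<omega>. N (white_map B \<delta> \<omega>)"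
  let ?S = "\<lambda>\<omega>. \<integral>\<^sup>+i. ennreal (H_weight B \<delta> i * (\<omega> i)\<^sup>2) \<partial>count_space ?J"
  have Sm: "?S \<in> borel_measurable ?I"
    using measurable_iid_normal_component[of _ "idx B"]
    by (intro borel_measurable_nn_integral_count_space) auto
  have V: "?V \<in> borel_measurable ?I" by (rule measurable_compose[OF white_map_measurable[OF B] measurable])
  have tail: "1 \<le> ennreal ((C / c)\<^sup>2) * ?S \<omega>" if ge: "c \<le> ?V (scale_coords F 0 \<omega>)" for \<omega>
  proof -
    let ?x = "zero_extend B (scale_coords F 0 \<omega>)"
    have "N (\<lambda>_. 0) = 0" using scale[OF H_space_zero, of 0] by simp
    then have x: "?x \<in> H_space B \<delta>" "white_map B \<delta> (scale_coords F 0 \<omega>) = ?x"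
      using ge c by (auto simp: white_map_def split: if_splits)
    let ?h = "\<lambda>i. H_weight B \<delta> i * (\<omega> i)\<^sup>2" and ?g = "\<lambda>i. H_weight B \<delta> i * (?x i)\<^sup>2"
    have g: "?g summable_on idx B" using x(1) by (simp add: H_space_def)
    have gh: "?g i = ?h i" if "i \<in> ?J" for i using that by (simp add: zero_extend_def scale_coords_def)
    have g0: "?g i = 0" if "i \<in> F" for i using that by (simp add: zero_extend_def scale_coords_def)
    have h: "?h summable_on ?J"
      using summable_on_subset_banach[OF g, of ?J] summable_on_cong[of ?J ?g ?h, OF gh] by blast
    have gJ: "infsum ?g (idx B) = infsum ?h ?J"
      by (rule infsum_cong_neutral) (use gh g0 in auto)
    have nn: "0 \<le> ?h i" if "i \<in> ?J" for i using H_weight_nonneg[OF B] that by simp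
    have "c \<le> C * H_norm B \<delta> ?x" using ge bound[OF x(1)] by (simp add: x(2))
    then have "c \<le> C * sqrt (infsum ?h ?J)" by (simp only: H_norm_def gJ)
    then have "c\<^sup>2 \<le> (C * sqrt (infsum ?h ?J))\<^sup>2" using c by (intro power_mono) auto
    then have "c\<^sup>2 \<le> C\<^sup>2 * infsum ?h ?J" using infsum_nonneg[of ?J ?h] nn by (simp add: power_mult_distrib)
    then have "1 \<le> (C / c)\<^sup>2 * infsum ?h ?J" using c by (simp add: power_divide field_simps)
    then have "1 \<le> ennreal ((C / c)\<^sup>2 * infsum ?h ?J)" by simp
    also have "\<dots> = ennreal ((C / c)\<^sup>2) * ?S \<omega>"
      using h nn nn_integral_count_space_eq_infsum[of ?J ?h] infsum_nonneg[of ?J ?h]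
      by (simp add: ennreal_mult del: ennreal_mult')
    finally show ?thesis .
  qed
  have "emeasure ?I {\<omega> \<in> space ?I. ?V \<omega> = c} \<le> emeasure ?I {\<omega> \<in> space ?I. 1 \<le> ennreal ((C / c)\<^sup>2) * ?S \<omega>}"
  proof (rule emeasure_mono_AE)
    show "AE \<omega> in ?I. \<omega> \<in> {\<omega> \<in> space ?I. ?V \<omega> = c} \<longrightarrow> \<omega> \<in> {\<omega> \<in> space ?I. 1 \<le> ennreal ((C / c)\<^sup>2) * ?S \<omega>}"
      using AE_norm_neq_if_tail_less[OF F c] by eventually_elim (auto intro!: tail simp: not_less)
    show "{\<omega> \<in> space ?I. 1 \<le> ennreal ((C / c)\<^sup>2) * ?S \<omega>} \<in> sets ?I" using Sm by measurable
  qed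
  also have "\<dots> \<le> ennreal ((C / c)\<^sup>2) * (\<integral>\<^sup>+\<omega>. ?S \<omega> * indicator (space ?I) \<omega> \<partial>?I)"
    by (rule nn_integral_Markov_inequality) (use Sm in auto)
  also have "(\<integral>\<^sup>+\<omega>. ?S \<omega> * indicator (space ?I) \<omega> \<partial>?I) = (\<integral>\<^sup>+\<omega>. ?S \<omega> \<partial>?I)"
    by (rule nn_integral_cong) simp
  also have "\<dots> = (\<integral>\<^sup>+i. ennreal (H_weight B \<delta> i) \<partial>count_space ?J)"
    using H_weight_nonneg[OF B] by (intro nn_integral_iid_normal_weighted_square) auto
  finally show ?thesis .
qed

lemma emeasure_norm_eq_pos:
  assumes d: "\<delta> > 1/2" and c: "c > 0"
  shows "emeasure (iid_normal (idx B)) {\<omega> \<in> space (iid_normal (idx B)). N (white_map B \<delta> \<omega>) = c} = 0"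
proof -
  let ?w = "H_weight B \<delta>"
  let ?e = "emeasure (iid_normal (idx B)) {\<omega> \<in> space (iid_normal (idx B)). N (white_map B \<delta> \<omega>) = c}"
  have sm: "?w summable_on idx B" by (rule H_weight_summable[OF B d])
  have "?e \<le> 0 + ennreal e" if e: "e > 0" for e
  proof -
    \<comment> \<open>The tail weight that the Markov factor (C / c)^2 turns into exactly e.\<close>
    define e' where "e' = e / (C / c)\<^sup>2"
    have e': "e' > 0" "(C / c)\<^sup>2 * e' = e" using e c C by (auto simp: e'_def)
    have "(sum ?w \<longlongrightarrow> infsum ?w (idx B)) (finite_subsets_at_top (idx B))"
      using has_sum_infsum[OF sm] by (simp add: has_sum_def)
    then have "\<forall>\<^sub>F F in finite_subsets_at_top (idx B). sum ?w F > infsum ?w (idx B) - e'"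
      using e' by (intro order_tendstoD) auto
    then obtain F where F: "finite F" "F \<subseteq> idx B" "sum ?w F > infsum ?w (idx B) - e'"
      unfolding eventually_finite_subsets_at_top by blast
    have "infsum ?w (idx B - F) = infsum ?w (idx B) - infsum ?w F"
      using F by (intro infsum_Diff sm) auto
    then have le: "infsum ?w (idx B - F) \<le> e'" using F by simp
    have "?e \<le> ennreal ((C / c)\<^sup>2) * (\<integral>\<^sup>+i. ennreal (?w i) \<partial>count_space (idx B - F))"
      by (rule emeasure_norm_eq_le_tail[OF F(1,2) c])
    also have "(\<integral>\<^sup>+i. ennreal (?w i) \<partial>count_space (idx B - F)) = ennreal (infsum ?w (idx B - F))"
      using nn_integral_count_space_eq_infsum[of "idx B - F" ?w] H_weight_nonneg[OF B]
        summable_on_subset_banach[OF sm, of "idx B - F"] by simp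
    also have "ennreal ((C / c)\<^sup>2) * ennreal (infsum ?w (idx B - F)) \<le> ennreal ((C / c)\<^sup>2) * ennreal e'"
      using le by (intro mult_left_mono ennreal_leI) auto
    also have "\<dots> = ennreal e" using e' by (simp add: ennreal_mult[symmetric])
    finally show ?thesis by simp
  qed
  then have "?e \<le> 0" by (rule ennreal_le_epsilon)
  then show ?thesis by simp
qed

definition law :: "real measure" where
  "law = distr (white_noise B \<delta>) borel N"

lemma measurable_white_noise: "N \<in> borel_measurable (white_noise B \<delta>)"
  using measurable by (simp cong: measurable_cong_sets add: measurable_cong_sets[OF sets_white_noise refl])

lemma real_distribution_law: "real_distribution law"
proof -
  interpret prob_space "white_noise B \<delta>" by (rule prob_space_white_noise[OF B])
  show ?thesis unfolding law_def by (rule real_distribution_distr[OF measurable_white_noise])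
qed

lemma cdf_law: "cdf law a = measure (white_noise B \<delta>) {w \<in> H_space B \<delta>. N w \<le> a}"
  unfolding law_def cdf_def
  by (subst measure_distr[OF measurable_white_noise])
    (auto simp: space_white_noise[OF B] intro!: arg_cong[where f = "measure (white_noise B \<delta>)"])

lemma law_atomless:
  assumes d: "\<delta> > 1/2" and i: "i \<in> idx B" and Ni: "N (\<lambda>j. if j = i then 1 else 0) > 0"
  shows "measure law {c} = 0"
proof -
  let ?I = "iid_normal (idx B)"
  let ?E = "{\<omega> \<in> space ?I. N (white_map B \<delta> \<omega>) = c}"
  have V: "(\<lambda>\<omega>. N (white_map B \<delta> \<omega>)) \<in> borel_measurable ?I"
    by (rule measurable_compose[OF white_map_measurable[OF B] measurable])
  have "emeasure ?I ?E = 0"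
  proof -
    consider "c > 0" | "c = 0" | "c < 0" by linarith
    then show ?thesis
    proof cases
      case 1 then show ?thesis by (rule emeasure_norm_eq_pos[OF d])
    next
      case 2
      have "AE \<omega> in ?I. \<omega> \<notin> ?E" using AE_norm_neq_0[OF d i Ni] by eventually_elim (simp add: 2)
      moreover have "?E \<in> sets ?I" using V by measurable
      ultimately show ?thesis using AE_iff_null_sets[of ?E ?I] by auto
    next
      case 3
      then have "?E = {}" using nonneg[OF white_map_in_H] by (auto simp: not_less[symmetric])
      then show ?thesis by (simp only: emeasure_empty)
    qed
  qed
  moreover have "emeasure law {c} = emeasure ?I ?E"
  proof -
    have "law = distr ?I borel (\<lambda>\<omega>. N (white_map B \<delta> \<omega>))"
      unfolding law_def white_noise_eq_distr
      by (subst distr_distr[OF measurable white_map_measurable[OF B]]) (simp add: comp_def)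
    then show ?thesis
      using V by (auto simp: emeasure_distr intro!: arg_cong[where f = "emeasure ?I"])
  qed
  ultimately show ?thesis by (simp add: measure_def)
qed

text \<open>The margin 2 \<eta> pays for two shifts of the argument: one from linearizing the
  self-convolution, one from smoothing the indicator in the bounded Lipschitz comparison. Continuity
  of the distribution function provides it.\<close>

lemma cdf_law_quantile:
  assumes d: "\<delta> > 1/2" and i: "i \<in> idx B" and Ni: "N (\<lambda>j. if j = i then 1 else 0) > 0"
    and p: "0 < p" "p < 1" and e: "e > 0"
  obtains a \<eta> where "\<eta> > 0" "\<And>y. \<bar>y - a\<bar> \<le> 2 * \<eta> \<Longrightarrow> \<bar>cdf law y - p\<bar> < e"
proof -
  interpret real_distribution law by (rule real_distribution_law)
  have cont: "isCont (cdf law) x" for x by (simp add: isCont_cdf law_atomless[OF d i Ni])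
  have "\<forall>\<^sub>F x in at_bot. cdf law x < p" using cdf_lim_at_bot p(1) by (rule order_tendstoD)
  then obtain x where x: "cdf law x < p" using eventually_happens by fastforce
  have "\<forall>\<^sub>F x in at_top. cdf law x > p" using cdf_lim_at_top_prob p(2) by (rule order_tendstoD)
  then obtain y where y: "cdf law y > p" using eventually_happens by fastforce
  have "x \<le> y" using x y cdf_nondecreasing[of y x] by linarith
  then obtain a where a: "cdf law a = p"
    using IVT[of "cdf law" x p y] x y cont by auto
  obtain s where s: "s > 0" "\<And>y. dist y a < s \<Longrightarrow> dist (cdf law y) (cdf law a) < e"
    using cont[of a] e unfolding continuous_at_eps_delta by metis
  show ?thesis
    \<comment> \<open>Thirds, because 2 s / 3 stays strictly inside the continuity neighbourhood of
      radius s.\<close>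
    by (rule that[of "s / 3" a]) (use s a in \<open>auto simp: dist_real_def\<close>)
qed

end

section \<open>The law of the data and comparison of laws in the bounded Lipschitz metric\<close>

lemma data_law_measurable:
  assumes B: "regular_basis S B" and d: "\<delta> > 0"
  shows "(\<lambda>w i. basis_coeff B f i + w i / sqrt (real n)) \<in> measurable (white_noise B \<delta>) (H_borel B \<delta>)"
  using H_affine_measurable[OF B basis_coeff_in_H(1)[OF B d], of f "1 / sqrt (real n)"]
  by (simp add: measurable_cong_sets[OF sets_white_noise refl])

lemma prob_space_data_law:
  assumes B: "regular_basis S B" and d: "\<delta> > 0"
  shows "prob_space (data_law B \<delta> n f)"
  unfolding data_law_def
  by (rule prob_space.prob_space_distr[OF prob_space_white_noise[OF B] data_law_measurable[OF B d]])

lemma space_data_law: "regular_basis S B \<Longrightarrow> space (data_law B \<delta> n f) = H_space B \<delta>"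
  and sets_data_law: "sets (data_law B \<delta> n f) = sets (H_borel B \<delta>)"
  by (simp_all add: data_law_def space_H_borel)

text \<open>Inserting the data, sqrt n (f - X) is exactly -W, and N is even. The law is therefore
  the same for every positive n, without passing to a limit.\<close>

lemma (in H_seminorm) data_law_norm_le:
  assumes d: "\<delta> > 0" and n: "n > 0"
  shows "measure (data_law B \<delta> n f)
    {x \<in> H_space B \<delta>. N (\<lambda>i. sqrt (real n) * (basis_coeff B f i - x i)) \<le> a} = cdf law a"
    and "{x \<in> H_space B \<delta>. N (\<lambda>i. sqrt (real n) * (basis_coeff B f i - x i)) \<le> a} \<in> sets (H_borel B \<delta>)"
proof -
  let ?b = "basis_coeff B f"
  let ?M = "\<lambda>x. N (\<lambda>i. sqrt (real n) * (?b i - x i))"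
  have b: "?b \<in> H_space B \<delta>" by (rule basis_coeff_in_H[OF B d])
  have "(\<lambda>x i. sqrt (real n) * ?b i + (- sqrt (real n)) * x i) \<in> measurable (H_borel B \<delta>) (H_borel B \<delta>)"
    by (intro H_affine_measurable[OF B] H_space_scale b)
  from measurable_compose[OF this measurable] have Mm: "?M \<in> borel_measurable (H_borel B \<delta>)"
    by (simp add: right_diff_distrib)
  then show m: "{x \<in> H_space B \<delta>. ?M x \<le> a} \<in> sets (H_borel B \<delta>)"
    unfolding space_H_borel[OF B, symmetric] by measurable
  have eq: "?M (\<lambda>i. ?b i + w i / sqrt (real n)) = N w" if w: "w \<in> H_space B \<delta>" for w
  proof -
    have "(\<lambda>i. sqrt (real n) * (?b i - (?b i + w i / sqrt (real n)))) = (\<lambda>i. - 1 * w i)"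
      using n by auto
    then show ?thesis using scale[OF w, of "-1"] by (simp only:)
  qed
  have mem: "(\<lambda>i. ?b i + w i / sqrt (real n)) \<in> H_space B \<delta>" if "w \<in> H_space B \<delta>" for w
    using H_space_add[OF B b H_space_scale[OF that, of "1 / sqrt (real n)"]] by simp
  have "measure (data_law B \<delta> n f) {x \<in> H_space B \<delta>. ?M x \<le> a} =
      measure (white_noise B \<delta>) ((\<lambda>w i. ?b i + w i / sqrt (real n)) -` {x \<in> H_space B \<delta>. ?M x \<le> a} \<inter> space (white_noise B \<delta>))"
    unfolding data_law_def by (rule measure_distr[OF data_law_measurable[OF B d] m])
  also have "(\<lambda>w i. ?b i + w i / sqrt (real n)) -` {x \<in> H_space B \<delta>. ?M x \<le> a} \<inter> space (white_noise B \<delta>) =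
      {w \<in> H_space B \<delta>. N w \<le> a}"
    using eq mem by (auto simp: space_white_noise[OF B])
  finally show "measure (data_law B \<delta> n f) {x \<in> H_space B \<delta>. ?M x \<le> a} = cdf law a"
    by (simp add: cdf_law)
qed

lemma BL1_abs_le_1:
  assumes "u \<in> BL1 M d" "x \<in> M"
  shows "\<bar>u x\<bar> \<le> 1"
proof -
  have "ennreal \<bar>u x\<bar> \<le> (SUP x\<in>M. ennreal \<bar>u x\<bar>)" using assms(2) by (rule SUP_upper)
  also have "\<dots> \<le> 1"
    using assms(1) unfolding BL1_def by (auto intro: order_trans[rotated])
  finally show ?thesis by simp
qed

lemma BL_dist_upper:
  assumes \<mu>: "prob_space \<mu>" "space \<mu> = M" and \<nu>: "prob_space \<nu>" "space \<nu> = M" and u: "u \<in> BL1 M d"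
  shows "\<bar>(LINT x|\<mu>. u x) - (LINT x|\<nu>. u x)\<bar> \<le> BL_dist M d \<mu> \<nu>"
  unfolding BL_dist_def
proof (rule cSUP_upper[OF u])
  \<comment> \<open>Members of \<open>BL1\<close> need not be measurable for the given measure; a
    function that is not integrable has integral 0, so the bound that makes the supremum finite
    covers all of them.\<close>
  have le: "\<bar>LINT x|\<mu>. u x\<bar> \<le> 1" if "prob_space \<mu>" "space \<mu> = M" "u \<in> BL1 M d" for \<mu> u
  proof (cases "integrable \<mu> u")
    case True
    interpret prob_space \<mu> by fact
    have "\<bar>LINT x|\<mu>. u x\<bar> \<le> (LINT x|\<mu>. \<bar>u x\<bar>)" by (rule integral_abs_bound)
    also have "\<dots> \<le> 1"
      by (rule integral_le_const) (use True BL1_abs_le_1[OF that(3)] that(2) in auto)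
    finally show ?thesis .
  qed (simp add: not_integrable_integral_eq)
  have "\<bar>(LINT x|\<mu>. u x) - (LINT x|\<nu>. u x)\<bar> \<le> 2" if "u \<in> BL1 M d" for u
    using le[OF \<mu> that] le[OF \<nu> that] by linarith
  then show "bdd_above ((\<lambda>u. \<bar>(LINT x|\<mu>. u x) - (LINT x|\<nu>. u x)\<bar>) ` BL1 M d)"
    by (auto simp: bdd_above_def)
qed

context H_seminorm
begin

text \<open>The test function is 1 where N \<le> a and descends linearly in N to 0 on
  [a, a + \<eta>]. It is bounded by 1 and Lipschitz with constant C / \<eta>, so division by 1 + C /
  \<eta> puts it into \<open>BL1\<close>.\<close>

lemma portmanteau:
  assumes \<mu>: "prob_space \<mu>" "sets \<mu> = sets (H_borel B \<delta>)" and \<nu>: "prob_space \<nu>" "sets \<nu> = sets (H_borel B \<delta>)"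
    and \<eta>: "\<eta> > 0"
  shows "\<bar>(LINT x|\<mu>. max 0 (min 1 ((a + \<eta> - N x) / \<eta>))) - (LINT x|\<nu>. max 0 (min 1 ((a + \<eta> - N x) / \<eta>)))\<bar> \<le>
      (1 + C / \<eta>) * BL_dist (H_space B \<delta>) (H_dist B \<delta>) \<mu> \<nu>"
proof -
  interpret Metric_space "H_space B \<delta>" "H_dist B \<delta>" by (rule Metric_space_H[OF B])
  let ?g = "\<lambda>x. max 0 (min 1 ((a + \<eta> - N x) / \<eta>))"
  define L where "L = 1 + C / \<eta>"
  have L: "L \<ge> 1" "L > 0" using C \<eta> by (auto simp: L_def add_pos_pos)
  have sp: "space \<mu> = H_space B \<delta>" "space \<nu> = H_space B \<delta>"
    using sets_eq_imp_space_eq[OF \<mu>(2)] sets_eq_imp_space_eq[OF \<nu>(2)] by (simp_all add: space_H_borel[OF B])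
  define u where "u x = ?g x / L" for x
  have "(SUP x\<in>H_space B \<delta>. ennreal \<bar>u x\<bar>) \<le> ennreal (1 / L)"
    using L by (intro SUP_least ennreal_leI) (auto simp: u_def divide_right_mono)
  moreover have "(SUP (x, y)\<in>{(x, y). x \<in> H_space B \<delta> \<and> y \<in> H_space B \<delta> \<and> x \<noteq> y}.
      ennreal (\<bar>u x - u y\<bar> / H_dist B \<delta> x y)) \<le> ennreal (C / \<eta> / L)"
  proof (rule SUP_least, clarify)
    fix x y assume xy: "x \<in> H_space B \<delta>" "y \<in> H_space B \<delta>" "x \<noteq> y"
    have pos: "H_dist B \<delta> x y > 0" using mdist_pos_less xy by blast
    have "\<bar>max 0 (min 1 s) - max 0 (min 1 t)\<bar> \<le> \<bar>s - t\<bar>" for s t :: real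
      by linarith
    then have "\<bar>?g x - ?g y\<bar> \<le> \<bar>(a + \<eta> - N x) / \<eta> - (a + \<eta> - N y) / \<eta>\<bar>" .
    also have "\<dots> = \<bar>N x - N y\<bar> / \<eta>" using \<eta> by (simp add: diff_divide_distrib[symmetric] abs_minus_commute)
    also have "\<dots> \<le> C * H_dist B \<delta> x y / \<eta>" using lipschitz[OF xy(1,2)] \<eta> by (intro divide_right_mono) auto
    finally have "\<bar>?g x - ?g y\<bar> / L \<le> C * H_dist B \<delta> x y / \<eta> / L" using L by (intro divide_right_mono) auto
    moreover have "\<bar>u x - u y\<bar> = \<bar>?g x - ?g y\<bar> / L"
      using L by (simp add: u_def diff_divide_distrib[symmetric])
    ultimately have "\<bar>u x - u y\<bar> / H_dist B \<delta> x y \<le> (C * H_dist B \<delta> x y / \<eta> / L) / H_dist B \<delta> x y"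
      using pos by (intro divide_right_mono) auto
    also have "\<dots> = C / \<eta> / L" using pos by simp
    finally show "ennreal (\<bar>u x - u y\<bar> / H_dist B \<delta> x y) \<le> ennreal (C / \<eta> / L)" by (rule ennreal_leI)
  qed
  ultimately have "(SUP x\<in>H_space B \<delta>. ennreal \<bar>u x\<bar>) +
      (SUP (x, y)\<in>{(x, y). x \<in> H_space B \<delta> \<and> y \<in> H_space B \<delta> \<and> x \<noteq> y}.
        ennreal (\<bar>u x - u y\<bar> / H_dist B \<delta> x y)) \<le> ennreal (1 / L) + ennreal (C / \<eta> / L)"
    by (rule add_mono)
  also have "\<dots> = ennreal (1 / L + C / \<eta> / L)" using C \<eta> L by (intro ennreal_plus[symmetric]) auto
  also have "1 / L + C / \<eta> / L = (1 + C / \<eta>) / L" by (simp only: add_divide_distrib)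
  also have "\<dots> = 1" using L by (simp only: L_def[symmetric]) simp
  finally have "u \<in> BL1 (H_space B \<delta>) (H_dist B \<delta>)" by (simp add: BL1_def)
  from BL_dist_upper[OF \<mu>(1) sp(1) \<nu>(1) sp(2) this]
  have "\<bar>(LINT x|\<mu>. ?g x) / L - (LINT x|\<nu>. ?g x) / L\<bar> \<le> BL_dist (H_space B \<delta>) (H_dist B \<delta>) \<mu> \<nu>"
    by (simp add: u_def[abs_def])
  then show ?thesis
    using L by (simp add: diff_divide_distrib[symmetric] L_def[symmetric] field_simps)
qed

lemma measure_le_smoothed:
  assumes \<mu>: "prob_space \<mu>" "sets \<mu> = sets (H_borel B \<delta>)" and \<eta>: "\<eta> > 0"
  shows "measure \<mu> {x \<in> H_space B \<delta>. N x \<le> a} \<le> (LINT x|\<mu>. max 0 (min 1 ((a + \<eta> - N x) / \<eta>)))"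
    and "(LINT x|\<mu>. max 0 (min 1 ((a + \<eta> - N x) / \<eta>))) \<le> measure \<mu> {x \<in> H_space B \<delta>. N x \<le> a + \<eta>}"
proof -
  interpret prob_space \<mu> by fact
  let ?g = "\<lambda>x. max 0 (min 1 ((a + \<eta> - N x) / \<eta>))"
  have sp: "space \<mu> = H_space B \<delta>"
    using sets_eq_imp_space_eq[OF \<mu>(2)] by (simp add: space_H_borel[OF B])
  have Nm: "N \<in> borel_measurable \<mu>" using measurable by (simp add: measurable_cong_sets[OF \<mu>(2) refl])
  have S: "{x \<in> H_space B \<delta>. N x \<le> t} \<in> sets \<mu>" for t
    unfolding sp[symmetric] using Nm by measurable
  have gm: "?g \<in> borel_measurable \<mu>" using Nm by measurable
  have gi: "integrable \<mu> ?g"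
    by (rule integrable_const_bound[of _ 1]) (use gm in auto)
  have ind: "integrable \<mu> (\<lambda>x. indicator {x \<in> H_space B \<delta>. N x \<le> t} x :: real)" for t
    using S by (simp add: integrable_indicator_iff emeasure_eq_measure)
  have "(LINT x|\<mu>. indicator {x \<in> H_space B \<delta>. N x \<le> a} x) \<le> (LINT x|\<mu>. ?g x)"
    using \<eta> by (intro integral_mono ind gi) (auto simp: indicator_def)
  then show "measure \<mu> {x \<in> H_space B \<delta>. N x \<le> a} \<le> (LINT x|\<mu>. ?g x)" using S by simp
  have "(LINT x|\<mu>. ?g x) \<le> (LINT x|\<mu>. indicator {x \<in> H_space B \<delta>. N x \<le> a + \<eta>} x)"
    using \<eta> by (intro integral_mono ind gi) (auto simp: indicator_def sp divide_nonpos_pos)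
  then show "(LINT x|\<mu>. ?g x) \<le> measure \<mu> {x \<in> H_space B \<delta>. N x \<le> a + \<eta>}" using S by simp
qed

text \<open>The descent of the cut-off is placed on [a, a + \<eta>] for the first bound and on
  [a - \<eta>, a] for the second.\<close>

lemma BL_dist_norm_le:
  assumes \<mu>: "prob_space \<mu>" "sets \<mu> = sets (H_borel B \<delta>)" and \<eta>: "\<eta> > 0"
  defines "\<beta> \<equiv> BL_dist (H_space B \<delta>) (H_dist B \<delta>) \<mu> (white_noise B \<delta>)"
  shows "measure \<mu> {x \<in> H_space B \<delta>. N x \<le> a} \<le> cdf law (a + \<eta>) + (1 + C / \<eta>) * \<beta>"
    and "cdf law (a - \<eta>) \<le> measure \<mu> {x \<in> H_space B \<delta>. N x \<le> a} + (1 + C / \<eta>) * \<beta>"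
proof -
  note \<nu> = prob_space_white_noise[OF B] sets_white_noise
  show "measure \<mu> {x \<in> H_space B \<delta>. N x \<le> a} \<le> cdf law (a + \<eta>) + (1 + C / \<eta>) * \<beta>"
    using portmanteau[OF \<mu> \<nu> \<eta>, of a] measure_le_smoothed(1)[OF \<mu> \<eta>, of a]
      measure_le_smoothed(2)[OF \<nu> \<eta>, of a] unfolding cdf_law \<beta>_def by linarith
  show "cdf law (a - \<eta>) \<le> measure \<mu> {x \<in> H_space B \<delta>. N x \<le> a} + (1 + C / \<eta>) * \<beta>"
    using portmanteau[OF \<mu> \<nu> \<eta>, of "a - \<eta>"] measure_le_smoothed(2)[OF \<mu> \<eta>, of "a - \<eta>"]
      measure_le_smoothed(1)[OF \<nu> \<eta>, of "a - \<eta>"] unfolding cdf_law \<beta>_def by simp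
qed

end

section \<open>Linearization of the self-convolution\<close>

text \<open>By bilinearity and commutativity the left side is the convolution of f + m with f - m,
  and f + m = 2 f0 + 2 (m - f0) + (f - m).\<close>

lemma self_convol_diff:
  "self_convol f t - self_convol m t =
    convol (2 *\<^sub>R f0) (f - m) t + (2 * convol (m - f0) (f - m) t + convol (f - m) (f - m) t)"
proof -
  have "self_convol f t - self_convol m t = convol f (f - m) t + convol m (f - m) t"
    unfolding self_convol_def convol_commute[of f "f - m"] convol_diff_right convol_diff_left by simp
  moreover have "convol (2 *\<^sub>R f0) (f - m) t = 2 * convol f0 (f - m) t"
    unfolding convol_commute[of _ "f - m"] convol_eq_inner by simp
  ultimately show ?thesis by (simp add: convol_diff_left)
qed

lemma abs_self_convol_diff_le: "\<bar>self_convol f t - self_convol g t\<bar> \<le> norm (f - g) * (norm f + norm g)"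
proof -
  have "self_convol f t - self_convol g t = convol (f - g) f t + convol (f - g) g t"
    unfolding self_convol_def convol_commute[of "f - g"] convol_diff_right convol_diff_left
    by (simp add: convol_commute[of g f])
  also have "\<bar>\<dots>\<bar> \<le> norm (f - g) * norm f + norm (f - g) * norm g"
    using abs_convol_le[of "f - g" f t] abs_convol_le[of "f - g" g t] by linarith
  finally show ?thesis by (simp add: distrib_left)
qed

definition band_dist :: "L2 \<Rightarrow> L2 \<Rightarrow> real" where
  "band_dist f m = unif_norm (\<lambda>t. self_convol f t - self_convol m t)"

lemma band_dist_nonneg: "0 \<le> band_dist f m"
  unfolding band_dist_def using abs_self_convol_diff_le[of f _ m]
  by (intro unif_norm_nonneg) (auto simp: bdd_above_def)

lemma band_dist_lipschitz:
  "\<bar>band_dist f m - band_dist f m'\<bar> \<le> norm (m - m') * (norm m + norm m')"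
proof -
  have le: "band_dist f m \<le> band_dist f m' + norm (m - m') * (norm m + norm m')" for m m' :: L2
  proof -
    have "unif_norm (\<lambda>t. (self_convol f t - self_convol m' t) + (self_convol m' t - self_convol m t)) \<le>
        unif_norm (\<lambda>t. self_convol f t - self_convol m' t) + unif_norm (\<lambda>t. self_convol m' t - self_convol m t)"
      by (rule unif_norm_triangle; rule abs_self_convol_diff_le)
    then have "band_dist f m \<le> band_dist f m' + unif_norm (\<lambda>t. self_convol m' t - self_convol m t)"
      by (simp add: band_dist_def)
    also have "unif_norm (\<lambda>t. self_convol m' t - self_convol m t) \<le> norm (m' - m) * (norm m' + norm m)"
      by (rule unif_norm_le[OF abs_self_convol_diff_le])
    finally show ?thesis by (simp add: norm_minus_commute add.commute)
  qed
  show ?thesis using le[of m m'] le[of m' m] by (simp add: norm_minus_commute add.commute abs_le_iff)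
qed

text \<open>Continuity in the centre makes the distance measurable once the posterior mean is
  inserted, which the coverage event requires.\<close>

lemma continuous_band_dist: "continuous_on UNIV (band_dist f)"
proof (rule continuous_at_imp_continuous_on, intro ballI)
  fix m :: L2
  have "((\<lambda>m'. norm (m' - m) * (norm m' + norm m)) \<longlongrightarrow> norm (m - m) * (norm m + norm m)) (at m)"
    by (intro tendsto_intros)
  then have "((\<lambda>m'. norm (m' - m) * (norm m' + norm m)) \<longlongrightarrow> 0) (at m)" by simp
  then have "((\<lambda>m'. band_dist f m' - band_dist f m) \<longlongrightarrow> 0) (at m)"
    by (rule Lim_null_comparison[rotated]) (use band_dist_lipschitz in \<open>auto intro: always_eventually\<close>)
  then show "isCont (band_dist f) m" unfolding isCont_def by (rule LIM_zero_cancel)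
qed

text \<open>The factor 2 is that of the derivative of the self-convolution at \<open>f0\<close>,
  which sends h to the convolution of 2 f0 with h.\<close>

locale convolution_BvM = H_seminorm B S \<delta> "\<lambda>w. unif_norm (conv_form B (2 *\<^sub>R f0) w)" C
  for B S \<delta> C and f0 :: L2 +
  assumes d: "\<delta> > 1/2" and S: "S > 0"
begin

abbreviation "N w \<equiv> unif_norm (conv_form B (2 *\<^sub>R f0) w)"
abbreviation "scaled n f x \<equiv> (\<lambda>i. sqrt (real n) * (basis_coeff B f i - x i)) :: coeffs"

lemma d0: "\<delta> > 0" using d by simp

lemma scaled_in_H: "x \<in> H_space B \<delta> \<Longrightarrow> scaled n f x \<in> H_space B \<delta>"
  by (intro H_space_scale H_space_diff[OF B] basis_coeff_in_H[OF B d0])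

lemma self_convol_in_band_iff:
  assumes "n > 0"
  shows "self_convol f \<in> credible_band n k R x \<longleftrightarrow> sqrt (real n) * band_dist f (post_mean k x) \<le> R x"
proof -
  have "self_convol f \<in> periodic_C"
    using continuous_convol[OF B S] by (simp add: periodic_C_def self_convol_def convol_periodic)
  then show ?thesis using assms by (simp add: credible_band_def band_dist_def field_simps)
qed

text \<open>Two errors occur: the quadratic remainder of the self-convolution, and the replacement
  of the centre m by the data x, which costs N of the rescaled difference of m and x.\<close>

lemma linearization:
  assumes x: "x \<in> H_space B \<delta>"
  shows "\<bar>sqrt (real n) * band_dist f m - N (scaled n f x)\<bar> \<le>
    sqrt (real n) * (2 * norm (m - f0) * norm (f - m) + (norm (f - m))\<^sup>2) + N (scaled n m x)"
proof -
  let ?b = "basis_coeff B" and ?s = "sqrt (real n)"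
  let ?L = "convol (2 *\<^sub>R f0) (f - m)"
  let ?E = "\<lambda>t. 2 * convol (m - f0) (f - m) t + convol (f - m) (f - m) t"
  let ?e = "2 * norm (m - f0) * norm (f - m) + (norm (f - m))\<^sup>2"
  have E: "\<bar>?E t\<bar> \<le> ?e" for t
    using abs_convol_le[of "m - f0" "f - m" t] abs_convol_le[of "f - m" "f - m" t]
    by (simp add: power2_eq_square)
  have E': "\<bar>- ?E t\<bar> \<le> ?e" for t using E[of t] by simp
  have eq: "(\<lambda>t. self_convol f t - self_convol m t) = (\<lambda>t. ?L t + ?E t)"
    by (intro ext self_convol_diff)
  have "band_dist f m \<le> unif_norm ?L + ?e"
  proof -
    have "unif_norm (\<lambda>t. ?L t + ?E t) \<le> unif_norm ?L + unif_norm ?E"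
      by (rule unif_norm_triangle[OF abs_convol_le E])
    moreover have "unif_norm ?E \<le> ?e" by (rule unif_norm_le[OF E])
    ultimately show ?thesis unfolding band_dist_def eq by linarith
  qed
  moreover have "unif_norm ?L \<le> band_dist f m + ?e"
  proof -
    \<comment> \<open>For the reverse bound, the linear part is the full difference minus the
      remainder.\<close>
    have "unif_norm (\<lambda>t. (?L t + ?E t) + - ?E t) \<le> unif_norm (\<lambda>t. ?L t + ?E t) + unif_norm (\<lambda>t. - ?E t)"
      by (rule unif_norm_triangle[OF _ E'], rule abs_self_convol_diff_le[of f _ m, unfolded self_convol_diff[of f _ m f0]])
    moreover have "unif_norm (\<lambda>t. - ?E t) \<le> ?e" by (rule unif_norm_le[OF E'])
    ultimately show ?thesis unfolding band_dist_def eq by (simp only: add.right_inverse add.assoc add_0_right)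
  qed
  ultimately have "\<bar>band_dist f m - unif_norm ?L\<bar> \<le> ?e" by linarith
  then have "?s * \<bar>band_dist f m - unif_norm ?L\<bar> \<le> ?s * ?e" by (intro mult_left_mono) auto
  then have 1: "\<bar>?s * band_dist f m - ?s * unif_norm ?L\<bar> \<le> ?s * ?e"
    by (simp add: abs_mult right_diff_distrib[symmetric])
  have bH: "?b g \<in> H_space B \<delta>" for g by (rule basis_coeff_in_H[OF B d0])
  have "?s * unif_norm ?L = N (\<lambda>i. ?s * ?b (f - m) i)"
  proof -
    have "conv_form B (2 *\<^sub>R f0) (?b (f - m)) = ?L" by (rule ext) (rule conv_form_basis_coeff[OF B])
    then show ?thesis using scale[OF bH, of ?s "f - m"] by simp
  qed
  also have "(\<lambda>i. ?s * ?b (f - m) i) = (\<lambda>i. scaled n f x i - scaled n m x i)"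
    by (auto simp: basis_coeff_diff right_diff_distrib)
  finally have 2: "?s * unif_norm ?L = N (\<lambda>i. scaled n f x i - scaled n m x i)" .
  have "N (scaled n f x) \<le> ?s * unif_norm ?L + N (scaled n m x)"
    using triangle[OF H_space_diff[OF B scaled_in_H[OF x] scaled_in_H[OF x]] scaled_in_H[OF x], of n f n m n m]
    by (simp add: 2)
  moreover have "?s * unif_norm ?L \<le> N (scaled n f x) + N (scaled n m x)"
    using triangle[OF scaled_in_H[OF x] H_space_scale[OF scaled_in_H[OF x]], of n f "-1" n m]
      scale[OF scaled_in_H[OF x], of "-1" n m] by (simp add: 2)
  ultimately show ?thesis using 1 by linarith
qed

text \<open>Since M is at least 1, both f and m lie within q = sqrt (M r) of \<open>f0\<close>,
  hence within 2 q of each other; the remainder is at most 4 q^2 + 4 q^2, which is the origin of the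
  constant 8.\<close>

lemma linearization_near_truth:
  assumes x: "x \<in> H_space B \<delta>" and M: "M \<ge> 1"
    and m: "(norm (m - f0))\<^sup>2 \<le> M * r" and f: "(norm (f - f0))\<^sup>2 \<le> r"
    and r: "8 * M * sqrt (real n) * r \<le> \<eta> / 2" and mx: "C * (sqrt (real n) * H_dist B \<delta> (basis_coeff B m) x) \<le> \<eta> / 2"
  shows "\<bar>sqrt (real n) * band_dist f m - N (scaled n f x)\<bar> \<le> \<eta>"
proof -
  have r0: "r \<ge> 0" using f zero_le_power2[of "norm (f - f0)"] by linarith
  define q where "q = sqrt (M * r)"
  have q: "q \<ge> 0" "q\<^sup>2 = M * r" using M r0 by (auto simp: q_def)
  have m': "norm (m - f0) \<le> q" by (rule power2_le_imp_le[OF _ q(1)]) (simp only: q(2) m)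
  have "r \<le> M * r" using M r0 mult_right_mono[of 1 M r] by simp
  then have "(norm (f - f0))\<^sup>2 \<le> q\<^sup>2" unfolding q(2) using f by linarith
  then have f': "norm (f - f0) \<le> q" by (rule power2_le_imp_le[OF _ q(1)])
  have fm: "norm (f - m) \<le> 2 * q"
    using norm_triangle_ineq4[of "f - f0" "m - f0"] m' f' by simp
  have "2 * norm (m - f0) * norm (f - m) \<le> 2 * q * (2 * q)"
    using m' fm q by (intro mult_mono) auto
  moreover have "(norm (f - m))\<^sup>2 \<le> (2 * q)\<^sup>2" using fm by (intro power_mono) auto
  ultimately have "2 * norm (m - f0) * norm (f - m) + (norm (f - m))\<^sup>2 \<le> 2 * q * (2 * q) + (2 * q)\<^sup>2"
    by linarith
  also have "\<dots> = 8 * (M * r)" unfolding q(2)[symmetric] by (simp add: power2_eq_square)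
  finally have "2 * norm (m - f0) * norm (f - m) + (norm (f - m))\<^sup>2 \<le> 8 * (M * r)" .
  then have "sqrt (real n) * (2 * norm (m - f0) * norm (f - m) + (norm (f - m))\<^sup>2) \<le> sqrt (real n) * (8 * (M * r))"
    by (intro mult_left_mono) auto
  also have "\<dots> \<le> \<eta> / 2" using r by (simp add: mult_ac)
  finally have 1: "sqrt (real n) * (2 * norm (m - f0) * norm (f - m) + (norm (f - m))\<^sup>2) \<le> \<eta> / 2" .
  have "N (scaled n m x) \<le> C * H_norm B \<delta> (scaled n m x)" by (rule bound[OF scaled_in_H[OF x]])
  also have "H_norm B \<delta> (scaled n m x) = sqrt (real n) * H_dist B \<delta> (basis_coeff B m) x"
    by (simp add: H_norm_scale H_dist_def)
  finally have "N (scaled n m x) \<le> \<eta> / 2" using mx by simp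
  with 1 show ?thesis using linearization[OF x, of n f m] by linarith
qed

lemma measure_rescaled_posterior:
  assumes \<mu>: "prob_space (k x)" "sets (k x) = sets borel" and x: "x \<in> H_space B \<delta>"
  shows "prob_space (rescaled_posterior B \<delta> n k x)"
    and "measure (rescaled_posterior B \<delta> n k x) {w \<in> H_space B \<delta>. N w \<le> a} = measure (k x) {f. N (scaled n f x) \<le> a}"
    and "{f. N (scaled n f x) \<le> a} \<in> sets (k x)"
proof -
  have "(\<lambda>f i. (- sqrt (real n)) * x i + sqrt (real n) * basis_coeff B f i) \<in> measurable borel (H_borel B \<delta>)"
    by (rule measurable_compose[OF basis_coeff_measurable[OF B d0] H_affine_measurable[OF B H_space_scale[OF x]]])
  then have m: "(\<lambda>f. scaled n f x) \<in> measurable (k x) (H_borel B \<delta>)"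
    by (simp add: right_diff_distrib measurable_cong_sets[OF \<mu>(2) refl])
  show "prob_space (rescaled_posterior B \<delta> n k x)"
    unfolding rescaled_posterior_def by (rule prob_space.prob_space_distr[OF \<mu>(1) m])
  have S: "{w \<in> H_space B \<delta>. N w \<le> a} \<in> sets (H_borel B \<delta>)"
    unfolding space_H_borel[OF B, symmetric] using measurable by measurable
  have sp: "space (k x) = UNIV" using sets_eq_imp_space_eq[OF \<mu>(2)] by simp
  have eq: "(\<lambda>f. scaled n f x) -` {w \<in> H_space B \<delta>. N w \<le> a} \<inter> space (k x) = {f. N (scaled n f x) \<le> a}"
    using scaled_in_H[OF x] by (auto simp: sp)
  show "measure (rescaled_posterior B \<delta> n k x) {w \<in> H_space B \<delta>. N w \<le> a} = measure (k x) {f. N (scaled n f x) \<le> a}"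
    unfolding rescaled_posterior_def by (subst measure_distr[OF m S]) (simp only: eq)
  show "{f. N (scaled n f x) \<le> a} \<in> sets (k x)" using measurable_sets[OF m S] by (simp only: eq)
qed

text \<open>If R x were at least a, every f near \<open>f0\<close> whose rescaled N is at most a -
  \<eta> would lie in the band, so such f would have posterior mass at most 1 - \<alpha> +
  \<epsilon>; the metric comparison makes this mass at least \<open>cdf law (a - 2 * \<eta>)\<close>
  minus \<epsilon>. The lower bound on R x is symmetric.\<close>

lemma radius_bounds:
  assumes n: "n > 0" and \<mu>: "prob_space (k x)" "sets (k x) = sets borel" and x: "x \<in> H_space B \<delta>"
    and M: "M \<ge> 1" and \<eta>: "\<eta> > 0" and \<epsilon>: "\<epsilon> < 1"
    and m: "(norm (post_mean k x - f0))\<^sup>2 \<le> M * \<bar>r\<bar>"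
    and contr: "measure (k x) {f. (norm (f - f0))\<^sup>2 > r} \<le> \<epsilon>"
    and r: "8 * M * sqrt (real n) * \<bar>r\<bar> \<le> \<eta> / 2"
    and mx: "C * (sqrt (real n) * H_dist B \<delta> (basis_coeff B (post_mean k x)) x) \<le> \<eta> / 2"
    and BL: "(1 + C / \<eta>) * BL_dist (H_space B \<delta>) (H_dist B \<delta>) (rescaled_posterior B \<delta> n k x) (white_noise B \<delta>) \<le> \<epsilon>"
    and level: "measure (k x) (self_convol -` credible_band n k R x) = 1 - \<alpha>" "\<alpha> < 1"
  shows "0 \<le> R x"
    and "1 - \<alpha> + 2 * \<epsilon> < cdf law (a - 2 * \<eta>) \<Longrightarrow> R x < a"
    and "cdf law (b + 2 * \<eta>) + 2 * \<epsilon> < 1 - \<alpha> \<Longrightarrow> b < R x"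
    and "\<bar>sqrt (real n) * band_dist f0 (post_mean k x) - N (scaled n f0 x)\<bar> \<le> \<eta>"
proof -
  interpret P: prob_space "k x" by fact
  let ?m = "post_mean k x" and ?s = "sqrt (real n)"
  let ?band = "self_convol -` credible_band n k R x"
  let ?far = "{f. (norm (f - f0))\<^sup>2 > r}"
  let ?A = "\<lambda>a. {f. N (scaled n f x) \<le> a}"
  have sp: "space (k x) = UNIV" using sets_eq_imp_space_eq[OF \<mu>(2)] by simp
  \<comment> \<open>A negative r would make every f count as far from \<open>f0\<close>, with
    posterior mass 1 > \<epsilon>.\<close>
  have r0: "r \<ge> 0"
  proof (rule ccontr)
    assume "\<not> ?thesis"
    then have "?far = space (k x)"
      by (auto simp: sp not_le intro: less_le_trans)
    then show False using contr \<epsilon> P.prob_space by simp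
  qed
  have near: "\<bar>?s * band_dist f ?m - N (scaled n f x)\<bar> \<le> \<eta>" if "f \<notin> ?far" for f
    using linearization_near_truth[OF x M, of ?m r f n \<eta>] m r r0 mx that by simp
  show "\<bar>?s * band_dist f0 ?m - N (scaled n f0 x)\<bar> \<le> \<eta>" by (rule near) (use r0 in simp)
  have band: "?band = {f. ?s * band_dist f ?m \<le> R x}"
    using self_convol_in_band_iff[OF n] by auto
  \<comment> \<open>A band of positive posterior mass has a member, and its nonnegative distance to
    the centre bounds R x from below.\<close>
  have "?band \<noteq> {}" using level by auto
  then obtain f where "?s * band_dist f ?m \<le> R x" unfolding band by blast
  moreover have "0 \<le> ?s * band_dist f ?m" by (simp add: band_dist_nonneg)
  ultimately show "0 \<le> R x" by linarith
  \<comment> \<open>\<open>measure\<close> is 0 off the sigma-algebra, so the positive level 1 -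
    \<alpha> already shows that the band is measurable.\<close>
  have bandS: "?band \<in> sets (k x)"
    using level measure_notin_sets[of ?band "k x"] by fastforce
  have "open ?far" by (intro open_Collect_less continuous_intros)
  then have farS: "?far \<in> sets (k x)" using \<mu>(2) by simp
  note AS = measure_rescaled_posterior(3)[where k = k and x = x and n = n, OF \<mu> x]
  note rp = measure_rescaled_posterior(1)[where k = k and x = x and n = n, OF \<mu> x]
  have rps: "sets (rescaled_posterior B \<delta> n k x) = sets (H_borel B \<delta>)" by (simp add: rescaled_posterior_def)
  note BLn = BL_dist_norm_le[OF rp rps \<eta>, unfolded measure_rescaled_posterior(2)[where k = k and x = x, OF \<mu> x]]
  show "R x < a" if a: "1 - \<alpha> + 2 * \<epsilon> < cdf law (a - 2 * \<eta>)"
  proof (rule ccontr)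
    assume "\<not> R x < a"
    then have "?A (a - \<eta>) \<subseteq> ?band \<union> ?far" using near unfolding band by fastforce
    then have "measure (k x) (?A (a - \<eta>)) \<le> measure (k x) (?band \<union> ?far)"
      using bandS farS by (intro P.finite_measure_mono) auto
    also have "\<dots> \<le> measure (k x) ?band + measure (k x) ?far"
      using bandS farS by (rule measure_Un_le)
    also have "\<dots> \<le> 1 - \<alpha> + \<epsilon>" using level contr by simp
    finally show False using BLn(2)[of "a - \<eta>"] BL a by simp
  qed
  show "b < R x" if b: "cdf law (b + 2 * \<eta>) + 2 * \<epsilon> < 1 - \<alpha>"
  proof (rule ccontr)
    assume "\<not> b < R x"
    then have "?band \<subseteq> ?A (b + \<eta>) \<union> ?far" using near unfolding band by fastforce
    then have "1 - \<alpha> \<le> measure (k x) (?A (b + \<eta>) \<union> ?far)"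
      unfolding level(1)[symmetric] using AS farS by (intro P.finite_measure_mono) auto
    also have "\<dots> \<le> measure (k x) (?A (b + \<eta>)) + measure (k x) ?far"
      using AS farS by (intro measure_Un_le)
    also have "\<dots> \<le> measure (k x) (?A (b + \<eta>)) + \<epsilon>" using contr by simp
    finally show False using BLn(1)[of "b + \<eta>"] BL b by (simp add: add.assoc)
  qed
qed

lemma coverage_measurable:
  assumes n: "n > 0" and K: "K \<in> measurable (H_borel B \<delta>) (prob_algebra borel)"
    and R: "R \<in> borel_measurable (H_borel B \<delta>)"
  shows "{x \<in> H_space B \<delta>. self_convol f \<in> credible_band n K R x} \<in> sets (H_borel B \<delta>)"
proof -
  have "(\<lambda>x. post_mean K x) \<in> borel_measurable (H_borel B \<delta>)"
    unfolding post_mean_def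
    by (rule measurable_compose[OF measurable_prob_algebraD[OF K] integral_measurable_subprob_algebra]) simp
  then have "(\<lambda>x. band_dist f (post_mean K x)) \<in> borel_measurable (H_borel B \<delta>)"
    by (rule measurable_compose) (rule borel_measurable_continuous_onI[OF continuous_band_dist])
  then have "{x \<in> space (H_borel B \<delta>). sqrt (real n) * band_dist f (post_mean K x) \<le> R x} \<in> sets (H_borel B \<delta>)"
    using R by measurable
  then show ?thesis by (simp add: self_convol_in_band_iff[OF n] space_H_borel[OF B])
qed

end

section \<open>Coverage\<close>

text \<open>An outer measure is attained by a measurable superset, so a bound in outer probability
  becomes a pointwise statement off a measurable event.\<close>

lemma outer_measure_cover:
  assumes "outer_measure_of M {x \<in> space M. Q x} \<le> e"
  obtains E where "E \<in> sets M" "emeasure M E \<le> e" "\<And>x. x \<in> space M - E \<Longrightarrow> \<not> Q x"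
  using outer_measure_of_attain[of "{x \<in> space M. Q x}" M] assms by force

lemma little_oP_cover:
  assumes "little_oP P Z r" "c > 0" "e > 0"
  shows "\<forall>\<^sub>F n in sequentially. \<exists>E\<in>sets (P n). emeasure (P n) E \<le> ennreal e \<and>
    (\<forall>x\<in>space (P n) - E. \<bar>Z n x\<bar> \<le> c * \<bar>r n\<bar>)"
proof -
  have "(\<lambda>n. outer_measure_of (P n) {x \<in> space (P n). \<bar>Z n x\<bar> > c * \<bar>r n\<bar>}) \<longlonglongrightarrow> 0"
    using assms by (simp add: little_oP_def)
  moreover have "(0::ennreal) < ennreal e" using assms(3) by simp
  ultimately have "\<forall>\<^sub>F n in sequentially.
      outer_measure_of (P n) {x \<in> space (P n). \<bar>Z n x\<bar> > c * \<bar>r n\<bar>} < ennreal e"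
    by (rule order_tendstoD)
  then show ?thesis
    by eventually_elim (rule outer_measure_cover[OF less_imp_le], assumption, force)
qed

lemma big_OP_cover:
  assumes "big_OP P Z r" "e > 0"
  obtains M where "\<forall>\<^sub>F n in sequentially. \<exists>E\<in>sets (P n). emeasure (P n) E \<le> ennreal e \<and>
    (\<forall>x\<in>space (P n) - E. \<bar>Z n x\<bar> \<le> M * \<bar>r n\<bar>)"
proof -
  obtain M where "\<forall>\<^sub>F n in sequentially.
      outer_measure_of (P n) {x \<in> space (P n). \<bar>Z n x\<bar> > M * \<bar>r n\<bar>} \<le> ennreal e"
    using assms unfolding big_OP_def by blast
  then have "\<forall>\<^sub>F n in sequentially. \<exists>E\<in>sets (P n). emeasure (P n) E \<le> ennreal e \<and>
      (\<forall>x\<in>space (P n) - E. \<bar>Z n x\<bar> \<le> M * \<bar>r n\<bar>)"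
    by eventually_elim (rule outer_measure_cover, assumption, force)
  then show ?thesis by (rule that)
qed

lemma is_posterior_kernel:
  assumes "regular_basis S B" "is_posterior B \<delta> n prior k" "x \<in> H_space B \<delta>"
  shows "prob_space (k x)" "sets (k x) = sets borel"
proof -
  have "k x \<in> space (prob_algebra borel)"
    using assms by (intro measurable_space[of k "H_borel B \<delta>"]) (auto simp: is_posterior_def space_H_borel)
  then show "prob_space (k x)" "sets (k x) = sets borel" by (auto simp: space_prob_algebra)
qed

context convolution_BvM
begin

text \<open>Each of the four stochastic hypotheses receives an exceptional event of probability at
  most e / 4, and the equation for the radius a null set. The thresholds are fitted to the
  comparison at a fixed data point: \<epsilon> / (1 + C / \<eta>) for the metric and \<eta> / (2 C),
  relative to 1 / sqrt n, for the distance of the mean to the data.\<close>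

lemma eventually_radius_bounds:
  fixes K :: "nat \<Rightarrow> coeffs \<Rightarrow> L2 measure" and R :: "nat \<Rightarrow> coeffs \<Rightarrow> real"
  assumes posterior: "\<And>n. n > 0 \<Longrightarrow> is_posterior B \<delta> n prior (K n)"
    and BvM: "weak_BvM B \<delta> f0 K"
    and mean_data: "little_oP (\<lambda>n. data_law B \<delta> n f0)
      (\<lambda>n x. H_dist B \<delta> (basis_coeff B (post_mean (K n) x)) x) (\<lambda>n. 1 / sqrt (real n))"
    and rate: "r \<in> o(\<lambda>n. 1 / sqrt (real n))"
    and mean_rate: "big_OP (\<lambda>n. data_law B \<delta> n f0)
      (\<lambda>n x. (norm (post_mean (K n) x - f0))\<^sup>2) r"
    and contraction: "little_oP (\<lambda>n. data_law B \<delta> n f0)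
      (\<lambda>n x. measure (K n x) {f. (norm (f - f0))\<^sup>2 > r n}) (\<lambda>_. 1)"
    and level: "\<alpha> < 1"
    and radius: "\<And>n. n > 0 \<Longrightarrow> AE x in data_law B \<delta> n f0.
      measure (K n x) (self_convol -` credible_band n (K n) (R n) x) = 1 - \<alpha>"
    and \<eta>: "\<eta> > 0" and \<epsilon>: "0 < \<epsilon>" "\<epsilon> < 1" and e: "e > 0"
  shows "\<forall>\<^sub>F n in sequentially. \<exists>E\<in>sets (H_borel B \<delta>). measure (data_law B \<delta> n f0) E \<le> e \<and>
    (\<forall>x\<in>H_space B \<delta> - E. 0 \<le> R n x \<and>
      (\<forall>a. 1 - \<alpha> + 2 * \<epsilon> < cdf law (a - 2 * \<eta>) \<longrightarrow> R n x < a) \<and>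
      (\<forall>b. cdf law (b + 2 * \<eta>) + 2 * \<epsilon> < 1 - \<alpha> \<longrightarrow> b < R n x) \<and>
      \<bar>sqrt (real n) * band_dist f0 (post_mean (K n) x) - N (scaled n f0 x)\<bar> \<le> \<eta>)"
proof -
  let ?P = "\<lambda>n. data_law B \<delta> n f0"
  let ?BL = "\<lambda>n x. BL_dist (H_space B \<delta>) (H_dist B \<delta>) (rescaled_posterior B \<delta> n (K n) x) (white_noise B \<delta>)"
  let ?C = "1 + C / \<eta>"
  have C1: "?C > 0" using C \<eta> by (auto intro: add_pos_pos)
  have C2: "2 * C > 0" using C by simp
  have e4: "e / 4 > 0" using e by simp
  obtain M0 where M0: "\<forall>\<^sub>F n in sequentially. \<exists>E\<in>sets (?P n). emeasure (?P n) E \<le> ennreal (e / 4) \<and>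
      (\<forall>x\<in>space (?P n) - E. \<bar>(norm (post_mean (K n) x - f0))\<^sup>2\<bar> \<le> M0 * \<bar>r n\<bar>)"
    using big_OP_cover[OF mean_rate e4] by blast
  \<comment> \<open>Raised to at least 1, so that one ball around \<open>f0\<close> contains both
    the posterior mean and the f near \<open>f0\<close>.\<close>
  define M where "M = max 1 M0"
  have M: "M \<ge> 1" "M0 \<le> M" by (auto simp: M_def)
  \<comment> \<open>This threshold makes 8 M sqrt n |r n| at most \<eta> / 2.\<close>
  have "\<eta> / (16 * M) > 0" using \<eta> M by simp
  from landau_o.smallD[OF rate this]
  have rate': "\<forall>\<^sub>F n in sequentially. \<bar>r n\<bar> \<le> \<eta> / (16 * M) * (1 / sqrt (real n))" by simp
  show ?thesis
    using M0 rate' eventually_gt_at_top[of 0]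
      little_oP_cover[OF contraction \<epsilon>(1) e4]
      little_oP_cover[OF BvM[unfolded weak_BvM_def] divide_pos_pos[OF \<epsilon>(1) C1] e4]
      little_oP_cover[OF mean_data divide_pos_pos[OF \<eta> C2] e4]
  proof eventually_elim
    case (elim n)
    interpret P: prob_space "?P n" by (rule prob_space_data_law[OF B d0])
    have sp: "space (?P n) = H_space B \<delta>" by (rule space_data_law[OF B])
    have n: "n > 0" by fact
    obtain E1 where E1: "E1 \<in> sets (?P n)" "emeasure (?P n) E1 \<le> ennreal (e / 4)"
      "\<And>x. x \<in> H_space B \<delta> - E1 \<Longrightarrow> (norm (post_mean (K n) x - f0))\<^sup>2 \<le> M0 * \<bar>r n\<bar>"
      using elim(1) sp by auto
    obtain E2 where E2: "E2 \<in> sets (?P n)" "emeasure (?P n) E2 \<le> ennreal (e / 4)"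
      "\<And>x. x \<in> H_space B \<delta> - E2 \<Longrightarrow> measure (K n x) {f. (norm (f - f0))\<^sup>2 > r n} \<le> \<epsilon>"
      using elim(4) sp by auto
    obtain E3 where E3: "E3 \<in> sets (?P n)" "emeasure (?P n) E3 \<le> ennreal (e / 4)"
      "\<And>x. x \<in> H_space B \<delta> - E3 \<Longrightarrow> \<bar>?BL n x\<bar> \<le> \<epsilon> / ?C * \<bar>1\<bar>"
      using elim(5) sp by blast
    obtain E4 where E4: "E4 \<in> sets (?P n)" "emeasure (?P n) E4 \<le> ennreal (e / 4)"
      "\<And>x. x \<in> H_space B \<delta> - E4 \<Longrightarrow>
        \<bar>H_dist B \<delta> (basis_coeff B (post_mean (K n) x)) x\<bar> \<le> \<eta> / (2 * C) * \<bar>1 / sqrt (real n)\<bar>"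
      using elim(6) sp by (metis (no_types, lifting))
    obtain E0 where E0: "E0 \<in> null_sets (?P n)"
      "{x \<in> space (?P n). \<not> measure (K n x) (self_convol -` credible_band n (K n) (R n) x) = 1 - \<alpha>} \<subseteq> E0"
      using radius[OF n] unfolding eventually_ae_filter by blast
    define E where "E = E1 \<union> E2 \<union> E3 \<union> E4 \<union> E0"
    have m: "measure (?P n) F \<le> e / 4" if "emeasure (?P n) F \<le> ennreal (e / 4)" for F
      using that e by (simp add: P.emeasure_eq_measure)
    have "measure (?P n) E \<le> measure (?P n) E1 + measure (?P n) E2 + measure (?P n) E3 + measure (?P n) E4 + measure (?P n) E0"
      unfolding E_def using E1(1) E2(1) E3(1) E4(1) E0(1)
      by (intro order_trans[OF measure_Un_le] add_mono order_refl sets.Un) auto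
    also have "\<dots> \<le> e"
      using m[OF E1(2)] m[OF E2(2)] m[OF E3(2)] m[OF E4(2)] E0(1) by (auto simp: null_sets_def measure_def)
    finally have Ee: "measure (?P n) E \<le> e" .
    have ES: "E \<in> sets (H_borel B \<delta>)"
      using E1(1) E2(1) E3(1) E4(1) E0(1) unfolding E_def sets_data_law[symmetric, of B \<delta> n f0] by auto
    have "0 \<le> R n x \<and>
        (\<forall>a. 1 - \<alpha> + 2 * \<epsilon> < cdf law (a - 2 * \<eta>) \<longrightarrow> R n x < a) \<and>
        (\<forall>b. cdf law (b + 2 * \<eta>) + 2 * \<epsilon> < 1 - \<alpha> \<longrightarrow> b < R n x) \<and>
        \<bar>sqrt (real n) * band_dist f0 (post_mean (K n) x) - N (scaled n f0 x)\<bar> \<le> \<eta>"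
      if x: "x \<in> H_space B \<delta> - E" for x
    proof -
      have xH: "x \<in> H_space B \<delta>" using x by simp
      have sq: "sqrt (real n) > 0" using n by simp
      have 1: "(norm (post_mean (K n) x - f0))\<^sup>2 \<le> M * \<bar>r n\<bar>"
        using E1(3)[of x] x M(2) mult_right_mono[OF M(2), of "\<bar>r n\<bar>"] by (auto simp: E_def)
      have 2: "measure (K n x) {f. (norm (f - f0))\<^sup>2 > r n} \<le> \<epsilon>"
        using E2(3)[of x] x by (auto simp: E_def)
      have "8 * M * sqrt (real n) * \<bar>r n\<bar> \<le> 8 * M * sqrt (real n) * (\<eta> / (16 * M) * (1 / sqrt (real n)))"
        using elim(2) M by (intro mult_left_mono) auto
      also have "\<dots> = \<eta> / 2" using M sq by simp
      finally have 3: "8 * M * sqrt (real n) * \<bar>r n\<bar> \<le> \<eta> / 2" .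
      have "H_dist B \<delta> (basis_coeff B (post_mean (K n) x)) x \<le> \<eta> / (2 * C) * (1 / sqrt (real n))"
        using E4(3)[of x] x by (auto simp: E_def)
      then have "C * (sqrt (real n) * H_dist B \<delta> (basis_coeff B (post_mean (K n) x)) x) \<le>
          C * (sqrt (real n) * (\<eta> / (2 * C) * (1 / sqrt (real n))))"
        using C by (intro mult_left_mono) auto
      also have "\<dots> = \<eta> / 2" using C sq by simp
      finally have 4: "C * (sqrt (real n) * H_dist B \<delta> (basis_coeff B (post_mean (K n) x)) x) \<le> \<eta> / 2" .
      have "\<bar>?BL n x\<bar> \<le> \<epsilon> / ?C" using E3(3)[of x] x by (auto simp: E_def)
      then have "?BL n x \<le> \<epsilon> / ?C" by linarith
      then have "?C * ?BL n x \<le> ?C * (\<epsilon> / ?C)" using C1 by (intro mult_left_mono) auto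
      then have 5: "?C * ?BL n x \<le> \<epsilon>" using C1 by simp
      have 6: "measure (K n x) (self_convol -` credible_band n (K n) (R n) x) = 1 - \<alpha>"
        using E0(2) x sp by (auto simp: E_def)
      note rb = radius_bounds[OF n is_posterior_kernel[OF B posterior[OF n] xH] xH M(1) \<eta> \<epsilon>(2) 1 2 3 4 5 6 level]
      show ?thesis using rb by blast
    qed
    with Ee ES show ?case by blast
  qed
qed

end

lemma sobolev_scale:
  assumes "f \<in> sobolev B s"
  shows "c *\<^sub>R f \<in> sobolev B s"
proof -
  have "(\<lambda>i. c\<^sup>2 * (case i of (l, k) \<Rightarrow> char_seq B l powr (2 * s) * (inner (elem B l k) f)\<^sup>2)) summable_on idx B"
    using assms by (intro summable_on_cmult_right) (simp add: sobolev_def)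
  then show ?thesis
    by (simp add: sobolev_def case_prod_unfold power_mult_distrib mult.left_commute)
qed

theorem theorem2:
  fixes B :: l2_basis and S :: nat and s \<delta> \<alpha> :: real and f0 :: L2 and prior :: "L2 measure"
    and K :: "nat \<Rightarrow> coeffs \<Rightarrow> L2 measure" and r :: "nat \<Rightarrow> real" and R :: "nat \<Rightarrow> coeffs \<Rightarrow> real"
  assumes delta: "\<delta> > 1 / 2"
    and basis: "regular_basis S B" "fourier_equivalent B s"
    and smoothness: "s > 1 / 2" "s < real S"
    and truth: "f0 \<in> sobolev B s" "f0 \<noteq> 0"
    and prior: "prob_space prior" "sets prior = sets borel"
    and posterior: "\<And>n. n > 0 \<Longrightarrow> is_posterior B \<delta> n prior (K n)"
    and mean_exists: "\<And>n. n > 0 \<Longrightarrow> AE x in data_law B \<delta> n f0. integrable (K n x) (\<lambda>f. f)"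
    and BvM: "weak_BvM B \<delta> f0 K"
    and mean_data: "little_oP (\<lambda>n. data_law B \<delta> n f0)
      (\<lambda>n x. H_dist B \<delta> (basis_coeff B (post_mean (K n) x)) x) (\<lambda>n. 1 / sqrt (real n))"
    and rate: "r \<in> o(\<lambda>n. 1 / sqrt (real n))"
    and mean_rate: "big_OP (\<lambda>n. data_law B \<delta> n f0)
      (\<lambda>n x. (norm (post_mean (K n) x - f0))\<^sup>2) r"
    and contraction: "little_oP (\<lambda>n. data_law B \<delta> n f0)
      (\<lambda>n x. measure (K n x) {f. (norm (f - f0))\<^sup>2 > r n}) (\<lambda>_. 1)"
    and level: "0 < \<alpha>" "\<alpha> < 1"
    and radius_measurable: "\<And>n. n > 0 \<Longrightarrow> R n \<in> borel_measurable (H_borel B \<delta>)"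
    and radius: "\<And>n. n > 0 \<Longrightarrow> AE x in data_law B \<delta> n f0.
      measure (K n x) (self_convol -` credible_band n (K n) (R n) x) = 1 - \<alpha>"
  shows "(\<lambda>n. measure (data_law B \<delta> n f0)
      {x \<in> space (data_law B \<delta> n f0). self_convol f0 \<in> credible_band n (K n) (R n) x}) \<longlonglongrightarrow> 1 - \<alpha>
    \<and> big_OP (\<lambda>n. data_law B \<delta> n f0) R (\<lambda>_. 1)"
proof -
  have d0: "\<delta> > 0" using delta by simp
  have S: "S > 0" using smoothness by (cases S) auto
  obtain C where "H_seminorm B S \<delta> (\<lambda>w. unif_norm (conv_form B (2 *\<^sub>R f0) w)) C"
    using H_seminorm_conv_form[OF basis smoothness(1) d0 sobolev_scale[OF truth(1)]] by blast
  then interpret convolution_BvM B S \<delta> C f0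
    by (intro convolution_BvM.intro convolution_BvM_axioms.intro delta S)
  have "2 *\<^sub>R f0 \<noteq> 0" using truth(2) by simp
  then obtain i where i: "i \<in> idx B" "N (\<lambda>j. if j = i then 1 else 0) > 0"
    using conv_form_nontrivial[OF basis(1)] by blast
  let ?P = "\<lambda>n. data_law B \<delta> n f0"
  let ?T = "\<lambda>n x. sqrt (real n) * band_dist f0 (post_mean (K n) x)"
  let ?cov = "\<lambda>n. {x \<in> space (?P n). self_convol f0 \<in> credible_band n (K n) (R n) x}"
  note good = eventually_radius_bounds[OF posterior BvM mean_data rate mean_rate contraction level(2) radius]
  \<comment> \<open>Near a and b the distribution function is within e / 4 of 1 - \<alpha> + e and 1
    - \<alpha> - e, so it clears 1 - \<alpha> by more than 3 e / 4. The choice \<epsilon> = e / 8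
    requires only 2 \<epsilon> = e / 4.\<close>
  have window: "\<forall>\<^sub>F n in sequentially. \<exists>E\<in>sets (H_borel B \<delta>). measure (?P n) E \<le> e \<and>
      (\<forall>x\<in>H_space B \<delta> - E. 0 \<le> R n x \<and> b < R n x \<and> R n x < a \<and> \<bar>?T n x - N (scaled n f0 x)\<bar> \<le> \<eta>)"
    if \<eta>: "\<eta> > 0" and e: "0 < e" "e < 1"
      and a: "\<forall>y. \<bar>y - a\<bar> \<le> 2 * \<eta> \<longrightarrow> \<bar>cdf law y - (1 - \<alpha> + e)\<bar> < e / 4"
      and b: "\<forall>y. \<bar>y - b\<bar> \<le> 2 * \<eta> \<longrightarrow> \<bar>cdf law y - (1 - \<alpha> - e)\<bar> < e / 4"
    for e \<eta> a b
  proof -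
    have "\<bar>cdf law (a - 2 * \<eta>) - (1 - \<alpha> + e)\<bar> < e / 4" by (rule a[rule_format]) (use \<eta> in simp)
    then have "1 - \<alpha> + 2 * (e / 8) < cdf law (a - 2 * \<eta>)" using e by linarith
    moreover have "\<bar>cdf law (b + 2 * \<eta>) - (1 - \<alpha> - e)\<bar> < e / 4" by (rule b[rule_format]) (use \<eta> in simp)
    then have "cdf law (b + 2 * \<eta>) + 2 * (e / 8) < 1 - \<alpha>" using e by linarith
    ultimately show ?thesis
      using good[OF _ _ \<eta>, of "e / 8" e] e by (auto elim!: eventually_mono)
  qed
  \<comment> \<open>The conditions on e keep both levels strictly between 0 and 1; the smaller of
    the two margins serves both quantiles.\<close>
  have quantiles: "\<exists>\<eta> a b. \<eta> > 0 \<and> (\<forall>y. \<bar>y - a\<bar> \<le> 2 * \<eta> \<longrightarrow> \<bar>cdf law y - (1 - \<alpha> + e)\<bar> < e / 4) \<and>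
      (\<forall>y. \<bar>y - b\<bar> \<le> 2 * \<eta> \<longrightarrow> \<bar>cdf law y - (1 - \<alpha> - e)\<bar> < e / 4)"
    if e: "e > 0" "e < \<alpha>" "e < 1 - \<alpha>" for e
  proof -
    have e4: "e / 4 > 0" using e by simp
    obtain a \<eta>1 where 1: "\<eta>1 > 0" "\<And>y. \<bar>y - a\<bar> \<le> 2 * \<eta>1 \<Longrightarrow> \<bar>cdf law y - (1 - \<alpha> + e)\<bar> < e / 4"
      by (rule cdf_law_quantile[OF delta i _ _ e4, of "1 - \<alpha> + e"]) (use e level in \<open>simp, simp, blast\<close>)
    obtain b \<eta>2 where 2: "\<eta>2 > 0" "\<And>y. \<bar>y - b\<bar> \<le> 2 * \<eta>2 \<Longrightarrow> \<bar>cdf law y - (1 - \<alpha> - e)\<bar> < e / 4"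
      by (rule cdf_law_quantile[OF delta i _ _ e4, of "1 - \<alpha> - e"]) (use e level in \<open>simp, simp, blast\<close>)
    show ?thesis
      by (intro exI[of _ "min \<eta>1 \<eta>2"] exI[of _ a] exI[of _ b]) (use 1 2 in auto)
  qed
  define e0 where "e0 = min \<alpha> (1 - \<alpha>) / 2"
  have e0: "e0 > 0" "e0 < \<alpha>" "e0 < 1 - \<alpha>" using level by (auto simp: e0_def)
  have "(\<lambda>n. measure (?P n) (?cov n)) \<longlonglongrightarrow> 1 - \<alpha>"
  proof (rule LIMSEQ_I)
    fix t :: real assume t: "t > 0"
    \<comment> \<open>The coverage error will be at most e + e / 4 + e, which is below t because e
      \<le> t / 4.\<close>
    define e where "e = min (t / 4) e0"
    have e: "e > 0" "e < \<alpha>" "e < 1 - \<alpha>" "e \<le> t / 4" using t e0 by (auto simp: e_def)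
    obtain \<eta> a b where \<eta>: "\<eta> > 0"
      and a: "\<forall>y. \<bar>y - a\<bar> \<le> 2 * \<eta> \<longrightarrow> \<bar>cdf law y - (1 - \<alpha> + e)\<bar> < e / 4"
      and b: "\<forall>y. \<bar>y - b\<bar> \<le> 2 * \<eta> \<longrightarrow> \<bar>cdf law y - (1 - \<alpha> - e)\<bar> < e / 4"
      using quantiles[OF e(1-3)] by metis
    have "e < 1" using e level by simp
    have "\<forall>\<^sub>F n in sequentially. norm (measure (?P n) (?cov n) - (1 - \<alpha>)) < t"
      using window[OF \<eta> e(1) \<open>e < 1\<close> a b] eventually_gt_at_top[of 0]
    proof eventually_elim
      case (elim n)
      then obtain E where E: "E \<in> sets (H_borel B \<delta>)" "measure (?P n) E \<le> e"
        and good: "\<And>x. x \<in> H_space B \<delta> - E \<Longrightarrow> b < R n x \<and> R n x < a \<and> \<bar>?T n x - N (scaled n f0 x)\<bar> \<le> \<eta>"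
        by blast
      have n: "n > 0" by fact
      interpret P: prob_space "?P n" by (rule prob_space_data_law[OF basis(1) d0])
      let ?L = "\<lambda>c. {x \<in> H_space B \<delta>. N (scaled n f0 x) \<le> c}"
      have cov: "?cov n = {x \<in> H_space B \<delta>. self_convol f0 \<in> credible_band n (K n) (R n) x}"
        by (simp add: space_data_law[OF basis(1)])
      have covS: "?cov n \<in> sets (?P n)"
        unfolding cov sets_data_law
        using posterior[OF n] radius_measurable[OF n] by (intro coverage_measurable n) (auto simp: is_posterior_def)
      have ES: "E \<in> sets (?P n)" using E(1) by (simp add: sets_data_law)
      have LS: "?L c \<in> sets (?P n)" for c using data_law_norm_le(2)[OF d0 n] by (simp add: sets_data_law)
      have L: "measure (?P n) (?L c) = cdf law c" for c by (rule data_law_norm_le(1)[OF d0 n])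
      have mem: "x \<in> ?cov n \<longleftrightarrow> x \<in> H_space B \<delta> \<and> ?T n x \<le> R n x" for x
        unfolding cov using self_convol_in_band_iff[OF n] by simp
      \<comment> \<open>Off E, coverage bounds N at the rescaled error of the data by R n x +
        \<eta>, which is less than a + \<eta>; the distribution function of that value of N is
        exactly \<open>cdf law\<close>.\<close>
      have "?cov n \<subseteq> ?L (a + \<eta>) \<union> E"
      proof
        fix x assume "x \<in> ?cov n"
        then show "x \<in> ?L (a + \<eta>) \<union> E" using good[of x] unfolding mem by force
      qed
      then have "measure (?P n) (?cov n) \<le> measure (?P n) (?L (a + \<eta>) \<union> E)"
        using LS ES by (intro P.finite_measure_mono) auto
      also have "\<dots> \<le> cdf law (a + \<eta>) + measure (?P n) E"
        unfolding L[symmetric] using LS ES by (rule measure_Un_le)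
      finally have "measure (?P n) (?cov n) \<le> cdf law (a + \<eta>) + measure (?P n) E" .
      moreover have "\<bar>cdf law (a + \<eta>) - (1 - \<alpha> + e)\<bar> < e / 4" by (rule a[rule_format]) (use \<eta> in simp)
      ultimately have upper: "measure (?P n) (?cov n) \<le> 1 - \<alpha> + e + e / 4 + e"
        using E(2) by linarith
      \<comment> \<open>Off E, the linearization turns N \<le> b - \<eta> into a statistic of at
        most b, and b is below the radius.\<close>
      have "?L (b - \<eta>) \<subseteq> ?cov n \<union> E"
      proof
        fix x assume "x \<in> ?L (b - \<eta>)"
        then show "x \<in> ?cov n \<union> E" using good[of x] unfolding Un_iff mem by force
      qed
      then have "cdf law (b - \<eta>) \<le> measure (?P n) (?cov n \<union> E)"
        unfolding L[symmetric] using covS ES by (intro P.finite_measure_mono) auto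
      also have "\<dots> \<le> measure (?P n) (?cov n) + measure (?P n) E"
        using covS ES by (rule measure_Un_le)
      finally have "cdf law (b - \<eta>) \<le> measure (?P n) (?cov n) + measure (?P n) E" .
      moreover have "\<bar>cdf law (b - \<eta>) - (1 - \<alpha> - e)\<bar> < e / 4" by (rule b[rule_format]) (use \<eta> in simp)
      ultimately have "1 - \<alpha> - e - e / 4 - e \<le> measure (?P n) (?cov n)"
        using E(2) by linarith
      with upper e(1,4) show ?case by (simp add: abs_less_iff)
    qed
    then show "\<exists>no. \<forall>n\<ge>no. norm (measure (?P n) (?cov n) - (1 - \<alpha>)) < t"
      by (simp add: eventually_sequentially)
  qed
  moreover have "big_OP ?P R (\<lambda>_. 1)"
    unfolding big_OP_def
  proof (intro allI impI)
    fix t :: real assume t: "t > 0"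
    define e where "e = min t e0"
    have e: "e > 0" "e < \<alpha>" "e < 1 - \<alpha>" "e \<le> t" using t e0 by (auto simp: e_def)
    obtain \<eta> a b where \<eta>: "\<eta> > 0"
      and a: "\<forall>y. \<bar>y - a\<bar> \<le> 2 * \<eta> \<longrightarrow> \<bar>cdf law y - (1 - \<alpha> + e)\<bar> < e / 4"
      and b: "\<forall>y. \<bar>y - b\<bar> \<le> 2 * \<eta> \<longrightarrow> \<bar>cdf law y - (1 - \<alpha> - e)\<bar> < e / 4"
      using quantiles[OF e(1-3)] by metis
    have "e < 1" using e level by simp
    \<comment> \<open>The quantile a does not depend on n and serves as the bound; off E the radius
      is nonnegative, so its absolute value is below a.\<close>
    have "\<forall>\<^sub>F n in sequentially. outer_measure_of (?P n) {x \<in> space (?P n). \<bar>R n x\<bar> > a * \<bar>1\<bar>} \<le> ennreal t"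
      using window[OF \<eta> e(1) \<open>e < 1\<close> a b]
    proof eventually_elim
      case (elim n)
      then obtain E where E: "E \<in> sets (H_borel B \<delta>)" "measure (?P n) E \<le> e"
        and good: "\<And>x. x \<in> H_space B \<delta> - E \<Longrightarrow> 0 \<le> R n x \<and> R n x < a"
        by blast
      interpret P: prob_space "?P n" by (rule prob_space_data_law[OF basis(1) d0])
      have ES: "E \<in> sets (?P n)" using E(1) by (simp add: sets_data_law)
      have "{x \<in> space (?P n). \<bar>R n x\<bar> > a * \<bar>1\<bar>} \<subseteq> E"
        using good by (force simp: space_data_law[OF basis(1)])
      then have "outer_measure_of (?P n) {x \<in> space (?P n). \<bar>R n x\<bar> > a * \<bar>1\<bar>} \<le> emeasure (?P n) E"
        using outer_measure_of_mono[of _ E "?P n"] ES by simp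
      also have "\<dots> \<le> ennreal t"
        unfolding P.emeasure_eq_measure using E(2) e(4) by (intro ennreal_leI) simp
      finally show ?case .
    qed
    then show "\<exists>M. \<forall>\<^sub>F n in sequentially. outer_measure_of (?P n) {x \<in> space (?P n). \<bar>R n x\<bar> > M * \<bar>1\<bar>} \<le> ennreal t"
      by blast
  qed
  ultimately show ?thesis by blast
qed

end
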